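(* Let $X=\mathcal A^{\mathbb N}$ and $Y=\mathcal D^{\mathbb N}$ be two full shifts over finite alphabets, with left shifts $T$ and $S$, and let $\pi:X\to Y$ be a one-block factor map. Let $\mathbf a=(a,b)\in\mathbb R^2$ with $a>0$ and $b\ge0$. Let $\Phi_1,\dots,\Phi_d\in\mathcal C_{aa}(X,T)$ satisfy the bounded distortion property. Then the map $Q:\mathbb R^d\to\mathbb R$ defined by $$\mathbf q=(q_1,\dots,q_d)\mapsto P^{\mathbf a}\Big(T,\sum_{i=1}^dq_i\Phi_i\Big)$$ is $C^1$ over $\mathbb R^d$ with $$\nabla Q(q_1,\dots,q_d)=\big((\Phi_1)_*(\mu_{\mathbf q}),\dots,(\Phi_d)_*(\mu_{\mathbf q})\big),$$ where $\nabla$ denotes the gradient and $\mu_{\mathbf q}$ is the unique $\mathbf a$-weighted equilibrium state of $\sum_{i=1}^dq_i\Phi_i$.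
   Context: A one-block factor map $\pi:X\to Y$ is a continuous surjection with $\pi T=S\pi$ induced letter by letter by a map $\mathcal A\to\mathcal D$. $\mathcal M(X,T)$ is the set of $T$-invariant Borel probability measures; $h_\mu(T)$ is measure-theoretic entropy. $\mathcal C_{aa}(X,T)$ is the set of almost additive potentials: sequences $\Phi=(\log\phi_n)_{n\ge1}$ with each $\phi_n:X\to(0,\infty)$ continuous and some $c>0$ with $c^{-1}\phi_n(x)\phi_m(T^nx)\le\phi_{n+m}(x)\le c\,\phi_n(x)\phi_m(T^nx)$ for all $x\in X$, $n,m\in\mathbb N$. $\Phi$ has the bounded distortion property if there is $c>0$ such that $c^{-1}\phi_n(y)\le\phi_n(x)\le c\,\phi_n(y)$ for all $n$ whenever $x,y$ lie in the same $n$-th cylinder (i.e. share their first $n$ letters). $\Phi_*(\eta)=\lim_n\frac1n\int\log\phi_n\,d\eta$. Linear combinations of potentials are taken termwise. $P^{\mathbf a}(T,\Phi)=\sup\{\Phi_*(\eta)+a h_\eta(T)+b h_{\eta\circ\pi^{-1}}(S):\eta\in\mathcal M(X,T)\}$; an $\mathbf a$-weighted equilibrium state of $\Phi$ is an $\eta\in\mathcal M(X,T)$ attaining the supremum (for almost additive potentials with bounded distortion on full shifts it is unique). *)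

theory Defs
  imports "HOL-Probability.Probability"
begin

definition invariant_measures :: "('x::topological_space \<Rightarrow> 'x) \<Rightarrow> 'x measure set" where
  "invariant_measures T =
     {\<mu>. prob_space \<mu> \<and> sets \<mu> = sets borel \<and> T \<in> measurable \<mu> \<mu> \<and> distr \<mu> \<mu> T = \<mu>}"

definition finite_measurable_partitions :: "'x measure \<Rightarrow> 'x set set set" where
  "finite_measurable_partitions M =
     {\<P>. finite \<P> \<and> \<P> \<subseteq> sets M \<and> partition_on (space M) \<P>}"

(* The convention 0 log 0 = 0 is automatic. *)
definition partition_entropy :: "'x measure \<Rightarrow> 'x set set \<Rightarrow> real" where
  "partition_entropy M \<P> = - (\<Sum>A\<in>\<P>. measure M A * ln (measure M A))"

(* The join of \<P>, T^{-1}\<P>, ..., T^{-(n-1)}\<P>. The result may contain the empty set,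
   which contributes nothing to partition_entropy. *)
definition iterated_join :: "'x measure \<Rightarrow> ('x \<Rightarrow> 'x) \<Rightarrow> 'x set set \<Rightarrow> nat \<Rightarrow> 'x set set" where
  "iterated_join M T \<P> n =
     {{x \<in> space M. \<forall>i<n. (T ^^ i) x \<in> A i} |A. \<forall>i<n. A i \<in> \<P>}"

(* Kolmogorov-Sinai entropy. *)
definition ks_entropy :: "'x measure \<Rightarrow> ('x \<Rightarrow> 'x) \<Rightarrow> ereal" where
  "ks_entropy M T =
     (SUP \<P>\<in>finite_measurable_partitions M.
        ereal (lim (\<lambda>n. partition_entropy M (iterated_join M T \<P> n) / real n)))"

definition left_shift :: "(nat \<Rightarrow> 'a) \<Rightarrow> (nat \<Rightarrow> 'a)" where
  "left_shift x = (\<lambda>n. x (Suc n))"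

definition factor_map ::
  "('x::topological_space \<Rightarrow> 'x) \<Rightarrow> ('y::topological_space \<Rightarrow> 'y) \<Rightarrow> ('x \<Rightarrow> 'y) \<Rightarrow> bool" where
  "factor_map T S \<pi> \<longleftrightarrow> continuous_on UNIV \<pi> \<and> surj \<pi> \<and> \<pi> \<circ> T = S \<circ> \<pi>"

definition one_block_factor_map ::
  "((nat \<Rightarrow> 'a::topological_space) \<Rightarrow> (nat \<Rightarrow> 'b::topological_space)) \<Rightarrow> bool" where
  "one_block_factor_map \<pi> \<longleftrightarrow>
     factor_map left_shift left_shift \<pi> \<and> (\<exists>p. \<forall>x n. \<pi> x n = p (x n))"

(* Throughout, a potential (log \<phi>_n)_{n \<ge> 1} is given by \<Phi> n = log \<phi>_n, that is
   \<phi>_n = exp \<circ> \<Phi> n, so that linear combinations are termwise. The term \<Phi> 0 is irrelevant. *)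
definition almost_additive ::
  "('x::topological_space \<Rightarrow> 'x) \<Rightarrow> (nat \<Rightarrow> 'x \<Rightarrow> real) \<Rightarrow> bool" where
  "almost_additive T \<Phi> \<longleftrightarrow>
     (\<forall>n\<ge>1. continuous_on UNIV (\<lambda>x. exp (\<Phi> n x))) \<and>
     (\<exists>c>0. \<forall>x. \<forall>n\<ge>1. \<forall>m\<ge>1.
        inverse c * exp (\<Phi> n x) * exp (\<Phi> m ((T ^^ n) x)) \<le> exp (\<Phi> (n + m) x) \<and>
        exp (\<Phi> (n + m) x) \<le> c * exp (\<Phi> n x) * exp (\<Phi> m ((T ^^ n) x)))"

definition bounded_distortion :: "(nat \<Rightarrow> (nat \<Rightarrow> 'a) \<Rightarrow> real) \<Rightarrow> bool" where
  "bounded_distortion \<Phi> \<longleftrightarrow>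
     (\<exists>c>0. \<forall>n\<ge>1. \<forall>x y. (\<forall>i<n. x i = y i) \<longrightarrow>
        inverse c * exp (\<Phi> n y) \<le> exp (\<Phi> n x) \<and> exp (\<Phi> n x) \<le> c * exp (\<Phi> n y))"

definition linear_combination ::
  "real ^ 'i \<Rightarrow> ('i \<Rightarrow> nat \<Rightarrow> 'x \<Rightarrow> real) \<Rightarrow> nat \<Rightarrow> 'x \<Rightarrow> real" where
  "linear_combination q \<Phi> = (\<lambda>n x. \<Sum>i\<in>UNIV. q $ i * \<Phi> i n x)"

(* \<Phi>_*(\<eta>). *)
definition potential_mean :: "(nat \<Rightarrow> 'x \<Rightarrow> real) \<Rightarrow> 'x measure \<Rightarrow> real" where
  "potential_mean \<Phi> \<eta> = lim (\<lambda>n. (\<integral>x. \<Phi> n x \<partial>\<eta>) / real n)"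

definition weighted_free_energy ::
  "('x::topological_space \<Rightarrow> 'x) \<Rightarrow> ('y::topological_space \<Rightarrow> 'y) \<Rightarrow> ('x \<Rightarrow> 'y) \<Rightarrow>
    real \<Rightarrow> real \<Rightarrow> (nat \<Rightarrow> 'x \<Rightarrow> real) \<Rightarrow> 'x measure \<Rightarrow> ereal" where
  "weighted_free_energy T S \<pi> a b \<Phi> \<eta> =
     ereal (potential_mean \<Phi> \<eta>) + ereal a * ks_entropy \<eta> T
       + ereal b * ks_entropy (distr \<eta> borel \<pi>) S"

definition weighted_pressure ::
  "('x::topological_space \<Rightarrow> 'x) \<Rightarrow> ('y::topological_space \<Rightarrow> 'y) \<Rightarrow> ('x \<Rightarrow> 'y) \<Rightarrow>
    real \<Rightarrow> real \<Rightarrow> (nat \<Rightarrow> 'x \<Rightarrow> real) \<Rightarrow> ereal" where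
  "weighted_pressure T S \<pi> a b \<Phi> =
     (SUP \<eta>\<in>invariant_measures T. weighted_free_energy T S \<pi> a b \<Phi> \<eta>)"

definition weighted_equilibrium_state ::
  "('x::topological_space \<Rightarrow> 'x) \<Rightarrow> ('y::topological_space \<Rightarrow> 'y) \<Rightarrow> ('x \<Rightarrow> 'y) \<Rightarrow>
    real \<Rightarrow> real \<Rightarrow> (nat \<Rightarrow> 'x \<Rightarrow> real) \<Rightarrow> 'x measure \<Rightarrow> bool" where
  "weighted_equilibrium_state T S \<pi> a b \<Phi> \<eta> \<longleftrightarrow>
     \<eta> \<in> invariant_measures T \<and>
     weighted_free_energy T S \<pi> a b \<Phi> \<eta> = weighted_pressure T S \<pi> a b \<Phi>"

end

theory Submission
  imports Defs
begin

text \<open>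
  By almost additivity and bounded distortion the potential may be replaced by a function \<open>g\<close> of finite
  words that is additive up to a constant. Write \<open>f = exp (g / a)\<close>, let \<open>F(u)\<close> be the sum of \<open>f\<close> over the words
  with image \<open>u\<close>, put \<open>\<gamma> = b / (a + b)\<close>, and let \<open>\<theta>(w)\<close> be \<open>f(w) F(\<pi> w) powr - \<gamma>\<close> divided by its sum \<open>Z(n)\<close> over the
  words of length \<open>n\<close>. By the chain rule for relative entropy, the energy of an invariant measure \<open>\<mu>\<close> on
  words of length \<open>n\<close> is \<open>(a + b) ln Z(n) - a D(\<mu>|\<theta>) - b D(\<pi> \<mu>|\<pi> \<theta>)\<close>. Since \<open>\<theta>\<close> is multiplicative up to a
  constant, there is an invariant ergodic measure \<open>m\<close> comparable to \<open>\<theta>\<close> on cylinders, and it is an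
  equilibrium state. Conversely an equilibrium state \<open>\<mu>\<close> has \<open>D(\<mu>|\<theta>)\<close> bounded in \<open>n\<close>, so \<open>\<mu>\<close> is absolutely
  continuous with respect to \<open>m\<close>, hence \<open>\<mu> = m\<close>.

  The comparison constants are locally bounded in \<open>q\<close>, so every weak limit of equilibrium states for
  parameters converging to \<open>q\<close> is comparable to \<open>\<theta>\<close> at \<open>q\<close> and therefore is the equilibrium state at \<open>q\<close>.
  Thus \<open>q \<mapsto> (\<Phi>)\<^sub>*(\<mu>\<^sub>q)\<close> is a continuous selection of subgradients of \<open>Q\<close>, which makes \<open>Q\<close> continuously
  differentiable.
\<close>

section \<open>Almost additive sequences and the Gibbs inequality\<close>

text \<open>The exponent \<open>\<gamma>\<close> comes from maximising the block energy in two
  stages. For a given law of the image word, the best conditional law on each fibre is proportional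
  to \<open>f\<close> and contributes the mean of \<open>a ln F\<close>. What remains,
  \<open>(a + b)\<close> times the entropy of the image law plus that mean, is maximal for a law
  proportional to \<open>F powr (a / (a + b))\<close>; the product of the two laws is proportional
  to \<open>f(w) F(\<pi> w) powr - \<gamma>\<close>.

  The divergence \<open>D(\<mu>|\<theta>)\<close> stays bounded because every comparison holds at
  each finite \<open>n\<close> up to a constant, not merely up to \<open>o(n)\<close>: entropy is
  exactly subadditive, while means of \<open>g\<close> and \<open>ln Z\<close> are additive up to a
  constant. So an equilibrium state can lose only a bounded amount against
  \<open>(a + b) ln Z(n)\<close>.

  Entropy is defined as a supremum over all finite partitions, so the passage to words needs the
  theorem that the letters generate. It need not be continuous under weak limits; limits of
  equilibrium states are therefore identified by cylinder bounds and not by their free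
  energy.\<close>

lemma almost_subadditive_limit:
  fixes u :: "nat \<Rightarrow> real"
  assumes sub: "\<And>n m. n \<ge> 1 \<Longrightarrow> m \<ge> 1 \<Longrightarrow> u (n + m) \<le> u n + u m + c"
    and lb: "\<And>n. n \<ge> 1 \<Longrightarrow> - B * real n \<le> u n"
  shows "\<exists>L. (\<lambda>n. u n / real n) \<longlonglongrightarrow> L \<and> (\<forall>n\<ge>1. real n * L \<le> u n + c)"
proof -
  \<comment> \<open>Absorbing the constant makes the sequence exactly subadditive, so Fekete's
    argument applies and the limit is an infimum; this is where the bound at every single
    \<open>n\<close> comes from.\<close>
  define v where "v n = u n + c" for n
  have v_sub: "v (n + m) \<le> v n + v m" if "n \<ge> 1" "m \<ge> 1" for n m
    using sub[OF that] by (simp add: v_def)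
  define L where "L = Inf ((\<lambda>n. v n / real n) ` {1..})"
  have bdd: "bdd_below ((\<lambda>n. v n / real n) ` {1..})"
  proof (rule bdd_belowI2)
    fix n :: nat assume n: "n \<in> {1..}"
    have "(- B - \<bar>c\<bar>) * real n \<le> - B * real n + c"
    proof -
      have "\<bar>c\<bar> * 1 \<le> \<bar>c\<bar> * real n" using n by (intro mult_left_mono) auto
      then show ?thesis by (simp add: algebra_simps)
    qed
    also have "\<dots> \<le> v n" using lb[of n] n by (simp add: v_def)
    finally show "- B - \<bar>c\<bar> \<le> v n / real n" using n by (simp add: field_simps)
  qed
  have L_le: "L \<le> v n / real n" if "n \<ge> 1" for n
    unfolding L_def by (rule cInf_lower[OF _ bdd]) (use that in auto)
  have upper: "\<exists>D. \<forall>n\<ge>1. v n / real n \<le> v k / real k + D / real n" if k: "k \<ge> 1" for k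
  proof -
    have multi: "v (j * k + r) \<le> real j * v k + v r" if r: "r \<ge> 1" for j r
    proof (induction j)
      case (Suc j)
      have "v (Suc j * k + r) = v (k + (j * k + r))" by (simp add: algebra_simps)
      also have "\<dots> \<le> v k + v (j * k + r)" using v_sub[of k "j * k + r"] k r by simp
      finally show ?case using Suc by (simp add: algebra_simps)
    qed simp
    define D where "D = \<bar>v k\<bar> + (\<Sum>r\<in>{1..k}. \<bar>v r\<bar>)"
    have "v n / real n \<le> v k / real k + D / real n" if n: "n \<ge> 1" for n
    proof -
      \<comment> \<open>The remainder runs over \<open>1..k\<close> instead of
        \<open>0..k-1\<close>, because subadditivity is assumed for positive lengths only.\<close>
      define j r where "j = (n - 1) div k" and "r = (n - 1) mod k + 1"
      have nr: "n = j * k + r" "r \<ge> 1" "r \<le> k"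
        using n k mod_less_divisor[of k "n - 1"] div_mult_mod_eq[of "n - 1" k]
        unfolding j_def r_def by (auto simp: Suc_le_eq simp del: mod_less_divisor)
      have "v r \<le> \<bar>v r\<bar>" by simp
      also have "\<dots> \<le> (\<Sum>r\<in>{1..k}. \<bar>v r\<bar>)"
        using nr by (intro member_le_sum) auto
      finally have vr: "v r \<le> (\<Sum>r\<in>{1..k}. \<bar>v r\<bar>)" .
      have jk: "real j * real k = real n - real r" using nr(1) by simp
      have "real j * v k = real n * (v k / real k) - (real r / real k) * v k"
      proof -
        have "real j = (real n - real r) / real k" using jk k by (simp add: field_simps)
        then show ?thesis by (simp add: left_diff_distrib diff_divide_distrib)
      qed
      also have "\<dots> \<le> real n * (v k / real k) + \<bar>v k\<bar>"
      proof -
        have "\<bar>(real r / real k) * v k\<bar> \<le> 1 * \<bar>v k\<bar>"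
          unfolding abs_mult using nr k by (intro mult_right_mono) auto
        then show ?thesis by linarith
      qed
      finally have "v n \<le> real n * (v k / real k) + D"
        using multi[OF nr(2), of j] vr nr(1) unfolding D_def by simp
      then show ?thesis using n by (simp add: field_simps)
    qed
    then show ?thesis by blast
  qed
  have "(\<lambda>n. v n / real n) \<longlonglongrightarrow> L"
  proof (rule LIMSEQ_I)
    fix e :: real assume e: "e > 0"
    obtain k where k: "k \<ge> 1" "v k / real k < L + e / 2"
      using cInf_lessD[of "(\<lambda>n. v n / real n) ` {1..}" "L + e / 2"] e unfolding L_def by auto
    obtain D where D: "\<And>n. n \<ge> 1 \<Longrightarrow> v n / real n \<le> v k / real k + D / real n"
      using upper[OF k(1)] by blast
    have "(\<lambda>n. D / real n) \<longlonglongrightarrow> 0" by (rule lim_const_over_n)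
    then obtain N where N: "\<And>n. n \<ge> N \<Longrightarrow> \<bar>D / real n\<bar> < e / 2"
      using LIMSEQ_D[of "\<lambda>n. D / real n" 0 "e / 2"] e by auto
    have "norm (v n / real n - L) < e" if n: "n \<ge> max 1 N" for n
    proof -
      have "n \<ge> 1" "n \<ge> N" using n by auto
      then show ?thesis
        using L_le[of n] D[of n] N[of n] k(2) unfolding real_norm_def abs_less_iff by linarith
    qed
    then show "\<exists>no. \<forall>n\<ge>no. norm (v n / real n - L) < e" by blast
  qed
  moreover have "(\<lambda>n. c / real n) \<longlonglongrightarrow> 0" by (rule lim_const_over_n)
  ultimately have "(\<lambda>n. v n / real n - c / real n) \<longlonglongrightarrow> L - 0" by (rule tendsto_diff)
  then have "(\<lambda>n. u n / real n) \<longlonglongrightarrow> L" by (simp add: v_def add_divide_distrib)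
  moreover have "real n * L \<le> u n + c" if "n \<ge> 1" for n
    using L_le[OF that] that by (simp add: v_def field_simps)
  ultimately show ?thesis by blast
qed

text \<open>Both \<open>u\<close> and \<open>- u\<close> are subadditive up to \<open>c\<close>, and
  their limits are opposite, so the two one-sided Fekete bounds combine. The error stays
  \<open>c\<close> for every \<open>n\<close>, which later keeps relative entropies bounded.\<close>

lemma almost_additive_limit:
  fixes u :: "nat \<Rightarrow> real"
  assumes aa: "\<And>n m. n \<ge> 1 \<Longrightarrow> m \<ge> 1 \<Longrightarrow> \<bar>u (n + m) - u n - u m\<bar> \<le> c"
  shows "\<exists>L. (\<lambda>n. u n / real n) \<longlonglongrightarrow> L \<and> (\<forall>n\<ge>1. \<bar>real n * L - u n\<bar> \<le> c)"
proof -
  have lower: "- (\<bar>u 1\<bar> + \<bar>c\<bar>) * real n \<le> u n \<and> - (\<bar>u 1\<bar> + \<bar>c\<bar>) * real n \<le> - u n" if "n \<ge> 1" for n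
    using that
  proof (induction n rule: nat_induct_at_least)
    case (Suc n)
    then show ?case using aa[of n 1] by (auto simp: algebra_simps abs_le_iff)
  qed (auto simp: algebra_simps abs_if)
  obtain L where L: "(\<lambda>n. u n / real n) \<longlonglongrightarrow> L" "\<forall>n\<ge>1. real n * L \<le> u n + c"
  proof -
    have "u (n + m) \<le> u n + u m + c" if "n \<ge> 1" "m \<ge> 1" for n m
      using aa[OF that] by (simp add: abs_le_iff)
    then show ?thesis
      using almost_subadditive_limit[of u c "\<bar>u 1\<bar> + \<bar>c\<bar>"] lower that by blast
  qed
  obtain L' where L': "(\<lambda>n. - u n / real n) \<longlonglongrightarrow> L'" "\<forall>n\<ge>1. real n * L' \<le> - u n + c"
  proof -
    have "- u (n + m) \<le> - u n + - u m + c" if "n \<ge> 1" "m \<ge> 1" for n m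
      using aa[OF that] by (simp add: abs_le_iff)
    then show ?thesis
      using almost_subadditive_limit[of "\<lambda>n. - u n" c "\<bar>u 1\<bar> + \<bar>c\<bar>"] lower that by blast
  qed
  have "L' = - L" using tendsto_minus[OF L(1)] L'(1) LIMSEQ_unique by fastforce
  then have "\<forall>n\<ge>1. \<bar>real n * L - u n\<bar> \<le> c" using L(2) L'(2) by (auto simp: abs_le_iff)
  then show ?thesis using L(1) by blast
qed

text \<open>This is \<open>ln t \<le> t - 1\<close> at \<open>t = r s / p s\<close>, averaged. The
  masses are left unnormalised so that \<open>r\<close> may be a sub-probability or a tilted weight.
  The assumption on supports rules out terms in which the convention \<open>ln 0 = 0\<close> would
  falsify the inequality.\<close>

lemma gibbs_inequality:
  fixes p r :: "'s \<Rightarrow> real"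
  assumes "finite S" and p: "\<And>s. s \<in> S \<Longrightarrow> p s \<ge> 0" and r: "\<And>s. s \<in> S \<Longrightarrow> r s \<ge> 0"
    and pr: "\<And>s. s \<in> S \<Longrightarrow> p s > 0 \<Longrightarrow> r s > 0"
  shows "(\<Sum>s\<in>S. p s * ln (r s)) - (\<Sum>s\<in>S. p s * ln (p s)) \<le> sum r S - sum p S"
proof -
  have "p s * ln (r s) - p s * ln (p s) \<le> r s - p s" if s: "s \<in> S" for s
  proof (cases "p s = 0")
    case False
    then have pos: "p s > 0" "r s > 0" using p[OF s] pr[OF s] by auto
    have "ln (r s / p s) \<le> r s / p s - 1" using pos by (intro ln_le_minus_one) auto
    then have "p s * (ln (r s) - ln (p s)) \<le> p s * (r s / p s - 1)"
      using pos by (intro mult_left_mono) (auto simp: ln_div)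
    then show ?thesis using pos by (simp add: algebra_simps)
  qed (use r[OF s] in auto)
  then have "(\<Sum>s\<in>S. p s * ln (r s) - p s * ln (p s)) \<le> (\<Sum>s\<in>S. r s - p s)"
    by (intro sum_mono)
  then show ?thesis by (simp add: sum_subtractf)
qed

section \<open>Words and cylinders\<close>

definition prefix_word :: "nat \<Rightarrow> (nat \<Rightarrow> 'a) \<Rightarrow> 'a list" where
  "prefix_word n x = map x [0..<n]"

definition words :: "nat \<Rightarrow> 'a list set" where
  "words n = {w. length w = n}"

definition cylinder :: "'a list \<Rightarrow> (nat \<Rightarrow> 'a) set" where
  "cylinder w = {x. prefix_word (length w) x = w}"

text \<open>These are the clopen sets of the shift space. Words of a length other than
  \<open>n\<close> in \<open>W\<close> have no effect, so complements can be taken among all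
  lists.\<close>

definition cylinder_set :: "nat \<Rightarrow> 'a list set \<Rightarrow> (nat \<Rightarrow> 'a) set" where
  "cylinder_set n W = {x. prefix_word n x \<in> W}"

text \<open>Supplies a point of every cylinder: an atom for a point mass, or the point at which a
  potential is evaluated to become a function of words.\<close>

definition prepend :: "'a list \<Rightarrow> (nat \<Rightarrow> 'a) \<Rightarrow> nat \<Rightarrow> 'a" where
  "prepend w x = (\<lambda>i. if i < length w then w ! i else x (i - length w))"

lemma length_prefix_word [simp]: "length (prefix_word n x) = n"
  by (simp add: prefix_word_def)

lemma prefix_word_nth [simp]: "i < n \<Longrightarrow> prefix_word n x ! i = x i"
  by (simp add: prefix_word_def)

lemma prefix_word_in_words [simp]: "prefix_word n x \<in> words n"
  by (simp add: words_def)

lemma prefix_word_eq_iff: "prefix_word n x = prefix_word n y \<longleftrightarrow> (\<forall>i<n. x i = y i)"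
  by (auto simp: list_eq_iff_nth_eq)

lemma words_0 [simp]: "words 0 = {[]}"
  by (auto simp: words_def)

lemma finite_words [simp]: "finite (words n :: 'a::finite list set)"
  using finite_lists_length_eq[of "UNIV :: 'a set" n] by (simp add: words_def)

lemma left_shift_funpow: "(left_shift ^^ n) x = (\<lambda>i. x (n + i))"
  by (induction n arbitrary: x) (auto simp: left_shift_def)

lemma prefix_word_add:
  "prefix_word (n + m) x = prefix_word n x @ prefix_word m ((left_shift ^^ n) x)"
  by (rule nth_equalityI) (auto simp: nth_append left_shift_funpow)

lemma take_prefix_word: "n \<le> m \<Longrightarrow> take n (prefix_word m x) = prefix_word n x"
  by (rule nth_equalityI) auto

lemma prefix_word_prepend [simp]: "prefix_word (length w) (prepend w x) = w"
  by (rule nth_equalityI) (auto simp: prepend_def)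

lemma prepend_in_cylinder [simp]: "prepend w x \<in> cylinder w"
  by (simp add: cylinder_def)

lemma mem_cylinder_prefix_word [simp]: "x \<in> cylinder (prefix_word n x)"
  by (simp add: cylinder_def)

lemma cylinder_Nil [simp]: "cylinder [] = UNIV"
  by (auto simp: cylinder_def prefix_word_def)

lemma mem_cylinder_iff: "w \<in> words n \<Longrightarrow> x \<in> cylinder w \<longleftrightarrow> prefix_word n x = w"
  by (auto simp: cylinder_def words_def)

lemma mem_cylinder_iff_nth: "x \<in> cylinder w \<longleftrightarrow> (\<forall>i<length w. x i = w ! i)"
  by (auto simp: cylinder_def list_eq_iff_nth_eq)

lemma mem_cylinder_snoc_iff: "x \<in> cylinder (w @ [c]) \<longleftrightarrow> x \<in> cylinder w \<and> x (length w) = c"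
  by (auto simp: mem_cylinder_iff_nth nth_append less_Suc_eq)

lemma mem_cylinder_append_iff:
  "x \<in> cylinder (v @ w) \<longleftrightarrow> x \<in> cylinder v \<and> (left_shift ^^ length v) x \<in> cylinder w"
  by (simp add: cylinder_def prefix_word_add)

lemma cylinder_eq_cylinder_set: "cylinder w = cylinder_set (length w) {w}"
  by (auto simp: cylinder_def cylinder_set_def)

lemma cylinder_set_Un_cylinder: "cylinder_set n W = (\<Union>w\<in>W \<inter> words n. cylinder w)"
  by (auto simp: cylinder_set_def mem_cylinder_iff)

lemma Compl_cylinder_set: "- cylinder_set n W = cylinder_set n (- W)"
  by (auto simp: cylinder_set_def)

lemma cylinder_set_lift:
  assumes "n \<le> m"
  shows "cylinder_set n W = cylinder_set m {w. take n w \<in> W}"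
  using assms by (auto simp: cylinder_set_def take_prefix_word)

lemma cylinder_set_finite_Union:
  fixes k :: nat
  assumes "\<And>i. i < k \<Longrightarrow> \<exists>n W. U i = cylinder_set n W"
  shows "\<exists>n W. (\<Union>i<k. U i) = cylinder_set n W"
  using assms
proof (induction k)
  case 0
  then show ?case by (auto simp: cylinder_set_def intro: exI[of _ "{}"])
next
  case (Suc k)
  obtain n W where 1: "(\<Union>i<k. U i) = cylinder_set n W" using Suc by (metis less_SucI)
  obtain m V where 2: "U k = cylinder_set m V" using Suc.prems by blast
  have "(\<Union>i<Suc k. U i) = cylinder_set n W \<union> cylinder_set m V"
    unfolding 1[symmetric] 2[symmetric] by (auto simp: less_Suc_eq)
  also have "\<dots> = cylinder_set (max n m) ({w. take n w \<in> W} \<union> {w. take m w \<in> V})"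
    using cylinder_set_lift[of n "max n m" W] cylinder_set_lift[of m "max n m" V]
    by (auto simp: cylinder_set_def)
  finally show ?case by blast
qed

lemma sum_words_add:
  fixes f :: "'a list \<Rightarrow> 'c::comm_monoid_add"
  shows "(\<Sum>w\<in>words (n + m). f w) = (\<Sum>v\<in>words n. \<Sum>w\<in>words m. f (v @ w))"
proof -
  have "words (n + m) = (\<lambda>(v, w). v @ w) ` (words n \<times> (words m :: 'a list set))"
  proof (intro equalityI subsetI)
    fix w :: "'a list" assume "w \<in> words (n + m)"
    then show "w \<in> (\<lambda>(v, w). v @ w) ` (words n \<times> words m)"
      by (intro image_eqI[of _ _ "(take n w, drop n w)"]) (auto simp: words_def)
  qed (auto simp: words_def)
  moreover have "inj_on (\<lambda>(v, w). v @ w) (words n \<times> (words m :: 'a list set))"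
    by (auto simp: inj_on_def words_def)
  ultimately have "(\<Sum>w\<in>words (n + m). f w) = (\<Sum>(v, w)\<in>words n \<times> words m. f (v @ w))"
    by (simp add: sum.reindex case_prod_unfold o_def)
  then show ?thesis by (simp add: sum.cartesian_product)
qed

lemma words_1: "words (Suc 0) = (\<lambda>c. [c]) ` UNIV"
  by (auto simp: words_def length_Suc_conv)

lemma sum_words_1: "(\<Sum>w\<in>words (Suc 0). f w) = (\<Sum>c\<in>UNIV. f [c])"
  by (simp add: words_1 sum.reindex inj_on_def)

section \<open>Topology and Borel structure of the shift space\<close>

lemma open_cylinder: "open (cylinder (w :: 'a::discrete_topology list))"
proof -
  have "open {x. \<forall>i\<in>{..<length w}. x (id i) \<in> {w ! i}}"
    by (rule product_topology_basis') (auto simp: discrete_topology_class.open_discrete)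
  also have "{x. \<forall>i\<in>{..<length w}. x (id i) \<in> {w ! i}} = cylinder w"
    by (auto simp: cylinder_def list_eq_iff_nth_eq)
  finally show ?thesis .
qed

lemma open_cylinder_set: "open (cylinder_set n (W :: 'a::discrete_topology list set))"
  unfolding cylinder_set_Un_cylinder by (auto intro: open_cylinder)

lemma closed_cylinder_set: "closed (cylinder_set n (W :: 'a::discrete_topology list set))"
  unfolding closed_def Compl_cylinder_set by (rule open_cylinder_set)

lemma cylinder_set_measurable [measurable]:
  "cylinder_set n (W :: 'a::discrete_topology list set) \<in> sets borel"
  by (rule borel_open[OF open_cylinder_set])

lemma cylinder_measurable [measurable]:
  "cylinder (w :: 'a::discrete_topology list) \<in> sets borel"
  by (rule borel_open[OF open_cylinder])

text \<open>A basic neighbourhood in the product topology constrains finitely many coordinates,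
  hence contains the cylinder of the first \<open>n\<close> letters as soon as \<open>n\<close>
  exceeds them all.\<close>

lemma open_imp_Union_cylinder:
  assumes "open U" "x \<in> U"
  shows "\<exists>n. cylinder (prefix_word n x) \<subseteq> (U :: (nat \<Rightarrow> 'a::topological_space) set)"
proof -
  have "openin (product_topology (\<lambda>i. euclidean) UNIV) U"
    using assms(1) by (simp add: open_fun_def)
  then obtain X where X: "x \<in> Pi\<^sub>E UNIV X" "finite {i. X i \<noteq> UNIV}" "Pi\<^sub>E UNIV X \<subseteq> U"
    using assms(2) unfolding openin_product_topology_alt by auto
  obtain n where n: "\<And>i. X i \<noteq> UNIV \<Longrightarrow> i < n"
    using X(2) finite_nat_set_iff_bounded by auto
  have "y \<in> U" if "y \<in> cylinder (prefix_word n x)" for y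
  proof -
    have eq: "\<And>i. i < n \<Longrightarrow> y i = x i"
      using that by (auto simp: cylinder_def prefix_word_eq_iff)
    have "y i \<in> X i" for i
      using n[of i] eq[of i] X(1) by (cases "X i = UNIV") (auto simp: PiE_iff)
    then show ?thesis using X(3) by auto
  qed
  then show ?thesis by blast
qed

lemma sets_borel_eq_sigma_cylinders:
  "sets (borel :: (nat \<Rightarrow> 'a::{finite,discrete_topology}) measure) = sigma_sets UNIV (range cylinder)"
proof
  have "U \<in> sigma_sets UNIV (range cylinder)" if "open U" for U :: "(nat \<Rightarrow> 'a) set"
  proof -
    have "U = (\<Union>w\<in>{w. cylinder w \<subseteq> U}. cylinder w)"
      using open_imp_Union_cylinder[OF that] mem_cylinder_prefix_word by fast
    \<comment> \<open>There are only countably many words over a finite alphabet, so this union is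
      countable.\<close>
    moreover have "(\<Union>w\<in>{w. cylinder w \<subseteq> U}. cylinder w) \<in> sigma_sets UNIV (range cylinder)"
      by (intro sigma_sets_UNION) auto
    ultimately show ?thesis by simp
  qed
  then show "sets borel \<subseteq> sigma_sets UNIV (range (cylinder :: 'a list \<Rightarrow> _))"
    unfolding borel_def by (auto intro!: sigma_sets_mono)
  show "sigma_sets UNIV (range cylinder) \<subseteq> sets (borel :: (nat \<Rightarrow> 'a) measure)"
    using sets.sigma_sets_subset[of "range cylinder" "borel :: (nat \<Rightarrow> 'a) measure"]
    by (simp add: image_subset_iff)
qed

text \<open>The sets with such approximations form a \<sigma>-algebra containing the cylinders. The
  same clopen set has to serve both measures, so the induction runs on the sum \<open>d\<close> of
  the two masses of the symmetric difference.\<close>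

lemma cylinder_set_approx:
  fixes M N :: "(nat \<Rightarrow> 'a::{finite,discrete_topology}) measure"
  assumes "finite_measure M" "finite_measure N"
    and [measurable_cong, simp]: "sets M = sets borel" "sets N = sets borel"
    and B: "B \<in> sets borel"
  shows "\<forall>e>0. \<exists>n W. measure M ((B - cylinder_set n W) \<union> (cylinder_set n W - B)) < e \<and>
    measure N ((B - cylinder_set n W) \<union> (cylinder_set n W - B)) < e"
proof -
  interpret M: finite_measure M by fact
  interpret N: finite_measure N by fact
  define d where "d A U = measure M ((A - U) \<union> (U - A)) + measure N ((A - U) \<union> (U - A))" for A U
  have "\<forall>e>0. \<exists>n W. d B (cylinder_set n W) < e"
    using B unfolding sets_borel_eq_sigma_cylinders
  proof (induction rule: sigma_sets.induct)
    case (Basic a)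
    then obtain w where "a = cylinder_set (length w) {w}" by (auto simp: cylinder_eq_cylinder_set)
    then have "d a (cylinder_set (length w) {w}) = 0" by (simp add: d_def)
    then show ?case by metis
  next
    case Empty
    show ?case by (auto simp: d_def cylinder_set_def intro!: exI[of _ 0] exI[of _ "{}"])
  next
    case (Compl a)
    have "d (UNIV - a) (cylinder_set n (- W)) = d a (cylinder_set n W)" for n W
    proof -
      have "(UNIV - a - cylinder_set n (- W)) \<union> (cylinder_set n (- W) - (UNIV - a))
        = (a - cylinder_set n W) \<union> (cylinder_set n W - a)"
        by (auto simp: cylinder_set_def)
      then show ?thesis by (simp add: d_def)
    qed
    then show ?case using Compl.IH by metis
  next
    case (Union a)
    have a[measurable]: "a i \<in> sets borel" for i
      using Union.hyps by (simp add: sets_borel_eq_sigma_cylinders)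
    show ?case
    proof (intro allI impI)
      fix e :: real assume e: "e > 0"
      define R where "R k = (\<Union>i. a i) - (\<Union>i<k. a i)" for k
      have R[measurable]: "R k \<in> sets borel" for k unfolding R_def by measurable
      have rangeR: "range R \<subseteq> sets borel" using R by blast
      have "decseq R" unfolding R_def by (intro decseq_SucI) auto
      moreover have "(\<Inter>k. R k) = {}" unfolding R_def by auto
      ultimately have "(\<lambda>k. measure M (R k) + measure N (R k)) \<longlonglongrightarrow> 0 + 0"
        using M.finite_Lim_measure_decseq[of R] N.finite_Lim_measure_decseq[of R] rangeR
        by (intro tendsto_add) auto
      then obtain k where k: "measure M (R k) + measure N (R k) < e / 2"
        using LIMSEQ_D[of _ 0 "e / 2"] e by (force simp: abs_less_iff)
      \<comment> \<open>Half of \<open>e\<close> pays for the tail \<open>R k\<close>, the other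
        half is shared by the first \<open>k\<close> sets; \<open>Suc k\<close> avoids dividing by
        zero.\<close>
      have pos: "e / (2 * real (Suc k)) > 0" using e by simp
      have "\<exists>U. d (a i) U < e / (2 * real (Suc k)) \<and> (\<exists>n W. U = cylinder_set n W)" for i
        using Union.IH[of i] pos by blast
      then obtain U where U: "\<And>i. d (a i) (U i) < e / (2 * real (Suc k))"
          "\<And>i. \<exists>n W. U i = cylinder_set n W"
        by metis
      have [measurable]: "U i \<in> sets borel" for i using U(2)[of i] by auto
      obtain n W where nW: "(\<Union>i<k. U i) = cylinder_set n W"
        using cylinder_set_finite_Union[of k U] U(2) by blast
      define D where "D i = (a i - U i) \<union> (U i - a i)" for i
      have D[measurable]: "D i \<in> sets borel" for i unfolding D_def by measurable
      have sub: "(((\<Union>i. a i) - (\<Union>i<k. U i)) \<union> ((\<Union>i<k. U i) - (\<Union>i. a i))) \<subseteq> R k \<union> (\<Union>i<k. D i)"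
        unfolding R_def D_def by auto
      have *: "measure L (((\<Union>i. a i) - (\<Union>i<k. U i)) \<union> ((\<Union>i<k. U i) - (\<Union>i. a i)))
          \<le> measure L (R k) + (\<Sum>i<k. measure L (D i))"
        if "finite_measure L" and [measurable_cong, simp]: "sets L = sets borel" for L
      proof -
        interpret finite_measure L by fact
        have "measure L (((\<Union>i. a i) - (\<Union>i<k. U i)) \<union> ((\<Union>i<k. U i) - (\<Union>i. a i)))
            \<le> measure L (R k \<union> (\<Union>i<k. D i))"
          by (rule finite_measure_mono[OF sub]) simp
        also have "\<dots> \<le> measure L (R k) + measure L (\<Union>i<k. D i)"
          by (rule measure_Un_le) auto
        also have "measure L (\<Union>i<k. D i) \<le> (\<Sum>i<k. measure L (D i))"
          by (rule finite_measure_subadditive_finite) auto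
        finally show ?thesis by simp
      qed
      have "d (\<Union>i. a i) (\<Union>i<k. U i) \<le>
          (measure M (R k) + measure N (R k)) + (\<Sum>i<k. d (a i) (U i))"
        using *[of M] *[of N] assms unfolding d_def D_def by (simp add: sum.distrib)
      also have "(\<Sum>i<k. d (a i) (U i)) \<le> (\<Sum>i<k. e / (2 * real (Suc k)))"
        using U(1) by (intro sum_mono less_imp_le)
      also have "\<dots> = real k * (e / (2 * real (Suc k)))" by simp
      also have "\<dots> \<le> e / 2" using e by (simp add: field_simps)
      finally have "d (\<Union>i. a i) (cylinder_set n W) < e" using k nW by simp
      then show "\<exists>n W. d (\<Union>i. a i) (cylinder_set n W) < e" by blast
    qed
  qed
  then show ?thesis unfolding d_def
    by (metis (no_types, lifting) add_increasing add_increasing2 le_less_trans measure_nonneg order_refl)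
qed

section \<open>Measures on the shift space\<close>

lemma measure_cylinder_set:
  fixes M :: "(nat \<Rightarrow> 'a::{finite,discrete_topology}) measure"
  assumes "finite_measure M" and [measurable_cong, simp]: "sets M = sets borel"
    and B: "B \<in> sets borel"
  shows "measure M (cylinder_set n W \<inter> B) = (\<Sum>w\<in>W \<inter> words n. measure M (cylinder w \<inter> B))"
proof -
  interpret finite_measure M by fact
  have "cylinder_set n W \<inter> B = (\<Union>w\<in>W \<inter> words n. cylinder w \<inter> B)"
    by (auto simp: cylinder_set_Un_cylinder)
  moreover have "measure M (\<Union>w\<in>W \<inter> words n. cylinder w \<inter> B) = (\<Sum>w\<in>W \<inter> words n. measure M (cylinder w \<inter> B))"
  proof (rule finite_measure_finite_Union)
    show "finite (W \<inter> words n)" by simp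
    show "(\<lambda>w. cylinder w \<inter> B) ` (W \<inter> words n) \<subseteq> sets M" using B by auto
    show "disjoint_family_on (\<lambda>w. cylinder w \<inter> B) (W \<inter> words n)"
      by (auto simp: disjoint_family_on_def mem_cylinder_iff)
  qed
  ultimately show ?thesis by simp
qed

text \<open>The inequality passes from cylinders to clopen sets by additivity, and from there to
  Borel sets by an approximation that is good for both measures at once.\<close>

lemma measure_le_if_cylinder_le:
  fixes M N :: "(nat \<Rightarrow> 'a::{finite,discrete_topology}) measure"
  assumes fin: "finite_measure M" "finite_measure N"
    and [measurable_cong, simp]: "sets M = sets borel" "sets N = sets borel"
    and le: "\<And>w. measure M (cylinder w) \<le> C * measure N (cylinder w)"
    and B: "B \<in> sets borel"
  shows "measure M B \<le> C * measure N B"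
proof (rule field_le_epsilon)
  fix e :: real assume e: "e > 0"
  interpret M: finite_measure M by fact
  interpret N: finite_measure N by fact
  note [measurable] = B
  \<comment> \<open>Chosen so that the error \<open>e'\<close> on the side of \<open>M\<close> and
    \<open>\<bar>C\<bar> * e'\<close> on the side of \<open>N\<close> add up to \<open>e\<close>;
    the sign of \<open>C\<close> is not prescribed.\<close>
  define e' where "e' = e / (1 + \<bar>C\<bar>)"
  have e': "e' > 0" using e by (simp add: e'_def add_pos_nonneg)
  obtain n W where nW: "measure M ((B - cylinder_set n W) \<union> (cylinder_set n W - B)) < e'"
      "measure N ((B - cylinder_set n W) \<union> (cylinder_set n W - B)) < e'"
    using cylinder_set_approx[OF fin _ _ B] e' by fastforce
  let ?U = "cylinder_set n W" and ?D = "(B - cylinder_set n W) \<union> (cylinder_set n W - B)"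
  have 1: "measure L X \<le> measure L Y + measure L ?D"
    if L: "finite_measure L" "sets L = sets borel" and XY: "X \<in> sets borel" "Y \<in> sets borel" "X \<subseteq> Y \<union> ?D" for L X Y
  proof -
    interpret finite_measure L by fact
    note [simp, measurable_cong] = L(2)
    note [measurable] = XY(1,2)
    have "measure L X \<le> measure L (Y \<union> ?D)" by (rule finite_measure_mono[OF XY(3)]) simp
    also have "\<dots> \<le> measure L Y + measure L ?D" by (rule measure_Un_le) auto
    finally show ?thesis .
  qed
  have U: "measure L ?U = (\<Sum>w\<in>W \<inter> words n. measure L (cylinder w))"
    if "finite_measure L" "sets L = sets borel" for L
    using measure_cylinder_set[OF that, of UNIV n W] by simp
  have "measure M ?U \<le> C * measure N ?U"
    using fin by (simp add: U sum_distrib_left sum_mono le)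
  moreover have "measure M B \<le> measure M ?U + e'" using 1[of M B ?U] nW fin by fastforce
  moreover have "\<bar>measure N ?U - measure N B\<bar> \<le> e'"
    using 1[of N B ?U] 1[of N ?U B] nW fin by (fastforce simp: abs_le_iff)
  then have "\<bar>C * measure N ?U - C * measure N B\<bar> \<le> \<bar>C\<bar> * e'"
    unfolding right_diff_distrib[symmetric] abs_mult by (rule mult_left_mono) auto
  moreover have "e' + \<bar>C\<bar> * e' = e"
  proof -
    have "1 + \<bar>C\<bar> \<noteq> 0" by linarith
    then have "e' * (1 + \<bar>C\<bar>) = e" by (simp add: e'_def)
    then show ?thesis by (simp add: algebra_simps)
  qed
  ultimately show "measure M B \<le> C * measure N B + e" by linarith
qed

lemma measure_eqI_cylinder:
  fixes M N :: "(nat \<Rightarrow> 'a::{finite,discrete_topology}) measure"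
  assumes "finite_measure M" "finite_measure N" "sets M = sets borel" "sets N = sets borel"
    and "\<And>w. measure M (cylinder w) = measure N (cylinder w)"
  shows "M = N"
proof (rule measure_eqI)
  interpret M: finite_measure M by fact
  interpret N: finite_measure N by fact
  show "sets M = sets N" using assms by simp
  fix B assume "B \<in> sets M"
  then have "measure M B = measure N B"
    using measure_le_if_cylinder_le[of M N 1 B] measure_le_if_cylinder_le[of N M 1 B] assms by force
  then show "emeasure M B = emeasure N B"
    by (simp add: M.emeasure_eq_measure N.emeasure_eq_measure)
qed

section \<open>Extension of word functions to measures, and weak compactness\<close>

lemma compact_shift_space: "compact (UNIV :: (nat \<Rightarrow> 'a::{finite,discrete_topology}) set)"
proof -
  have "compactin (product_topology (\<lambda>i::nat. euclidean :: 'a topology) UNIV) (Pi\<^sub>E UNIV (\<lambda>_. UNIV))"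
    by (subst compactin_PiE) (auto intro: finite_imp_compact)
  then show ?thesis by (simp add: euclidean_product_topology PiE_UNIV_domain)
qed

text \<open>Clopen sets are closed in a compact space, so the finite intersection property applies.
  It makes every finitely additive function on clopen sets continuous at the empty set, hence
  countably additive.\<close>

lemma decseq_cylinder_set_empty:
  fixes A :: "nat \<Rightarrow> (nat \<Rightarrow> 'a::{finite,discrete_topology}) set"
  assumes A: "\<And>i. \<exists>n W. A i = cylinder_set n W" and "decseq A" "(\<Inter>i. A i) = {}"
  shows "\<exists>i. A i = {}"
proof (rule ccontr)
  assume ne: "\<nexists>i. A i = {}"
  have "UNIV \<inter> (\<Inter>i\<in>UNIV. A i) \<noteq> {}"
  proof (rule compact_imp_fip_image[OF compact_shift_space])
    show "closed (A i)" for i using A[of i] closed_cylinder_set by metis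
    fix I :: "nat set" assume I: "finite I"
    show "UNIV \<inter> (\<Inter>i\<in>I. A i) \<noteq> {}"
    proof (cases "I = {}")
      case False
      have "A (Max I) \<subseteq> (\<Inter>i\<in>I. A i)"
        using \<open>decseq A\<close> I by (intro INT_greatest) (auto simp: decseq_def)
      then show ?thesis using ne by blast
    qed simp
  qed
  then show False using assms(3) by simp
qed

text \<open>Consistency under extension by one letter yields a content on the algebra of clopen
  sets; compactness gives continuity at the empty set, and Caratheodory's theorem extends
  it.\<close>

lemma measure_of_word_function:
  fixes u :: "'a::{finite,discrete_topology} list \<Rightarrow> real"
  assumes u: "\<And>w. u w \<ge> 0" "u [] = 1" "\<And>w. (\<Sum>c\<in>UNIV. u (w @ [c])) = u w"
  shows "\<exists>M. prob_space M \<and> sets M = sets borel \<and> (\<forall>w. measure M (cylinder w) = u w)"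
proof -
  define \<A> where "\<A> = {cylinder_set n W :: (nat \<Rightarrow> 'a) set | n W. True}"
  have sum_ext: "(\<Sum>w\<in>words k. u (v @ w)) = u v" for k v
  proof (induction k)
    case (Suc k)
    have "(\<Sum>w\<in>words (k + 1). u (v @ w)) = (\<Sum>w\<in>words k. \<Sum>c\<in>UNIV. u (v @ w @ [c]))"
      using sum_words_add[of "\<lambda>w. u (v @ w)" k "Suc 0"] by (simp add: sum_words_1)
    also have "\<dots> = u v" using u(3)[of "v @ _"] Suc by simp
    finally show ?case by simp
  qed simp
  \<comment> \<open>A clopen set has presentations of many lengths. The limit refers to the set
    alone, and the sum is constant once \<open>n\<close> reaches the length of any presentation, so
    \<open>g\<close> is well defined.\<close>
  define g where "g A = lim (\<lambda>n. \<Sum>w\<in>{w \<in> words n. cylinder w \<subseteq> A}. u w)" for A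
  have g: "g (cylinder_set N W) = (\<Sum>v\<in>W \<inter> words N. u v)" for N W
  proof -
    have "(\<Sum>w\<in>{w \<in> words n. cylinder w \<subseteq> cylinder_set N W}. u w) = (\<Sum>v\<in>W \<inter> words N. u v)"
      if n: "n \<ge> N" for n
    proof -
      have iff: "cylinder (v @ w) \<subseteq> cylinder_set N W \<longleftrightarrow> v \<in> W" if "v \<in> words N" for v w
      proof
        assume "cylinder (v @ w) \<subseteq> cylinder_set N W"
        then have "prepend (v @ w) undefined \<in> cylinder_set N W" using prepend_in_cylinder by blast
        then have "take N (prefix_word (length (v @ w)) (prepend (v @ w) undefined)) \<in> W"
          using that by (subst take_prefix_word) (auto simp: words_def cylinder_set_def)
        then show "v \<in> W" using that unfolding prefix_word_prepend by (simp add: words_def)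
      next
        assume "v \<in> W"
        then show "cylinder (v @ w) \<subseteq> cylinder_set N W"
          using that by (auto simp: mem_cylinder_append_iff cylinder_set_def mem_cylinder_iff)
      qed
      obtain k where k: "n = N + k" using n le_Suc_ex by blast
      have "(\<Sum>w\<in>{w \<in> words n. cylinder w \<subseteq> cylinder_set N W}. u w)
          = (\<Sum>w\<in>words n. if cylinder w \<subseteq> cylinder_set N W then u w else 0)"
        by (simp add: sum.inter_filter)
      also have "\<dots> = (\<Sum>v\<in>words N. \<Sum>w\<in>words k. if cylinder (v @ w) \<subseteq> cylinder_set N W then u (v @ w) else 0)"
        unfolding k by (rule sum_words_add)
      also have "\<dots> = (\<Sum>v\<in>words N. if v \<in> W then u v else 0)"
        by (intro sum.cong refl) (simp add: iff sum_ext)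
      also have "\<dots> = (\<Sum>v\<in>W \<inter> words N. u v)"
        by (simp add: sum.If_cases Int_commute)
      finally show ?thesis .
    qed
    then have "eventually (\<lambda>n. (\<Sum>w\<in>{w \<in> words n. cylinder w \<subseteq> cylinder_set N W}. u w) = (\<Sum>v\<in>W \<inter> words N. u v)) sequentially"
      by (auto simp: eventually_sequentially)
    then show ?thesis unfolding g_def by (intro limI tendsto_eventually)
  qed
  have common: "\<exists>n V V'. A = cylinder_set n V \<and> B = cylinder_set n V'"
    if AB: "A \<in> \<A>" "B \<in> \<A>" for A B
  proof -
    obtain n W m W' where "A = cylinder_set n W" "B = cylinder_set m W'"
      using AB by (auto simp: \<A>_def)
    then show ?thesis
      using cylinder_set_lift[of n "max n m" W] cylinder_set_lift[of m "max n m" W'] by auto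
  qed
  have \<A>_I: "cylinder_set n W \<in> \<A>" for n W by (auto simp: \<A>_def)
  have \<A>_sets: "\<A> \<subseteq> sets borel" by (auto simp: \<A>_def)
  interpret ring_of_sets UNIV \<A>
  proof (rule ring_of_setsI)
    have "cylinder_set 0 {} = {}" by (simp add: cylinder_set_def)
    then show "{} \<in> \<A>" using \<A>_I by metis
  next
    fix A B assume "A \<in> \<A>" "B \<in> \<A>"
    then obtain n V V' where AB: "A = cylinder_set n V" "B = cylinder_set n V'" using common by blast
    then have "A \<union> B = cylinder_set n (V \<union> V')" "A - B = cylinder_set n (V - V')"
      by (auto simp: cylinder_set_def)
    then show "A \<union> B \<in> \<A>" "A - B \<in> \<A>" using \<A>_I by metis+
  qed simp
  have g_nonneg: "g A \<ge> 0" if "A \<in> \<A>" for A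
    using that u(1) by (auto simp: \<A>_def g intro!: sum_nonneg)
  have g_empty: "g {} = 0" using g[of 0 "{}"] by (simp add: cylinder_set_def)
  have "\<exists>\<mu> :: (nat \<Rightarrow> 'a) set \<Rightarrow> ennreal. (\<forall>s \<in> \<A>. \<mu> s = ennreal (g s)) \<and> measure_space UNIV (sigma_sets UNIV \<A>) \<mu>"
  proof (rule caratheodory_empty_continuous)
    show "positive \<A> (\<lambda>A. ennreal (g A))" by (simp add: positive_def g_empty)
    show "additive \<A> (\<lambda>A. ennreal (g A))"
    proof (unfold additive_def, intro ballI impI)
      fix A B assume AB: "A \<in> \<A>" "B \<in> \<A>" "A \<inter> B = {}"
      then obtain n V V' where eq: "A = cylinder_set n V" "B = cylinder_set n V'" using common[OF AB(1,2)] by metis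
      have "V \<inter> V' \<inter> words n = {}"
      proof (rule ccontr)
        assume "V \<inter> V' \<inter> words n \<noteq> {}"
        then obtain w where w: "w \<in> V" "w \<in> V'" "length w = n" by (auto simp: words_def)
        then have "prepend w undefined \<in> A \<inter> B" by (auto simp: eq cylinder_set_def)
        then show False using AB by simp
      qed
      then have "(\<Sum>v\<in>(V \<inter> words n) \<union> (V' \<inter> words n). u v) = (\<Sum>v\<in>V \<inter> words n. u v) + (\<Sum>v\<in>V' \<inter> words n. u v)"
        by (intro sum.union_disjoint) auto
      moreover have "A \<union> B = cylinder_set n (V \<union> V')" by (auto simp: eq cylinder_set_def)
      ultimately have "g (A \<union> B) = g A + g B" by (simp add: eq g Int_Un_distrib2)
      then show "ennreal (g (A \<union> B)) = ennreal (g A) + ennreal (g B)"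
        using g_nonneg AB by simp
    qed
    show "(\<lambda>i. ennreal (g (A i))) \<longlonglongrightarrow> 0" if A: "range A \<subseteq> \<A>" "decseq A" "(\<Inter>i. A i) = {}" for A
    proof -
      have "\<exists>n W. A i = cylinder_set n W" for i using A(1) by (auto simp: \<A>_def image_subset_iff)
      then obtain i where "A i = {}" using decseq_cylinder_set_empty A by blast
      then have "\<forall>j\<ge>i. A j = {}" using A(2) by (auto simp: decseq_def)
      then have "eventually (\<lambda>j. ennreal (g (A j)) = 0) sequentially"
        unfolding eventually_sequentially by (intro exI[of _ i]) (simp add: g_empty)
      then show ?thesis by (rule tendsto_eventually)
    qed
  qed simp
  then obtain \<mu> where \<mu>: "\<And>s. s \<in> \<A> \<Longrightarrow> \<mu> s = ennreal (g s)" "measure_space UNIV (sigma_sets UNIV \<A>) \<mu>"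
    by blast
  have sig: "sigma_sets UNIV \<A> = sets borel"
  proof
    show "sigma_sets UNIV \<A> \<subseteq> sets borel"
      using sets.sigma_sets_subset[of \<A> "borel :: (nat \<Rightarrow> 'a) measure"] by (simp add: \<A>_sets)
    show "sets borel \<subseteq> sigma_sets UNIV \<A>"
      unfolding sets_borel_eq_sigma_cylinders
      by (rule sigma_sets_mono) (auto simp: cylinder_eq_cylinder_set \<A>_I)
  qed
  define M where "M = measure_of UNIV \<A> \<mu>"
  have sets: "sets M = sets borel" by (simp add: M_def sig sets_measure_of)
  have em: "emeasure M s = ennreal (g s)" if "s \<in> \<A>" for s
  proof -
    have "sets M = sigma_sets UNIV \<A>" by (simp add: M_def sets_measure_of)
    then have "emeasure M s = \<mu> s"
      using \<mu>(2) that by (intro emeasure_measure_of[OF M_def]) (auto simp: measure_space_def)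
    then show ?thesis using \<mu>(1)[OF that] by simp
  qed
  have cyl: "emeasure M (cylinder w) = ennreal (u w)" for w
    using em[OF \<A>_I[of "length w" "{w}"]] g[of "length w" "{w}"]
    by (simp add: cylinder_eq_cylinder_set words_def)
  have "prob_space M"
    using cyl[of "[]"] u(2) by (intro prob_spaceI) (simp add: M_def space_measure_of_conv)
  moreover have "measure M (cylinder w) = u w" for w
    using cyl[of w] u(1)[of w] by (simp add: measure_def)
  ultimately show ?thesis using sets by blast
qed

text \<open>Cylinder masses form a point in a countable product of unit intervals, which is compact
  and metrizable, hence sequentially compact. The consistency conditions are finite sums and survive
  the coordinatewise limit.\<close>

lemma prob_space_shift_weak_compact:
  fixes M :: "nat \<Rightarrow> (nat \<Rightarrow> 'a::{finite,discrete_topology}) measure"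
  assumes M: "\<And>k. prob_space (M k)" "\<And>k. sets (M k) = sets borel"
  shows "\<exists>N r. prob_space N \<and> sets N = sets borel \<and> strict_mono (r :: nat \<Rightarrow> nat) \<and>
    (\<forall>w. (\<lambda>k. measure (M (r k)) (cylinder w)) \<longlonglongrightarrow> measure N (cylinder w))"
proof -
  define u where "u k w = measure (M k) (cylinder w)" for k and w :: "'a list"
  have "compactin (product_topology (\<lambda>w::'a list. euclidean :: real topology) UNIV) (Pi\<^sub>E UNIV (\<lambda>_. {0..1}))"
    by (subst compactin_PiE) auto
  then have "compact (Pi\<^sub>E (UNIV :: 'a list set) (\<lambda>_. {0..1::real}))"
    by (simp add: euclidean_product_topology)
  then have "seq_compact (Pi\<^sub>E (UNIV :: 'a list set) (\<lambda>_. {0..1::real}))"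
    by (simp add: compact_eq_seq_compact_metric)
  moreover have "\<forall>k. u k \<in> Pi\<^sub>E UNIV (\<lambda>_. {0..1})"
    using prob_space.prob_le_1[OF M(1)] by (auto simp: u_def)
  ultimately obtain l r where r: "strict_mono (r :: nat \<Rightarrow> nat)" "((u \<circ> r) \<longlongrightarrow> l) sequentially"
    by (rule seq_compactE) 
  have l: "(\<lambda>k. u (r k) w) \<longlonglongrightarrow> l w" for w
  proof -
    have "continuous_on UNIV (\<lambda>f :: 'a list \<Rightarrow> real. f w)"
      by (rule continuous_on_product_coordinates)
    from continuous_on_tendsto_compose[OF this r(2)] show ?thesis by (simp add: o_def)
  qed
  have "l w \<ge> 0" for w
    using l[of w] by (rule LIMSEQ_le_const) (auto simp: u_def)
  moreover have "l [] = 1"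
  proof -
    have "u k [] = 1" for k
      using prob_space.prob_space[OF M(1)[of k]] sets_eq_imp_space_eq[OF M(2)[of k]] by (simp add: u_def)
    then show ?thesis using l[of "[]"] by (simp add: LIMSEQ_const_iff)
  qed
  moreover have "(\<Sum>c\<in>UNIV. l (w @ [c])) = l w" for w
  proof -
    have "(\<Sum>c\<in>UNIV. u k (w @ [c])) = u k w" for k
    proof -
      interpret prob_space "M k" by (rule M(1))
      have "measure (M k) (\<Union>c\<in>UNIV. cylinder (w @ [c])) = (\<Sum>c\<in>UNIV. measure (M k) (cylinder (w @ [c])))"
      proof (rule finite_measure_finite_Union)
        show "(\<lambda>c. cylinder (w @ [c])) ` UNIV \<subseteq> sets (M k)" by (simp add: M(2) image_subset_iff)
        show "disjoint_family_on (\<lambda>c. cylinder (w @ [c])) UNIV"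
          unfolding disjoint_family_on_def by (simp add: set_eq_iff mem_cylinder_snoc_iff)
      qed simp
      moreover have "(\<Union>c\<in>UNIV. cylinder (w @ [c])) = cylinder w"
        by (auto simp: mem_cylinder_snoc_iff)
      ultimately show ?thesis by (simp add: u_def)
    qed
    then have "(\<lambda>k. u (r k) w) \<longlonglongrightarrow> (\<Sum>c\<in>UNIV. l (w @ [c]))"
      using tendsto_sum[of UNIV "\<lambda>c k. u (r k) (w @ [c])" "\<lambda>c. l (w @ [c])"] l by simp
    then show ?thesis using l[of w] LIMSEQ_unique by blast
  qed
  ultimately obtain N where "prob_space N" "sets N = sets borel" "\<forall>w. measure N (cylinder w) = l w"
    using measure_of_word_function[of l] by blast
  then show ?thesis using r(1) l unfolding u_def by metis
qed

section \<open>Entropy of the shift\<close>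

lemma (in prob_space) prob_eq_sum_values:
  assumes "finite F" and Y[measurable]: "Y \<in> M \<rightarrow>\<^sub>M count_space F"
  shows "prob {x \<in> space M. Q (Y x)} = (\<Sum>y\<in>{y \<in> F. Q y}. prob {x \<in> space M. Y x = y})"
proof -
  have F: "Y x \<in> F" if "x \<in> space M" for x using measurable_space[OF Y that] by simp
  have "{x \<in> space M. Q (Y x)} = (\<Union>y\<in>{y \<in> F. Q y}. {x \<in> space M. Y x = y})" using F by auto
  moreover have "prob (\<Union>y\<in>{y \<in> F. Q y}. {x \<in> space M. Y x = y}) = (\<Sum>y\<in>{y \<in> F. Q y}. prob {x \<in> space M. Y x = y})"
  proof (rule finite_measure_finite_Union)
    show "(\<lambda>y. {x \<in> space M. Y x = y}) ` {y \<in> F. Q y} \<subseteq> events" by auto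
  qed (use assms in \<open>auto simp: disjoint_family_on_def\<close>)
  ultimately show ?thesis by simp
qed

lemma lists_Suc: "{s. set s \<subseteq> S \<and> length s = Suc n} = (\<lambda>(c, s). c # s) ` (S \<times> {s. set s \<subseteq> S \<and> length s = n})"
  by (auto simp: length_Suc_conv image_iff)

text \<open>Needed to see that a product of guesses, one for each time, has total mass at most 1
  over all itineraries.\<close>

lemma sum_lists_prod:
  fixes f :: "nat \<Rightarrow> 's \<Rightarrow> real"
  assumes "finite S"
  shows "(\<Sum>s\<in>{s. set s \<subseteq> S \<and> length s = n}. \<Prod>i<n. f i (s ! i)) = (\<Prod>i<n. \<Sum>c\<in>S. f i c)"
proof (induction n arbitrary: f)
  case 0
  have "{s. set s \<subseteq> S \<and> length s = 0} = {[]}" by auto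
  then show ?case by simp
next
  case (Suc n)
  have inj: "inj_on (\<lambda>(c, s). c # s) (S \<times> {s. set s \<subseteq> S \<and> length s = n})"
    by (auto simp: inj_on_def)
  have "(\<Sum>s\<in>{s. set s \<subseteq> S \<and> length s = Suc n}. \<Prod>i<Suc n. f i (s ! i))
      = (\<Sum>(c, s)\<in>S \<times> {s. set s \<subseteq> S \<and> length s = n}. f 0 c * (\<Prod>i<n. f (Suc i) (s ! i)))"
    unfolding lists_Suc sum.reindex[OF inj] by (simp add: case_prod_unfold prod.lessThan_Suc_shift del: prod.lessThan_Suc)
  also have "\<dots> = (\<Sum>c\<in>S. f 0 c) * (\<Sum>s\<in>{s. set s \<subseteq> S \<and> length s = n}. \<Prod>i<n. f (Suc i) (s ! i))"
    by (simp add: sum_product sum.cartesian_product)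
  finally show ?case using Suc[of "\<lambda>i. f (Suc i)"] by (simp add: prod.lessThan_Suc_shift del: prod.lessThan_Suc)
qed

text \<open>The label \<open>X\<close> may be the first letter of a point or the atom of a finite
  partition containing it, so subadditivity of entropy is proved once for both.\<close>

locale stationary_process = prob_space M for M :: "'x measure" +
  fixes T :: "'x \<Rightarrow> 'x" and X :: "'x \<Rightarrow> 's" and S :: "'s set"
  assumes T [measurable]: "T \<in> M \<rightarrow>\<^sub>M M" and invariant: "distr M M T = M"
    and finite_S: "finite S" and X [measurable]: "X \<in> M \<rightarrow>\<^sub>M count_space S"
begin

definition itinerary :: "nat \<Rightarrow> 'x \<Rightarrow> 's list" where
  "itinerary n x = map (\<lambda>i. X ((T ^^ i) x)) [0..<n]"

definition itineraries :: "nat \<Rightarrow> 's list set" where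
  "itineraries n = {s. set s \<subseteq> S \<and> length s = n}"

definition itinerary_prob :: "'s list \<Rightarrow> real" where
  "itinerary_prob s = prob {x \<in> space M. itinerary (length s) x = s}"

definition block_entropy :: "nat \<Rightarrow> real" where
  "block_entropy n = - (\<Sum>s\<in>itineraries n. itinerary_prob s * ln (itinerary_prob s))"

lemma funpow_measurable [measurable]: "T ^^ n \<in> M \<rightarrow>\<^sub>M M"
  by (induction n) simp_all

lemma distr_funpow: "distr M M (T ^^ n) = M"
proof (induction n)
  case (Suc n)
  have "distr M M (T \<circ> T ^^ n) = distr (distr M M (T ^^ n)) M T"
    by (rule distr_distr[symmetric]) measurable
  also have "\<dots> = M" using Suc invariant by simp
  finally show ?case by (simp only: funpow.simps)
qed (simp add: distr_id2)

lemma prob_vimage_funpow: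
  assumes "B \<in> events" shows "prob {x \<in> space M. (T ^^ n) x \<in> B} = prob B"
proof -
  have "prob B = measure (distr M M (T ^^ n)) B" by (simp add: distr_funpow)
  also have "\<dots> = prob ((T ^^ n) -` B \<inter> space M)" by (rule measure_distr) (use assms in auto)
  also have "(T ^^ n) -` B \<inter> space M = {x \<in> space M. (T ^^ n) x \<in> B}" by auto
  finally show ?thesis by simp
qed

lemma funpow_space: "x \<in> space M \<Longrightarrow> (T ^^ n) x \<in> space M"
  using measurable_space[OF funpow_measurable] .

lemma X_in_S: "x \<in> space M \<Longrightarrow> X x \<in> S"
  using measurable_space[OF X] by simp

lemma finite_itineraries [simp]: "finite (itineraries n)"
  using finite_lists_length_eq[OF finite_S] by (simp add: itineraries_def)

lemma length_itinerary [simp]: "length (itinerary n x) = n"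
  by (simp add: itinerary_def)

lemma itinerary_eq_iff: "itinerary n x = s \<longleftrightarrow> length s = n \<and> (\<forall>i<n. X ((T ^^ i) x) = s ! i)"
  by (auto simp: itinerary_def list_eq_iff_nth_eq)

lemma itinerary_add: "itinerary (n + m) x = itinerary n x @ itinerary m ((T ^^ n) x)"
  by (rule nth_equalityI) (auto simp: itinerary_def nth_append funpow_add[symmetric] simp flip: comp_apply[of "T ^^ _" "T ^^ _"])

lemma itinerary_measurable [measurable]: "itinerary n \<in> M \<rightarrow>\<^sub>M count_space (itineraries n)"
proof (subst measurable_count_space_eq2)
  have "itinerary n -` {s} \<inter> space M \<in> events" for s
  proof (cases "length s = n")
    case True
    have "{x \<in> space M. \<forall>i\<in>{..<n}. X ((T ^^ i) x) = s ! i} \<in> events" by measurable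
    also have "{x \<in> space M. \<forall>i\<in>{..<n}. X ((T ^^ i) x) = s ! i} = itinerary n -` {s} \<inter> space M"
      using True by (auto simp: itinerary_eq_iff)
    finally show ?thesis .
  next
    case False
    then have "itinerary n -` {s} \<inter> space M = {}" by (auto simp: itinerary_eq_iff)
    then show ?thesis by simp
  qed
  moreover have "itinerary n \<in> space M \<rightarrow> itineraries n"
    using X_in_S funpow_space by (auto simp: itineraries_def itinerary_def)
  ultimately show "itinerary n \<in> space M \<rightarrow> itineraries n \<and> (\<forall>s\<in>itineraries n. itinerary n -` {s} \<inter> space M \<in> events)"
    by blast
qed simp

lemma itinerary_in: "x \<in> space M \<Longrightarrow> itinerary n x \<in> itineraries n"
  using measurable_space[OF itinerary_measurable] by simp

lemma itinerary_prob_nonneg [simp]: "itinerary_prob s \<ge> 0"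
  by (simp add: itinerary_prob_def)

lemma itinerary_prob_le_1: "itinerary_prob s \<le> 1"
  by (simp add: itinerary_prob_def)

lemma sum_itinerary_prob: "(\<Sum>s\<in>itineraries n. itinerary_prob s) = 1"
proof -
  have "(\<Sum>s\<in>itineraries n. itinerary_prob s) = (\<Sum>s\<in>{s \<in> itineraries n. True}. prob {x \<in> space M. itinerary n x = s})"
    by (intro sum.cong) (auto simp: itinerary_prob_def itineraries_def)
  also have "\<dots> = prob {x \<in> space M. True}"
    by (rule prob_eq_sum_values[OF finite_itineraries itinerary_measurable, symmetric])
  finally show ?thesis by (simp add: prob_space)
qed

text \<open>Summing out the last labels is plain additivity; summing out the first labels is where
  invariance is used.\<close>

lemma sum_itinerary_prob_append:
  assumes "s \<in> itineraries n"
  shows "(\<Sum>t\<in>itineraries m. itinerary_prob (s @ t)) = itinerary_prob s"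
    and "(\<Sum>t\<in>itineraries m. itinerary_prob (t @ s)) = itinerary_prob s"
proof -
  have len: "length s = n" using assms by (simp add: itineraries_def)
  have "(\<Sum>t\<in>itineraries m. itinerary_prob (s @ t)) =
      (\<Sum>t\<in>itineraries m. prob ({x \<in> space M. itinerary n x = s} \<inter> {x \<in> space M. itinerary m ((T ^^ n) x) = t}))"
    by (intro sum.cong refl)
      (auto simp: itinerary_prob_def itineraries_def len itinerary_add intro!: arg_cong[where f = prob])
  also have "\<dots> = prob (\<Union>t\<in>itineraries m. {x \<in> space M. itinerary n x = s} \<inter> {x \<in> space M. itinerary m ((T ^^ n) x) = t})"
    by (rule finite_measure_finite_Union[symmetric]) (auto simp: disjoint_family_on_def)
  also have "(\<Union>t\<in>itineraries m. {x \<in> space M. itinerary n x = s} \<inter> {x \<in> space M. itinerary m ((T ^^ n) x) = t})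
      = {x \<in> space M. itinerary n x = s}"
    using itinerary_in funpow_space by auto
  finally show "(\<Sum>t\<in>itineraries m. itinerary_prob (s @ t)) = itinerary_prob s"
    by (simp add: itinerary_prob_def len)
  have "(\<Sum>t\<in>itineraries m. itinerary_prob (t @ s)) =
      (\<Sum>t\<in>itineraries m. prob ({x \<in> space M. itinerary m x = t} \<inter> {x \<in> space M. itinerary n ((T ^^ m) x) = s}))"
    by (intro sum.cong refl)
      (auto simp: itinerary_prob_def itineraries_def len itinerary_add intro!: arg_cong[where f = prob])
  also have "\<dots> = prob (\<Union>t\<in>itineraries m. {x \<in> space M. itinerary m x = t} \<inter> {x \<in> space M. itinerary n ((T ^^ m) x) = s})"
    by (rule finite_measure_finite_Union[symmetric]) (auto simp: disjoint_family_on_def)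
  also have "(\<Union>t\<in>itineraries m. {x \<in> space M. itinerary m x = t} \<inter> {x \<in> space M. itinerary n ((T ^^ m) x) = s})
      = {x \<in> space M. (T ^^ m) x \<in> {x \<in> space M. itinerary n x = s}}"
    using itinerary_in funpow_space by auto
  also have "prob \<dots> = itinerary_prob s"
    by (subst prob_vimage_funpow) (auto simp: itinerary_prob_def len)
  finally show "(\<Sum>t\<in>itineraries m. itinerary_prob (t @ s)) = itinerary_prob s" .
qed

lemma sum_itineraries_add:
  fixes f :: "'s list \<Rightarrow> real"
  shows "(\<Sum>s\<in>itineraries (n + m). f s) = (\<Sum>s\<in>itineraries n. \<Sum>t\<in>itineraries m. f (s @ t))"
proof -
  have "itineraries (n + m) = (\<lambda>(s, t). s @ t) ` (itineraries n \<times> itineraries m)"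
  proof (intro equalityI subsetI)
    fix s assume "s \<in> itineraries (n + m)"
    then show "s \<in> (\<lambda>(s, t). s @ t) ` (itineraries n \<times> itineraries m)"
      by (intro image_eqI[of _ _ "(take n s, drop n s)"])
        (auto simp: itineraries_def dest: in_set_takeD in_set_dropD)
  qed (auto simp: itineraries_def)
  moreover have "inj_on (\<lambda>(s, t). s @ t) (itineraries n \<times> itineraries m)"
    by (auto simp: inj_on_def itineraries_def)
  ultimately have "(\<Sum>s\<in>itineraries (n + m). f s) = (\<Sum>(s, t)\<in>itineraries n \<times> itineraries m. f (s @ t))"
    by (simp add: sum.reindex case_prod_unfold o_def)
  then show ?thesis by (simp add: sum.cartesian_product)
qed

lemma block_entropy_nonneg: "block_entropy n \<ge> 0"
proof -
  have "itinerary_prob s * ln (itinerary_prob s) \<le> 0" for s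
    using itinerary_prob_le_1[of s] by (cases "itinerary_prob s = 0") (auto intro!: mult_nonneg_nonpos simp: less_le)
  then show ?thesis unfolding block_entropy_def by (simp add: sum_nonpos)
qed

text \<open>The Gibbs inequality compares the law of the long itinerary with the product of its two
  marginals. Summing out either part in the cross term leaves the entropy of the other.\<close>

lemma block_entropy_subadditive: "block_entropy (n + m) \<le> block_entropy n + block_entropy m"
proof -
  let ?p = itinerary_prob
  have le: "?p (s @ t) \<le> ?p s" "?p (s @ t) \<le> ?p t" if "s \<in> itineraries n" "t \<in> itineraries m" for s t
  proof -
    show "?p (s @ t) \<le> ?p s"
      unfolding sum_itinerary_prob_append(1)[OF that(1), of m, symmetric] using that by (intro member_le_sum) auto
    show "?p (s @ t) \<le> ?p t"
      unfolding sum_itinerary_prob_append(2)[OF that(2), of n, symmetric]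
      using that member_le_sum[of s "itineraries n" "\<lambda>s. ?p (s @ t)"] by auto
  qed
  let ?I = "itineraries n \<times> itineraries m"
  have "(\<Sum>(s, t)\<in>?I. ?p (s @ t) * ln (?p s * ?p t)) - (\<Sum>(s, t)\<in>?I. ?p (s @ t) * ln (?p (s @ t)))
      \<le> (\<Sum>(s, t)\<in>?I. ?p s * ?p t) - (\<Sum>(s, t)\<in>?I. ?p (s @ t))"
    using gibbs_inequality[of ?I "\<lambda>(s, t). ?p (s @ t)" "\<lambda>(s, t). ?p s * ?p t"] le
    by (fastforce simp: case_prod_unfold zero_less_mult_iff)
  also have "(\<Sum>(s, t)\<in>?I. ?p s * ?p t) = 1"
    by (simp flip: sum.cartesian_product sum_product add: sum_itinerary_prob)
  also have "(\<Sum>(s, t)\<in>?I. ?p (s @ t)) = 1"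
    using sum_itineraries_add[of ?p n m] by (simp add: sum_itinerary_prob sum.cartesian_product)
  also have "(\<Sum>(s, t)\<in>?I. ?p (s @ t) * ln (?p (s @ t))) = - block_entropy (n + m)"
    by (simp add: block_entropy_def sum_itineraries_add sum.cartesian_product)
  also have "(\<Sum>(s, t)\<in>?I. ?p (s @ t) * ln (?p s * ?p t)) = (\<Sum>(s, t)\<in>?I. ?p (s @ t) * ln (?p s)) + (\<Sum>(s, t)\<in>?I. ?p (s @ t) * ln (?p t))"
    unfolding sum.distrib[symmetric]
  proof (intro sum.cong refl, clarify)
    fix s t assume st: "s \<in> itineraries n" "t \<in> itineraries m"
    show "?p (s @ t) * ln (?p s * ?p t) = ?p (s @ t) * ln (?p s) + ?p (s @ t) * ln (?p t)"
    proof (cases "?p (s @ t) = 0")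
      case False
      then have "?p (s @ t) > 0" by (simp add: less_le)
      then have "?p s > 0" "?p t > 0" using le[OF st] by linarith+
      then show ?thesis by (simp add: ln_mult algebra_simps)
    qed simp
  qed
  also have "(\<Sum>(s, t)\<in>?I. ?p (s @ t) * ln (?p s)) = - block_entropy n"
    by (simp flip: sum.cartesian_product sum_distrib_right
        add: block_entropy_def sum_itinerary_prob_append)
  also have "(\<Sum>(s, t)\<in>?I. ?p (s @ t) * ln (?p t)) = - block_entropy m"
    unfolding sum.cartesian_product[symmetric] sum.swap[of _ "itineraries m" "itineraries n"]
    by (simp flip: sum_distrib_right add: block_entropy_def sum_itinerary_prob_append)
  finally show ?thesis by simp
qed

lemma block_entropy_limit:
  "\<exists>h. (\<lambda>n. block_entropy n / real n) \<longlonglongrightarrow> h"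
  using almost_subadditive_limit[of block_entropy 0 0] block_entropy_subadditive block_entropy_nonneg
  by auto

end

section \<open>Letters and finite partitions as labellings\<close>

definition word_entropy :: "(nat \<Rightarrow> 'a) measure \<Rightarrow> nat \<Rightarrow> real" where
  "word_entropy M n = - (\<Sum>w\<in>words n. measure M (cylinder w) * ln (measure M (cylinder w)))"

lemma invariant_measures_prob_space: "M \<in> invariant_measures T \<Longrightarrow> prob_space M"
  and invariant_measures_sets: "M \<in> invariant_measures T \<Longrightarrow> sets M = sets borel"
  and invariant_measures_space: "M \<in> invariant_measures T \<Longrightarrow> space M = UNIV"
  by (auto simp: invariant_measures_def dest: sets_eq_imp_space_eq)

lemma coordinate_measurable:
  "(\<lambda>x. x i) \<in> (borel :: (nat \<Rightarrow> 'a::{finite,discrete_topology}) measure) \<rightarrow>\<^sub>M count_space UNIV"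
proof (subst measurable_count_space_eq2)
  have "(\<lambda>x. x i) -` {c} \<inter> space borel \<in> sets (borel :: (nat \<Rightarrow> 'a) measure)" for c :: 'a
  proof -
    have "(\<lambda>x. x i) -` {c} \<inter> space borel = cylinder_set (Suc i) {w. w ! i = c}"
      by (auto simp: cylinder_set_def)
    then show ?thesis by simp
  qed
  then show "(\<lambda>x. x i) \<in> space borel \<rightarrow> UNIV \<and>
    (\<forall>c\<in>UNIV. (\<lambda>x. x i) -` {c} \<inter> space borel \<in> sets (borel :: (nat \<Rightarrow> 'a) measure))" by blast
qed simp

lemma stationary_process_letters:
  assumes "M \<in> invariant_measures (left_shift :: (nat \<Rightarrow> 'a::{finite,discrete_topology}) \<Rightarrow> _)"
  shows "stationary_process M left_shift (\<lambda>x. x 0) UNIV"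
proof -
  interpret prob_space M using assms by (rule invariant_measures_prob_space)
  have "(\<lambda>x. x 0) \<in> M \<rightarrow>\<^sub>M count_space UNIV"
    using coordinate_measurable[of 0] measurable_cong_sets[OF invariant_measures_sets[OF assms] refl] by blast
  then show ?thesis
    using assms by unfold_locales (auto simp: invariant_measures_def)
qed

lemma itinerary_letters:
  assumes "stationary_process M left_shift (\<lambda>x. x 0) (UNIV :: 'a set)"
  shows "stationary_process.itinerary left_shift (\<lambda>x. x 0) n x = (prefix_word n x :: 'a list)"
    and "stationary_process.itineraries (UNIV :: 'a set) n = words n"
  unfolding stationary_process.itinerary_def[OF assms] stationary_process.itineraries_def[OF assms]
  by (auto simp: prefix_word_def left_shift_funpow words_def)

lemma block_entropy_letters:
  assumes "M \<in> invariant_measures (left_shift :: (nat \<Rightarrow> 'a::{finite,discrete_topology}) \<Rightarrow> _)"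
  shows "stationary_process.block_entropy M left_shift (\<lambda>x. x 0) UNIV = word_entropy M"
proof
  fix n
  interpret stationary_process M left_shift "\<lambda>x. x 0" UNIV by (rule stationary_process_letters[OF assms])
  note it = itinerary_letters[OF stationary_process_axioms]
  have "itinerary_prob w = measure M (cylinder w)" for w
    unfolding itinerary_prob_def it by (simp add: cylinder_def invariant_measures_space[OF assms])
  then show "block_entropy n = word_entropy M n" by (simp add: block_entropy_def it word_entropy_def)
qed

lemma stationary_process_partition:
  assumes M: "prob_space M" "T \<in> M \<rightarrow>\<^sub>M M" "distr M M T = M"
    and P: "\<P> \<in> finite_measurable_partitions M"
  shows "stationary_process M T (\<lambda>x. THE A. A \<in> \<P> \<and> x \<in> A) \<P>"
    and "partition_entropy M (iterated_join M T \<P> n) =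
      stationary_process.block_entropy M T (\<lambda>x. THE A. A \<in> \<P> \<and> x \<in> A) \<P> n"
proof -
  interpret prob_space M by fact
  define X where "X x = (THE A. A \<in> \<P> \<and> x \<in> A)" for x
  have P: "finite \<P>" "\<P> \<subseteq> events" "\<Union>\<P> = space M" "disjoint \<P>"
    using P by (auto simp: finite_measurable_partitions_def partition_on_def)
  have X_iff: "X x = A \<longleftrightarrow> x \<in> A" if "A \<in> \<P>" "x \<in> space M" for x A
  proof -
    obtain B where B: "B \<in> \<P>" "x \<in> B" using P(3) \<open>x \<in> space M\<close> by blast
    have uniq: "C = B" if "C \<in> \<P>" "x \<in> C" for C
      using disjointD[OF P(4) that(1) B(1)] B(2) that(2) by blast
    have "X x = B" unfolding X_def by (rule the_equality) (use B uniq in blast)+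
    then show ?thesis using uniq[OF \<open>A \<in> \<P>\<close>] B(2) by metis
  qed
  have X_in: "X x \<in> \<P>" if x: "x \<in> space M" for x
  proof -
    obtain A where "A \<in> \<P>" "x \<in> A" using P(3) x by blast
    then show ?thesis using X_iff[OF _ x] by metis
  qed
  have "X \<in> M \<rightarrow>\<^sub>M count_space \<P>"
  proof (subst measurable_count_space_eq2)
    have "X -` {A} \<inter> space M = A" if "A \<in> \<P>" for A
      using X_iff[OF that] P(3) that by auto
    then show "X \<in> space M \<rightarrow> \<P> \<and> (\<forall>A\<in>\<P>. X -` {A} \<inter> space M \<in> events)"
      using X_in P(2) by auto
  qed (rule P)
  then interpret X: stationary_process M T X \<P>
    using assms P by unfold_locales auto
  show "stationary_process M T (\<lambda>x. THE A. A \<in> \<P> \<and> x \<in> A) \<P>"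
    using X.stationary_process_axioms unfolding X_def .
  define J where "J s = {x \<in> space M. X.itinerary n x = s}" for s
  have J_eq: "J s = {x \<in> space M. \<forall>i<n. (T ^^ i) x \<in> s ! i}" if "s \<in> X.itineraries n" for s
  proof -
    have "s ! i \<in> \<P>" if "i < n" for i
      using that \<open>s \<in> X.itineraries n\<close> by (auto simp: X.itineraries_def)
    then have "X ((T ^^ i) x) = s ! i \<longleftrightarrow> (T ^^ i) x \<in> s ! i" if "i < n" "x \<in> space M" for i x
      using that X_iff X.funpow_space by metis
    then show ?thesis using that
      by (auto simp: J_def X.itinerary_eq_iff X.itineraries_def)
  qed
  have join: "iterated_join M T \<P> n = J ` X.itineraries n"
  proof (intro equalityI subsetI)
    fix B assume "B \<in> iterated_join M T \<P> n"
    then obtain A where A: "B = {x \<in> space M. \<forall>i<n. (T ^^ i) x \<in> A i}" "\<forall>i<n. A i \<in> \<P>"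
      by (auto simp: iterated_join_def)
    have s: "map A [0..<n] \<in> X.itineraries n" using A(2) by (auto simp: X.itineraries_def)
    moreover have "B = J (map A [0..<n])" unfolding J_eq[OF s] A(1) by auto
    ultimately show "B \<in> J ` X.itineraries n" by blast
  next
    fix B assume "B \<in> J ` X.itineraries n"
    then obtain s where s: "s \<in> X.itineraries n" "B = J s" by blast
    then have "\<forall>i<n. s ! i \<in> \<P>" by (auto simp: X.itineraries_def)
    then show "B \<in> iterated_join M T \<P> n"
      using s J_eq[OF s(1)] unfolding iterated_join_def by blast
  qed
  \<comment> \<open>The join is a set of sets, so label sequences with the same event are merged.
    This happens only for empty events, which contribute nothing to the entropy.\<close>
  have empty: "J s = {}" if "J s = J t" "s \<noteq> t" for s t
    using that by (auto simp: J_def)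
  have "partition_entropy M (iterated_join M T \<P> n) = - (\<Sum>s\<in>X.itineraries n. prob (J s) * ln (prob (J s)))"
    unfolding partition_entropy_def join
    using empty by (subst sum.reindex_nontrivial) (simp, metis measure_empty mult_zero_left, simp)
  also have "\<dots> = X.block_entropy n"
    unfolding X.block_entropy_def X.itinerary_prob_def
    by (intro arg_cong[where f = uminus] sum.cong refl) (auto simp: J_def X.itineraries_def)
  finally show "partition_entropy M (iterated_join M T \<P> n) =
      stationary_process.block_entropy M T (\<lambda>x. THE A. A \<in> \<P> \<and> x \<in> A) \<P> n"
    unfolding X_def .
qed

section \<open>The letters generate the entropy: the Kolmogorov-Sinai theorem\<close>

lemma label_approx:
  fixes M :: "(nat \<Rightarrow> 'a::{finite,discrete_topology}) measure"
  assumes M: "prob_space M" "sets M = sets borel" and S: "finite S"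
    and X: "X \<in> M \<rightarrow>\<^sub>M count_space S" and d: "d > 0"
  shows "\<exists>k g. (\<forall>v. g v \<in> S) \<and> measure M {x \<in> space M. X x \<noteq> g (prefix_word k x)} < d"
proof -
  interpret prob_space M by fact
  note [measurable] = X
  have space: "space M = UNIV" using sets_eq_imp_space_eq[OF M(2)] by simp
  have XS: "X x \<in> S" for x using measurable_space[OF X, of x] space by simp
  have cyl [measurable]: "cylinder_set n W \<in> events" for n W by (simp add: M(2))
  define D where "D c n W = ({x \<in> space M. X x = c} - cylinder_set n W) \<union> (cylinder_set n W - {x \<in> space M. X x = c})" for c n W
  have D_events [measurable]: "D c n W \<in> events" for c n W unfolding D_def using XS by measurable
  \<comment> \<open>An equal share of \<open>d\<close> for every label; the additional 1 makes the
    final estimate strict.\<close>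
  have pos: "d / (real (card S) + 1) > 0" using d by (simp add: add_nonneg_pos)
  have "\<forall>c. \<exists>n W. prob (D c n W) < d / (real (card S) + 1)"
  proof
    fix c
    have "{x \<in> space M. X x = c} \<in> sets borel" unfolding M(2)[symmetric] by measurable
    from cylinder_set_approx[OF finite_measure_axioms finite_measure_axioms M(2) M(2) this] pos
    show "\<exists>n W. prob (D c n W) < d / (real (card S) + 1)" unfolding D_def by blast
  qed
  then obtain n W where nW: "\<And>c. prob (D c (n c) (W c)) < d / (real (card S) + 1)" by metis
  define k where "k = (\<Sum>c\<in>S. n c)"
  have k: "n c \<le> k" if "c \<in> S" for c unfolding k_def using that S by (intro member_le_sum) auto
  \<comment> \<open>The guess is any label whose clopen approximation contains the word. Off the
    exceptional sets \<open>D\<close> exactly the true label qualifies; \<open>X undefined\<close>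
    only keeps the guess inside \<open>S\<close>.\<close>
  define g where "g v = (if \<exists>c\<in>S. take (n c) v \<in> W c then SOME c. c \<in> S \<and> take (n c) v \<in> W c else X undefined)" for v
  have g: "g v \<in> S" for v
    unfolding g_def using someI_ex[of "\<lambda>c. c \<in> S \<and> take (n c) v \<in> W c"] XS by auto
  have sub: "{x \<in> space M. X x \<noteq> g (prefix_word k x)} \<subseteq> (\<Union>c\<in>S. D c (n c) (W c))"
  proof (rule subsetI, rule ccontr)
    fix x assume x: "x \<in> {x \<in> space M. X x \<noteq> g (prefix_word k x)}" and notin: "x \<notin> (\<Union>c\<in>S. D c (n c) (W c))"
    have "X x = c \<longleftrightarrow> x \<in> cylinder_set (n c) (W c)" if c: "c \<in> S" for c
    proof -
      have "x \<notin> D c (n c) (W c)" using notin c by blast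
      then show ?thesis unfolding D_def space by blast
    qed
    then have *: "take (n c) (prefix_word k x) \<in> W c \<longleftrightarrow> X x = c" if "c \<in> S" for c
      using that k[OF that] by (simp add: cylinder_set_def take_prefix_word)
    have "g (prefix_word k x) = X x"
      using * XS[of x] someI_ex[of "\<lambda>c. c \<in> S \<and> take (n c) (prefix_word k x) \<in> W c"] unfolding g_def by auto
    then show False using x by simp
  qed
  have "prob {x \<in> space M. X x \<noteq> g (prefix_word k x)} \<le> prob (\<Union>c\<in>S. D c (n c) (W c))"
    using S by (intro finite_measure_mono[OF sub] sets.finite_UN) auto
  also have "\<dots> \<le> (\<Sum>c\<in>S. prob (D c (n c) (W c)))"
    using S by (intro finite_measure_subadditive_finite) auto
  also have "\<dots> \<le> (\<Sum>c\<in>S. d / (real (card S) + 1))"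
    using nW by (intro sum_mono less_imp_le)
  also have "\<dots> < d" using d by (simp add: field_simps)
  finally show ?thesis using g by blast
qed

lemma Collect_value_in_sets:
  assumes Y: "Y \<in> M \<rightarrow>\<^sub>M count_space F"
  shows "{x \<in> space M. Q (Y x)} \<in> sets M"
proof -
  have "{x \<in> space M. Q (Y x)} = Y -` {y \<in> F. Q y} \<inter> space M"
    using measurable_space[OF Y] by auto
  also have "\<dots> \<in> sets M" by (rule measurable_sets[OF Y]) auto
  finally show ?thesis .
qed

lemma (in prob_space) sum_prob_image:
  fixes f :: "'z \<Rightarrow> real"
  assumes "finite F" "finite F'" and Y: "Y \<in> M \<rightarrow>\<^sub>M count_space F" and h: "h ` F \<subseteq> F'"
  shows "(\<Sum>y\<in>F. prob {x \<in> space M. Y x = y} * f (h y)) = (\<Sum>z\<in>F'. prob {x \<in> space M. h (Y x) = z} * f z)"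
proof -
  have "(\<Sum>z\<in>F'. prob {x \<in> space M. h (Y x) = z} * f z)
      = (\<Sum>z\<in>F'. \<Sum>y\<in>{y \<in> F. h y = z}. prob {x \<in> space M. Y x = y} * f (h y))"
    by (subst prob_eq_sum_values[OF \<open>finite F\<close> Y]) (simp add: sum_distrib_right)
  also have "\<dots> = (\<Sum>y\<in>F. prob {x \<in> space M. Y x = y} * f (h y))"
    using assms by (intro sum.group) auto
  finally show ?thesis by simp
qed

lemma prefix_word_measurable:
  assumes "sets M = sets (borel :: (nat \<Rightarrow> 'a::{finite,discrete_topology}) measure)"
  shows "prefix_word n \<in> M \<rightarrow>\<^sub>M count_space (words n)"
proof (subst measurable_count_space_eq2)
  have "prefix_word n -` {w} \<inter> space M = cylinder_set n {w}" for w :: "'a list"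
    using sets_eq_imp_space_eq[OF assms] by (auto simp: cylinder_set_def)
  then show "prefix_word n \<in> space M \<rightarrow> words n \<and> (\<forall>w\<in>words n. prefix_word n -` {w} \<inter> space M \<in> sets M)"
    by (simp add: assms)
qed simp

lemma prefix_word_funpow_left_shift:
  assumes "i + k \<le> n"
  shows "prefix_word k ((left_shift ^^ i) x) = take k (drop i (prefix_word n x))"
  by (rule nth_equalityI) (use assms in \<open>auto simp: left_shift_funpow\<close>)

text \<open>
  A one-letter guess \<open>r\<close> of the label from the first \<open>k\<close> letters induces the sub-probability \<open>R\<close> below
  on pairs of an itinerary and a word; the Gibbs inequality against \<open>R\<close> replaces the usual calculus of
  conditional entropies in the Kolmogorov--Sinai theorem.
\<close>

lemma block_entropy_le_word_entropy:
  fixes M :: "(nat \<Rightarrow> 'a::{finite,discrete_topology}) measure"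
  assumes inv: "M \<in> invariant_measures left_shift"
    and proc: "stationary_process M left_shift X S" and e: "e > 0"
  shows "\<exists>k. \<forall>n. stationary_process.block_entropy M left_shift X S n \<le> word_entropy M (n + k) + real n * e"
proof -
  interpret stationary_process M left_shift X S by (rule proc)
  note sets = invariant_measures_sets[OF inv] and space = invariant_measures_space[OF inv]
  define N where "N = real (card S)"
  have "S \<noteq> {}" using X_in_S[of undefined] space by auto
  then have N: "N \<ge> 1" using finite_S by (simp add: N_def card_gt_0_iff Suc_le_eq)
  \<comment> \<open>A right guess costs \<open>- ln (1 - \<epsilon>) = e / 2\<close>, a wrong one
    costs \<open>B\<close>; \<open>\<delta>\<close> is so small that wrong guesses cost at most
    another \<open>e / 2\<close> on average. The term \<open>B + 1\<close> guards against
    \<open>B = 0\<close>.\<close>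
  define \<epsilon> where "\<epsilon> = 1 - exp (- e / 2)"
  have \<epsilon>: "0 < \<epsilon>" "\<epsilon> < 1" "ln (1 - \<epsilon>) = - e / 2" using e by (auto simp: \<epsilon>_def)
  define B where "B = ln (N / \<epsilon>)"
  have B: "B \<ge> 0" unfolding B_def using N \<epsilon> by (intro ln_ge_zero) (simp add: field_simps)
  define \<delta> where "\<delta> = e / (2 * (B + 1))"
  have \<delta>: "\<delta> > 0" "B * \<delta> \<le> e / 2" using e B by (auto simp: \<delta>_def field_simps)
  obtain k g where g: "\<And>v. g v \<in> S" and k: "prob {x \<in> space M. X x \<noteq> g (prefix_word k x)} < \<delta>"
    using label_approx[OF prob_space_axioms sets finite_S X \<delta>(1)] by blast
  define r where "r c v = (if c = g v then 1 - \<epsilon> else \<epsilon> / N)" for c v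
  have r_pos: "r c v > 0" for c v using \<epsilon> N by (auto simp: r_def)
  have r_sum: "(\<Sum>c\<in>S. r c v) \<le> 1" for v
  proof -
    have "(\<Sum>c\<in>S. r c v) = (1 - \<epsilon>) + (\<Sum>c\<in>S - {g v}. r c v)"
      using g finite_S by (subst sum.remove[of _ "g v"]) (auto simp: r_def)
    also have "(\<Sum>c\<in>S - {g v}. r c v) = (\<Sum>c\<in>S - {g v}. \<epsilon> / N)" by (intro sum.cong) (auto simp: r_def)
    also have "\<dots> = real (card (S - {g v})) * (\<epsilon> / N)" by simp
    also have "\<dots> \<le> N * (\<epsilon> / N)"
      unfolding N_def using \<epsilon> finite_S by (intro mult_right_mono) (auto simp: card_mono)
    finally show ?thesis using N by simp
  qed
  have r_ln: "- ln (r c v) \<le> e / 2 + B * of_bool (c \<noteq> g v)" for c v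
    using \<epsilon> N B e by (auto simp: r_def B_def ln_div)
  have "block_entropy n \<le> word_entropy M (n + k) + real n * e" for n
  proof -
    \<comment> \<open>The guess at a time \<open>i < n\<close> reads the letters \<open>i\<close> to
      \<open>i + k - 1\<close>, so \<open>n + k\<close> letters are enough for all guesses.\<close>
    define F where "F = itineraries n \<times> (words (n + k) :: 'a list set)"
    define Y where "Y x = (itinerary n x, prefix_word (n + k) x)" for x
    define J where "J y = prob {x \<in> space M. Y x = y}" for y
    define p where "p w = prob (cylinder w)" for w :: "'a list"
    define R where "R = (\<lambda>(s, w). p w * (\<Prod>i<n. r (s ! i) (take k (drop i w))))"
    have F: "finite F" by (simp add: F_def)
    have Y[measurable]: "Y \<in> M \<rightarrow>\<^sub>M count_space F"
    proof -
      have "Y \<in> M \<rightarrow>\<^sub>M count_space (itineraries n) \<Otimes>\<^sub>M count_space (words (n + k))"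
        unfolding Y_def[abs_def] using prefix_word_measurable[OF sets] by measurable
      then show ?thesis by (simp add: F_def pair_measure_countable countable_finite)
    qed
    have J_nonneg: "J y \<ge> 0" for y by (simp add: J_def)
    have marg1: "prob {x \<in> space M. fst (Y x) = s} = itinerary_prob s" if "s \<in> itineraries n" for s
      using that by (simp add: Y_def itinerary_prob_def itineraries_def)
    have marg2: "prob {x \<in> space M. snd (Y x) = w} = p w" if "w \<in> words (n + k)" for w
      using that by (simp add: Y_def p_def cylinder_def words_def space)
    have J_le: "J y \<le> itinerary_prob (fst y)" "J y \<le> p (snd y)" if "y \<in> F" for y
    proof -
      have "J y \<le> prob {x \<in> space M. fst (Y x) = fst y}" "J y \<le> prob {x \<in> space M. snd (Y x) = snd y}"
        unfolding J_def by (auto intro!: finite_measure_mono Collect_value_in_sets[OF Y])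
      then show "J y \<le> itinerary_prob (fst y)" "J y \<le> p (snd y)"
        using that marg1 marg2 by (auto simp: F_def)
    qed
    have sum_J: "sum J F = 1"
      using prob_eq_sum_values[OF F Y, of "\<lambda>_. True"] by (simp add: J_def prob_space)
    have r_nonzero: "r c v \<noteq> 0" for c v using r_pos[of c v] by simp
    have prod_r: "(\<Prod>i<n. r (s ! i) (take k (drop i w))) > 0" for s and w :: "'a list"
      by (intro prod_pos ballI r_pos)
    have R_pos: "R y > 0" if "y \<in> F" "J y > 0" for y
    proof -
      have "p (snd y) > 0" using J_le(2)[OF that(1)] that(2) by linarith
      then show ?thesis unfolding R_def case_prod_unfold using prod_r by (rule mult_pos_pos)
    qed
    have R_nonneg: "R y \<ge> 0" for y
      unfolding R_def case_prod_unfold p_def by (intro mult_nonneg_nonneg less_imp_le[OF prod_r]) simp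
    have lists_prod: "(\<Sum>s\<in>itineraries n. \<Prod>i<n. r (s ! i) (v i)) = (\<Prod>i<n. \<Sum>c\<in>S. r c (v i))" for v
      using sum_lists_prod[OF finite_S, where f = "\<lambda>i c. r c (v i)" and n = n] by (simp add: itineraries_def)
    have sum_R: "sum R F \<le> 1"
    proof -
      have "sum R F = (\<Sum>w\<in>words (n + k). \<Sum>s\<in>itineraries n. R (s, w))"
        unfolding F_def by (subst sum.swap) (simp add: sum.cartesian_product)
      also have "\<dots> = (\<Sum>w\<in>words (n + k). p w * (\<Prod>i<n. \<Sum>c\<in>S. r c (take k (drop i w))))"
        unfolding R_def prod.case sum_distrib_left[symmetric] lists_prod ..
      also have "\<dots> \<le> (\<Sum>w\<in>words (n + k). p w * 1)"
        using r_sum sum_nonneg[OF less_imp_le[OF r_pos]]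
        by (intro sum_mono mult_left_mono prod_le_1) (auto simp: p_def)
      also have "\<dots> = (\<Sum>w\<in>{w \<in> words (n + k). True}. prob {x \<in> space M. prefix_word (n + k) x = w})"
        by (intro sum.cong) (auto simp: p_def cylinder_def words_def space)
      also have "\<dots> = prob {x \<in> space M. True}"
        by (rule prob_eq_sum_values[OF finite_words prefix_word_measurable[OF sets], symmetric])
      finally show ?thesis by (simp add: prob_space)
    qed
    have "(\<Sum>y\<in>F. J y * ln (itinerary_prob (fst y)))
        = (\<Sum>s\<in>itineraries n. prob {x \<in> space M. fst (Y x) = s} * ln (itinerary_prob s))"
      unfolding J_def by (rule sum_prob_image[OF F finite_itineraries Y]) (auto simp: F_def)
    then have "- block_entropy n = (\<Sum>y\<in>F. J y * ln (itinerary_prob (fst y)))"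
      by (simp add: block_entropy_def marg1)
    \<comment> \<open>A joint mass is at most its marginal, so the entropy of the pair dominates
      that of the itinerary.\<close>
    also have "\<dots> \<ge> (\<Sum>y\<in>F. J y * ln (J y))"
    proof (rule sum_mono)
      fix y assume y: "y \<in> F"
      show "J y * ln (J y) \<le> J y * ln (itinerary_prob (fst y))"
        using J_le(1)[OF y] J_nonneg[of y]
        by (cases "J y = 0") (auto intro!: mult_left_mono simp: less_le)
    qed
    finally have 1: "block_entropy n \<le> - (\<Sum>y\<in>F. J y * ln (J y))" by simp
    have 2: "- (\<Sum>y\<in>F. J y * ln (J y)) \<le> - (\<Sum>y\<in>F. J y * ln (R y))"
      using gibbs_inequality[of F J R] F J_nonneg R_nonneg R_pos sum_R sum_J by force
    \<comment> \<open>By invariance a wrong guess has the same probability at every time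
      \<open>i\<close>, namely the one made smaller than \<open>\<delta>\<close>.\<close>
    have guess: "(\<Sum>y\<in>F. J y * - ln (r (fst y ! i) (take k (drop i (snd y))))) \<le> e" if i: "i < n" for i
    proof -
      let ?Q = "\<lambda>y. fst y ! i \<noteq> g (take k (drop i (snd y)))"
      have "(\<Sum>y\<in>F. J y * - ln (r (fst y ! i) (take k (drop i (snd y)))))
          \<le> (\<Sum>y\<in>F. J y * (e / 2 + B * of_bool (?Q y)))"
        using r_ln J_nonneg by (intro sum_mono mult_left_mono) auto
      also have "\<dots> = e / 2 * sum J F + B * (\<Sum>y\<in>F. J y * of_bool (?Q y))"
        by (simp add: sum_distrib_left sum.distrib algebra_simps)
      also have "(\<Sum>y\<in>F. J y * of_bool (?Q y)) = (\<Sum>y\<in>{y \<in> F. ?Q y}. J y)"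
        using F by (simp add: sum.inter_filter of_bool_def if_distrib cong: if_cong)
      also have "\<dots> = prob {x \<in> space M. ?Q (Y x)}"
        unfolding J_def by (rule prob_eq_sum_values[OF F Y, symmetric])
      also have "{x \<in> space M. ?Q (Y x)} = {x \<in> space M. (left_shift ^^ i) x \<in> {x \<in> space M. X x \<noteq> g (prefix_word k x)}}"
      proof -
        have "fst (Y x) ! i = X ((left_shift ^^ i) x)"
          "take k (drop i (snd (Y x))) = prefix_word k ((left_shift ^^ i) x)" for x
          using i prefix_word_funpow_left_shift[of i k "n + k" x] by (simp_all add: Y_def itinerary_def)
        then show ?thesis by (simp add: space)
      qed
      also have "prob \<dots> = prob {x \<in> space M. X x \<noteq> g (prefix_word k x)}"
      proof (rule prob_vimage_funpow)
        have "{x \<in> space M. X x \<noteq> g (prefix_word k x)}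
            = space M - (\<Union>c\<in>S. {x \<in> space M. X x = c} \<inter> {x \<in> space M. g (prefix_word k x) = c})"
          using X_in_S g by auto
        moreover have "{x \<in> space M. X x = c} \<inter> {x \<in> space M. g (prefix_word k x) = c} \<in> events" for c
          by (intro sets.Int Collect_value_in_sets[OF X] Collect_value_in_sets[OF prefix_word_measurable[OF sets]])
        then have "space M - (\<Union>c\<in>S. {x \<in> space M. X x = c} \<inter> {x \<in> space M. g (prefix_word k x) = c}) \<in> events"
          using finite_S by (intro sets.Diff sets.finite_UN) auto
        ultimately show "{x \<in> space M. X x \<noteq> g (prefix_word k x)} \<in> events" by simp
      qed
      also have "e / 2 * sum J F + B * prob {x \<in> space M. X x \<noteq> g (prefix_word k x)} \<le> e / 2 + B * \<delta>"
        using k B by (simp add: sum_J mult_left_mono)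
      finally show ?thesis using \<delta>(2) by simp
    qed
    have "- (\<Sum>y\<in>F. J y * ln (R y)) = - (\<Sum>y\<in>F. J y * ln (p (snd y))) + (\<Sum>i<n. \<Sum>y\<in>F. J y * - ln (r (fst y ! i) (take k (drop i (snd y)))))"
    proof -
      have "J y * ln (R y) = J y * ln (p (snd y)) - (\<Sum>i<n. J y * - ln (r (fst y ! i) (take k (drop i (snd y)))))" if "y \<in> F" for y
      proof (cases "J y = 0")
        case False
        then have "p (snd y) > 0" using J_le(2)[OF that] J_nonneg[of y] by linarith
        then have "ln (R y) = ln (p (snd y)) + ln (\<Prod>i<n. r (fst y ! i) (take k (drop i (snd y))))"
          unfolding R_def case_prod_unfold by (intro ln_mult_pos prod_r)
        also have "ln (\<Prod>i<n. r (fst y ! i) (take k (drop i (snd y)))) = (\<Sum>i<n. ln (r (fst y ! i) (take k (drop i (snd y)))))"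
          by (intro ln_prod r_nonzero) simp
        finally show ?thesis by (simp add: sum_negf sum_distrib_left distrib_left)
      qed simp
      then have "(\<Sum>y\<in>F. J y * ln (R y)) = (\<Sum>y\<in>F. J y * ln (p (snd y))) - (\<Sum>y\<in>F. \<Sum>i<n. J y * - ln (r (fst y ! i) (take k (drop i (snd y)))))"
        by (simp add: sum_subtractf)
      also have "(\<Sum>y\<in>F. \<Sum>i<n. J y * - ln (r (fst y ! i) (take k (drop i (snd y)))))
          = (\<Sum>i<n. \<Sum>y\<in>F. J y * - ln (r (fst y ! i) (take k (drop i (snd y)))))"
        by (rule sum.swap)
      finally show ?thesis by simp
    qed
    also have "(\<Sum>y\<in>F. J y * ln (p (snd y))) = (\<Sum>w\<in>words (n + k). prob {x \<in> space M. snd (Y x) = w} * ln (p w))"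
      unfolding J_def by (rule sum_prob_image[OF F finite_words Y]) (auto simp: F_def)
    also have "\<dots> = - word_entropy M (n + k)" by (simp add: word_entropy_def marg2 p_def[symmetric])
    also have "(\<Sum>i<n. \<Sum>y\<in>F. J y * - ln (r (fst y ! i) (take k (drop i (snd y))))) \<le> (\<Sum>i<n. e)"
      by (intro sum_mono guess) auto
    finally show ?thesis using 1 2 by simp
  qed
  then show ?thesis by blast
qed

lemma partition_entropy_letters:
  fixes M :: "(nat \<Rightarrow> 'a::{finite,discrete_topology}) measure"
  assumes "space M = UNIV"
  shows "partition_entropy M (iterated_join M left_shift (range (\<lambda>c. cylinder [c])) n) = word_entropy M n"
proof -
  have "iterated_join M left_shift (range (\<lambda>c. cylinder [c])) n = cylinder ` (words n :: 'a list set)"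
  proof (intro equalityI subsetI)
    fix B assume "B \<in> iterated_join M left_shift (range (\<lambda>c. cylinder [c :: 'a])) n"
    then obtain A where A: "B = {x \<in> space M. \<forall>i<n. (left_shift ^^ i) x \<in> A i}" "\<forall>i<n. \<exists>c. A i = cylinder [c]"
      by (auto simp: iterated_join_def image_iff)
    then obtain c where c: "\<And>i. i < n \<Longrightarrow> A i = cylinder [c i]" by metis
    have "B = cylinder (map c [0..<n])"
      using c by (auto simp: A(1) assms mem_cylinder_iff_nth left_shift_funpow)
    then show "B \<in> cylinder ` words n" by (auto simp: words_def)
  next
    fix B assume "B \<in> cylinder ` (words n :: 'a list set)"
    then obtain w where w: "w \<in> words n" "B = cylinder w" by blast
    then have "B = {x \<in> space M. \<forall>i<n. (left_shift ^^ i) x \<in> cylinder [w ! i]}"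
      by (auto simp: assms mem_cylinder_iff_nth left_shift_funpow words_def)
    then show "B \<in> iterated_join M left_shift (range (\<lambda>c. cylinder [c])) n"
      unfolding iterated_join_def by (intro CollectI exI[of _ "\<lambda>i. cylinder [w ! i]"] conjI) auto
  qed
  moreover have "inj_on cylinder (words n :: 'a list set)"
  proof (rule inj_onI)
    fix v w :: "'a list" assume vw: "v \<in> words n" "w \<in> words n" "cylinder v = cylinder w"
    then have "prepend v undefined \<in> cylinder w" using prepend_in_cylinder[of v] by simp
    then have "prefix_word n (prepend v undefined) = w" using vw(2) by (simp add: mem_cylinder_iff)
    then show "v = w" using vw(1) prefix_word_prepend[of v undefined] by (simp add: words_def)
  qed
  ultimately show ?thesis
    by (simp add: partition_entropy_def word_entropy_def sum.reindex)
qed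

text \<open>The supremum is attained at the partition into letters. For any other partition the
  previous estimate costs \<open>k\<close> extra letters, which are negligible after division by
  \<open>n\<close>, and an arbitrarily small \<open>e\<close> per step.\<close>

lemma ks_entropy_left_shift:
  fixes M :: "(nat \<Rightarrow> 'a::{finite,discrete_topology}) measure"
  assumes inv: "M \<in> invariant_measures left_shift"
  shows "\<exists>h. (\<lambda>n. word_entropy M n / real n) \<longlonglongrightarrow> h \<and> ks_entropy M left_shift = ereal h"
proof -
  note sets = invariant_measures_sets[OF inv] and space = invariant_measures_space[OF inv]
  have inv': "prob_space M" "left_shift \<in> M \<rightarrow>\<^sub>M M" "distr M M left_shift = M"
    using inv by (auto simp: invariant_measures_def)
  obtain h where h: "(\<lambda>n. word_entropy M n / real n) \<longlonglongrightarrow> h"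
    using stationary_process.block_entropy_limit[OF stationary_process_letters[OF inv]]
    unfolding block_entropy_letters[OF inv] by blast
  have "ks_entropy M left_shift \<le> ereal h"
    unfolding ks_entropy_def
  proof (rule SUP_least)
    fix \<P> assume P: "\<P> \<in> finite_measurable_partitions M"
    define X where "X x = (THE A. A \<in> \<P> \<and> x \<in> A)" for x
    note proc = stationary_process_partition(1)[OF inv' P, folded X_def]
    obtain h' where h': "(\<lambda>n. stationary_process.block_entropy M left_shift X \<P> n / real n) \<longlonglongrightarrow> h'"
      using stationary_process.block_entropy_limit[OF proc] by blast
    have "h' \<le> h + e" if e: "e > 0" for e
    proof -
      obtain k where k: "\<And>n. stationary_process.block_entropy M left_shift X \<P> n \<le> word_entropy M (n + k) + real n * e"
        using block_entropy_le_word_entropy[OF inv proc e] by blast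
      have 1: "(\<lambda>n. word_entropy M (n + k) / real (n + k)) \<longlonglongrightarrow> h"
        using h by (rule LIMSEQ_ignore_initial_segment)
      have 2: "(\<lambda>n. 1 + real k / real n) \<longlonglongrightarrow> 1 + 0"
        by (intro tendsto_add tendsto_const lim_const_over_n)
      have "(\<lambda>n. word_entropy M (n + k) / real (n + k) * (1 + real k / real n) + e) \<longlonglongrightarrow> h * (1 + 0) + e"
        by (rule tendsto_add[OF tendsto_mult[OF 1 2] tendsto_const])
      moreover have "stationary_process.block_entropy M left_shift X \<P> n / real n
          \<le> word_entropy M (n + k) / real (n + k) * (1 + real k / real n) + e" if "n \<ge> 1" for n
      proof -
        define c where "c = real (n + k)"
        have c: "1 + real k / real n = c / real n" "c \<noteq> 0" using that by (auto simp: c_def field_simps)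
        then have "word_entropy M (n + k) / c * (1 + real k / real n) = word_entropy M (n + k) / real n" by simp
        moreover have "stationary_process.block_entropy M left_shift X \<P> n / real n \<le> word_entropy M (n + k) / real n + e"
          using k[of n] that by (simp add: field_simps)
        ultimately show ?thesis unfolding c_def by simp
      qed
      ultimately show ?thesis using LIMSEQ_le[OF h'] by fastforce
    qed
    then have "h' \<le> h" by (rule field_le_epsilon)
    moreover have "lim (\<lambda>n. partition_entropy M (iterated_join M left_shift \<P> n) / real n) = h'"
      unfolding stationary_process_partition(2)[OF inv' P, folded X_def] using h' by (rule limI)
    ultimately show "ereal (lim (\<lambda>n. partition_entropy M (iterated_join M left_shift \<P> n) / real n)) \<le> ereal h"
      by simp
  qed
  moreover have "ereal h \<le> ks_entropy M left_shift"
  proof -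
    have "range (\<lambda>c. cylinder [c]) \<in> finite_measurable_partitions M"
    proof -
      have "cylinder [c] \<noteq> {}" for c :: 'a using prepend_in_cylinder by fastforce
      moreover have "x \<in> cylinder [x 0]" for x :: "nat \<Rightarrow> 'a" by (simp add: mem_cylinder_iff_nth)
      ultimately show ?thesis
        by (auto simp: finite_measurable_partitions_def partition_on_def sets space disjoint_def mem_cylinder_iff_nth)
    qed
    then have "ereal (lim (\<lambda>n. partition_entropy M (iterated_join M left_shift (range (\<lambda>c. cylinder [c])) n) / real n))
        \<le> ks_entropy M left_shift"
      unfolding ks_entropy_def by (rule SUP_upper)
    then show ?thesis unfolding partition_entropy_letters[OF space] limI[OF h] .
  qed
  ultimately show ?thesis using h antisym by blast
qed

section \<open>Quasi-Bernoulli weights and their Gibbs measures\<close>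

lemma left_shift_measurable:
  "left_shift \<in> borel \<rightarrow>\<^sub>M (borel :: (nat \<Rightarrow> 'a::{finite,discrete_topology}) measure)"
proof (rule borel_measurable_continuous_onI)
  show "continuous_on UNIV (left_shift :: (nat \<Rightarrow> 'a) \<Rightarrow> _)"
    unfolding left_shift_def by (intro continuous_on_coordinatewise_then_product) simp
qed

lemma left_shift_funpow_measurable:
  "left_shift ^^ n \<in> borel \<rightarrow>\<^sub>M (borel :: (nat \<Rightarrow> 'a::{finite,discrete_topology}) measure)"
  by (induction n) (auto intro: measurable_compose[OF _ left_shift_measurable])

lemma mem_cylinder_Cons_iff: "x \<in> cylinder (c # w) \<longleftrightarrow> x 0 = c \<and> left_shift x \<in> cylinder w"
  using mem_cylinder_append_iff[of x "[c]" w] by (simp add: mem_cylinder_iff_nth left_shift_funpow left_shift_def)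

lemma sum_measure_cylinder_Cons:
  fixes M :: "(nat \<Rightarrow> 'a::{finite,discrete_topology}) measure"
  assumes "finite_measure M" "sets M = sets borel"
  shows "(\<Sum>c\<in>UNIV. measure M (cylinder (c # w))) = measure M (left_shift -` cylinder w)"
proof -
  interpret finite_measure M by fact
  have "measure M (\<Union>c\<in>UNIV. cylinder (c # w)) = (\<Sum>c\<in>UNIV. measure M (cylinder (c # w)))"
  proof (rule finite_measure_finite_Union)
    show "(\<lambda>c. cylinder (c # w)) ` UNIV \<subseteq> sets M" by (simp add: assms(2) image_subset_iff)
    show "disjoint_family_on (\<lambda>c. cylinder (c # w)) UNIV"
      unfolding disjoint_family_on_def by (simp add: set_eq_iff mem_cylinder_Cons_iff)
  qed simp
  moreover have "(\<Union>c\<in>UNIV. cylinder (c # w)) = left_shift -` cylinder w"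
    by (auto simp: mem_cylinder_Cons_iff)
  ultimately show ?thesis by simp
qed

text \<open>The preimage of a cylinder is the disjoint union of its extensions by one letter on the
  left, and cylinders determine a measure. In this form invariance is a finite linear condition for
  each word, which passes to weak limits.\<close>

lemma invariant_measures_left_shift_iff:
  fixes M :: "(nat \<Rightarrow> 'a::{finite,discrete_topology}) measure"
  shows "M \<in> invariant_measures left_shift \<longleftrightarrow> prob_space M \<and> sets M = sets borel \<and>
    (\<forall>w. (\<Sum>c\<in>UNIV. measure M (cylinder (c # w))) = measure M (cylinder w))"
proof (cases "prob_space M \<and> sets M = sets borel")
  case True
  then interpret prob_space M by blast
  have sets: "sets M = sets borel" and space: "space M = UNIV"
    using True sets_eq_imp_space_eq[of M borel] by auto
  have T: "left_shift \<in> M \<rightarrow>\<^sub>M M"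
    using left_shift_measurable measurable_cong_sets[OF sets sets] by blast
  interpret D: prob_space "distr M M left_shift" using T by (rule prob_space_distr)
  have eq: "measure (distr M M left_shift) (cylinder w) = measure M (left_shift -` cylinder w)" for w
    using measure_distr[OF T, of "cylinder w"] by (simp add: sets space)
  have "distr M M left_shift = M \<longleftrightarrow> (\<forall>w. measure (distr M M left_shift) (cylinder w) = measure M (cylinder w))"
    using measure_eqI_cylinder[OF D.finite_measure_axioms finite_measure_axioms] sets by auto
  then show ?thesis
    using True T by (simp add: invariant_measures_def eq sum_measure_cylinder_Cons[OF finite_measure_axioms sets])
qed (auto simp: invariant_measures_def)

lemma invariant_measures_weak_limit:
  fixes M :: "nat \<Rightarrow> (nat \<Rightarrow> 'a::{finite,discrete_topology}) measure"
  assumes "\<And>k. M k \<in> invariant_measures left_shift" "prob_space N" "sets N = sets borel"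
    and lim: "\<And>w. (\<lambda>k. measure (M k) (cylinder w)) \<longlonglongrightarrow> measure N (cylinder w)"
  shows "N \<in> invariant_measures left_shift"
proof -
  have "(\<Sum>c\<in>UNIV. measure N (cylinder (c # w))) = measure N (cylinder w)" for w
  proof -
    have "(\<lambda>k. \<Sum>c\<in>UNIV. measure (M k) (cylinder (c # w))) \<longlonglongrightarrow> (\<Sum>c\<in>UNIV. measure N (cylinder (c # w)))"
      by (intro tendsto_sum lim)
    then have "(\<lambda>k. measure (M k) (cylinder w)) \<longlonglongrightarrow> (\<Sum>c\<in>UNIV. measure N (cylinder (c # w)))"
      using assms(1) by (simp add: invariant_measures_left_shift_iff)
    then show ?thesis using lim LIMSEQ_unique by blast
  qed
  then show ?thesis using assms by (simp add: invariant_measures_left_shift_iff)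
qed

text \<open>Each atom lies in exactly one of the extensions of a cylinder by one letter, so the word
  function is consistent; the cylinder masses come with the construction.\<close>

lemma atomic_measure_exists:
  fixes a :: "'i \<Rightarrow> real" and x :: "'i \<Rightarrow> nat \<Rightarrow> 'a::{finite,discrete_topology}"
  assumes "finite I" "\<And>i. i \<in> I \<Longrightarrow> a i \<ge> 0" "sum a I = 1"
  shows "\<exists>M. prob_space M \<and> sets M = sets borel \<and>
    (\<forall>w. measure M (cylinder w) = (\<Sum>i\<in>I. a i * of_bool (x i \<in> cylinder w)))"
proof (rule measure_of_word_function)
  show "(\<Sum>c\<in>UNIV. \<Sum>i\<in>I. a i * of_bool (x i \<in> cylinder (w @ [c]))) = (\<Sum>i\<in>I. a i * of_bool (x i \<in> cylinder w))" for w
  proof (subst sum.swap, intro sum.cong refl)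
    fix i
    have "(\<Sum>c\<in>UNIV. a i * of_bool (x i \<in> cylinder (w @ [c])))
        = (\<Sum>c\<in>UNIV. if x i (length w) = c then a i * of_bool (x i \<in> cylinder w) else 0)"
      by (intro sum.cong) (auto simp: mem_cylinder_snoc_iff)
    then show "(\<Sum>c\<in>UNIV. a i * of_bool (x i \<in> cylinder (w @ [c]))) = a i * of_bool (x i \<in> cylinder w)"
      by simp
  qed
qed (use assms in \<open>auto intro!: sum_nonneg\<close>)

lemma sum_mult_product:
  fixes f g :: "_ \<Rightarrow> real"
  shows "(\<Sum>v\<in>A. \<Sum>u\<in>B. c * (f v * g u)) = c * (sum f A * sum g B)"
  by (simp only: sum_product[of f A g B] sum_distrib_left[of c])

lemma sum_Times_divide:
  fixes g :: "'i \<Rightarrow> 'j \<Rightarrow> real"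
  shows "(\<Sum>i\<in>A \<times> B. g (fst i) (snd i) / c) = (\<Sum>i\<in>A. \<Sum>j\<in>B. g i j) / c"
  by (simp add: sum.cartesian_product case_prod_unfold sum_divide_distrib)

text \<open>\<open>\<theta>\<close> is a probability on the words of each length, but different
  lengths need not be consistent, so it does not itself define a measure on the shift space.\<close>

locale quasi_bernoulli =
  fixes \<theta> :: "'a::{finite,discrete_topology} list \<Rightarrow> real" and K :: real
  assumes pos: "\<theta> w > 0" and sum_words: "(\<Sum>w\<in>words n. \<theta> w) = 1" and K: "K > 0"
    and append_le: "\<theta> (v @ w) \<le> K * \<theta> v * \<theta> w"
    and append_ge: "\<theta> v * \<theta> w \<le> K * \<theta> (v @ w)"
begin

text \<open>One factor \<open>K\<close> splits off the left context and one the right; each context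
  has total mass 1. The constant depends neither on the position of \<open>w\<close> nor on the
  length of the context.\<close>

lemma sum_context_bounds:
  "(\<Sum>v\<in>words j. \<Sum>u\<in>words l. \<theta> (v @ w @ u)) \<le> K\<^sup>2 * \<theta> w"
  "\<theta> w \<le> K\<^sup>2 * (\<Sum>v\<in>words j. \<Sum>u\<in>words l. \<theta> (v @ w @ u))"
proof -
  have "(\<Sum>v\<in>words j. \<Sum>u\<in>words l. \<theta> (v @ w @ u)) \<le> (\<Sum>v\<in>words j. \<Sum>u\<in>words l. K * \<theta> v * (K * \<theta> w * \<theta> u))"
  proof (intro sum_mono)
    fix v u
    have "\<theta> (v @ w @ u) \<le> K * \<theta> v * \<theta> (w @ u)" by (rule append_le)
    also have "\<dots> \<le> K * \<theta> v * (K * \<theta> w * \<theta> u)"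
      using K pos[of v] by (intro mult_left_mono append_le) simp
    finally show "\<theta> (v @ w @ u) \<le> K * \<theta> v * (K * \<theta> w * \<theta> u)" .
  qed
  also have "\<dots> = K\<^sup>2 * \<theta> w * ((\<Sum>v\<in>words j. \<theta> v) * (\<Sum>u\<in>words l. \<theta> u))"
    unfolding sum_mult_product[symmetric] by (simp add: power2_eq_square mult_ac)
  finally show "(\<Sum>v\<in>words j. \<Sum>u\<in>words l. \<theta> (v @ w @ u)) \<le> K\<^sup>2 * \<theta> w" by (simp add: sum_words)
  have "\<theta> w = \<theta> w * ((\<Sum>v\<in>words j. \<theta> v) * (\<Sum>u\<in>words l. \<theta> u))" by (simp add: sum_words)
  also have "\<dots> = (\<Sum>v\<in>words j. \<Sum>u\<in>words l. \<theta> v * (\<theta> w * \<theta> u))"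
    unfolding sum_mult_product[symmetric] by (simp add: mult_ac)
  also have "\<dots> \<le> (\<Sum>v\<in>words j. \<Sum>u\<in>words l. K\<^sup>2 * \<theta> (v @ w @ u))"
  proof (intro sum_mono)
    fix v u
    have "\<theta> v * (\<theta> w * \<theta> u) \<le> \<theta> v * (K * \<theta> (w @ u))"
      using pos[of v] by (intro mult_left_mono append_ge) simp
    also have "\<dots> = K * (\<theta> v * \<theta> (w @ u))" by simp
    also have "\<dots> \<le> K * (K * \<theta> (v @ w @ u))"
      using K by (intro mult_left_mono append_ge) simp
    finally show "\<theta> v * (\<theta> w * \<theta> u) \<le> K\<^sup>2 * \<theta> (v @ w @ u)" by (simp add: power2_eq_square)
  qed
  finally show "\<theta> w \<le> K\<^sup>2 * (\<Sum>v\<in>words j. \<Sum>u\<in>words l. \<theta> (v @ w @ u))"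
    by (simp add: sum_distrib_left)
qed

text \<open>
  A weak limit of the averages over \<open>j < N\<close> of the \<open>j\<close>-th shift images of the atomic measures given by \<open>\<theta>\<close> on
  the words of length \<open>2 N\<close>.
\<close>

lemma invariant_measure_exists:
  "\<exists>m\<in>invariant_measures left_shift. \<forall>w. measure m (cylinder w) \<le> K\<^sup>2 * \<theta> w \<and> \<theta> w \<le> K\<^sup>2 * measure m (cylinder w)"
proof -
  define x where "x v = prepend v (undefined :: nat \<Rightarrow> 'a)" for v
  define A where "A N j w = (\<Sum>v\<in>words (2 * N). \<theta> v * of_bool ((left_shift ^^ j) (x v) \<in> cylinder w))" for N j w
  have A_01: "A N j w \<ge> 0" "A N j w \<le> 1" for N j w
  proof -
    show "A N j w \<ge> 0" unfolding A_def using pos by (intro sum_nonneg) (simp add: less_imp_le)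
    have "A N j w \<le> (\<Sum>v\<in>words (2 * N). \<theta> v * 1)"
      unfolding A_def using pos by (intro sum_mono mult_left_mono) (auto simp: less_imp_le)
    then show "A N j w \<le> 1" by (simp add: sum_words)
  qed
  \<comment> \<open>For these \<open>j\<close> and \<open>w\<close> the window lies inside the
    \<open>2 * N\<close> prescribed letters, so the arbitrary tail of \<open>x v\<close> is never
    read.\<close>
  have A_bounds: "A N j w \<le> K\<^sup>2 * \<theta> w" "\<theta> w \<le> K\<^sup>2 * A N j w" if j: "j < N" and w: "length w \<le> N" for N j w
  proof -
    obtain l where l: "2 * N = j + (length w + l)" using j w le_Suc_ex[of "j + length w" "2 * N"] by auto
    have length_w: "w \<in> words (length w)" by (simp add: words_def)
    have "A N j w = (\<Sum>v\<in>words (j + (length w + l)). \<theta> v * of_bool (take (length w) (drop j v) = w))"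
      unfolding A_def l[symmetric]
    proof (intro sum.cong refl arg_cong2[where f = "(*)"] arg_cong[where f = of_bool])
      fix v :: "'a list" assume "v \<in> words (2 * N)"
      then have "prefix_word (2 * N) (x v) = v" using prefix_word_prepend[of v undefined] by (simp add: words_def x_def)
      then show "((left_shift ^^ j) (x v) \<in> cylinder w) = (take (length w) (drop j v) = w)"
        using prefix_word_funpow_left_shift[of j "length w" "2 * N" "x v"] l by (simp add: cylinder_def)
    qed
    also have "\<dots> = (\<Sum>v\<in>words j. \<Sum>u\<in>words (length w). \<Sum>t\<in>words l. \<theta> (v @ u @ t) * of_bool (u = w))"
      unfolding sum_words_add by (intro sum.cong refl) (auto simp: words_def)
    also have "\<dots> = (\<Sum>v\<in>words j. \<Sum>u\<in>words (length w). if u = w then \<Sum>t\<in>words l. \<theta> (v @ u @ t) else 0)"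
      by (intro sum.cong refl) auto
    also have "\<dots> = (\<Sum>v\<in>words j. \<Sum>t\<in>words l. \<theta> (v @ w @ t))"
      using length_w by simp
    finally show "A N j w \<le> K\<^sup>2 * \<theta> w" "\<theta> w \<le> K\<^sup>2 * A N j w" using sum_context_bounds by auto
  qed
  have A_shift: "(\<Sum>c\<in>UNIV. A N j (c # w)) = A N (Suc j) w" for N j w
  proof -
    have "(\<Sum>c\<in>UNIV. A N j (c # w)) = (\<Sum>v\<in>words (2 * N). \<Sum>c\<in>UNIV. \<theta> v * of_bool ((left_shift ^^ j) (x v) \<in> cylinder (c # w)))"
      unfolding A_def by (rule sum.swap)
    also have "\<dots> = (\<Sum>v\<in>words (2 * N). \<Sum>c\<in>UNIV. if (left_shift ^^ j) (x v) 0 = c then \<theta> v * of_bool ((left_shift ^^ Suc j) (x v) \<in> cylinder w) else 0)"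
      by (intro sum.cong refl) (simp add: mem_cylinder_Cons_iff)
    finally show ?thesis by (simp add: A_def)
  qed
  \<comment> \<open>Averaging over \<open>Suc N\<close> shifts keeps the average nonempty for every
    \<open>N\<close>.\<close>
  define u where "u N w = (\<Sum>j<Suc N. A (Suc N) j w) / real (Suc N)" for N w
  have "\<exists>M. prob_space M \<and> sets M = sets borel \<and> (\<forall>w. measure M (cylinder w) = u N w)" for N
  proof -
    let ?I = "{..<Suc N} \<times> words (2 * Suc N)"
    have "(\<Sum>i\<in>?I. \<theta> (snd i) / real (Suc N)) = (\<Sum>j<Suc N. \<Sum>v\<in>words (2 * Suc N). \<theta> v) / real (Suc N)"
      by (rule sum_Times_divide)
    also have "\<dots> = 1" unfolding sum_words by simp
    finally have one: "(\<Sum>i\<in>?I. \<theta> (snd i) / real (Suc N)) = 1" .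
    have "(\<Sum>i\<in>?I. \<theta> (snd i) / real (Suc N) * of_bool ((left_shift ^^ fst i) (x (snd i)) \<in> cylinder w)) = u N w" for w
      unfolding u_def A_def times_divide_eq_left by (rule sum_Times_divide)
    then show ?thesis
      using atomic_measure_exists[of ?I "\<lambda>i. \<theta> (snd i) / real (Suc N)" "\<lambda>i. (left_shift ^^ fst i) (x (snd i))"] one pos
      by (simp add: less_imp_le)
  qed
  then obtain L where L: "\<And>N. prob_space (L N)" "\<And>N. sets (L N) = sets borel" "\<And>N w. measure (L N) (cylinder w) = u N w"
    by metis
  obtain m r where m: "prob_space m" "sets m = sets borel" "strict_mono (r :: nat \<Rightarrow> nat)"
      "\<And>w. (\<lambda>k. u (r k) w) \<longlonglongrightarrow> measure m (cylinder w)"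
    using prob_space_shift_weak_compact[of L] L by auto
  have u_bounds: "u N w \<le> K\<^sup>2 * \<theta> w" "\<theta> w \<le> K\<^sup>2 * u N w" if "length w \<le> N" for N w
  proof -
    have "(\<Sum>j<Suc N. A (Suc N) j w) \<le> (\<Sum>j<Suc N. K\<^sup>2 * \<theta> w)"
      using that by (intro sum_mono A_bounds) auto
    then show "u N w \<le> K\<^sup>2 * \<theta> w" by (simp add: u_def field_simps del: sum.lessThan_Suc)
    have "(\<Sum>j<Suc N. \<theta> w) \<le> (\<Sum>j<Suc N. K\<^sup>2 * A (Suc N) j w)"
      using that by (intro sum_mono A_bounds) auto
    then show "\<theta> w \<le> K\<^sup>2 * u N w" by (simp add: u_def field_simps sum_distrib_left del: sum.lessThan_Suc)
  qed
  have r_ge: "r k \<ge> k" for k using m(3) by (rule strict_mono_imp_increasing)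
  have ev: "\<forall>\<^sub>F k in sequentially. length w \<le> r k" for w :: "'a list"
    unfolding eventually_sequentially using r_ge order_trans by blast
  have "measure m (cylinder w) \<le> K\<^sup>2 * \<theta> w" for w
    by (rule tendsto_upperbound[OF m(4)]) (use ev[of w] in \<open>auto elim!: eventually_mono intro: u_bounds\<close>)
  moreover have "\<theta> w \<le> K\<^sup>2 * measure m (cylinder w)" for w
    by (rule tendsto_lowerbound[OF tendsto_mult[OF tendsto_const m(4)]])
      (use ev[of w] in \<open>auto elim!: eventually_mono intro: u_bounds\<close>)
  moreover have "(\<Sum>c\<in>UNIV. measure m (cylinder (c # w))) = measure m (cylinder w)" for w
  proof -
    \<comment> \<open>Shifting the average moves the summation index by one, so all but two end
      terms cancel, each of them between 0 and 1.\<close>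
    have bound: "\<bar>(\<Sum>c\<in>UNIV. u N (c # w)) - u N w\<bar> \<le> 1 / real (Suc N)" for N
    proof -
      have "(\<Sum>c\<in>UNIV. u N (c # w)) = (\<Sum>j<Suc N. \<Sum>c\<in>UNIV. A (Suc N) j (c # w)) / real (Suc N)"
        unfolding u_def sum_divide_distrib[symmetric] by (subst sum.swap) (rule refl)
      then have "(\<Sum>c\<in>UNIV. u N (c # w)) - u N w = (\<Sum>j<Suc N. A (Suc N) (Suc j) w - A (Suc N) j w) / real (Suc N)"
        by (simp add: A_shift u_def diff_divide_distrib sum_subtractf del: sum.lessThan_Suc)
      also have "(\<Sum>j<Suc N. A (Suc N) (Suc j) w - A (Suc N) j w) = A (Suc N) (Suc N) w - A (Suc N) 0 w"
        by (rule sum_lessThan_telescope)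
      finally show ?thesis
        using A_01[of "Suc N" "Suc N" w] A_01[of "Suc N" 0 w] by (simp add: divide_right_mono abs_le_iff del: of_nat_Suc)
    qed
    have "(\<lambda>k. (\<Sum>c\<in>UNIV. u (r k) (c # w)) - u (r k) w) \<longlonglongrightarrow> 0"
    proof (rule Lim_null_comparison)
      show "\<forall>\<^sub>F k in sequentially. norm ((\<Sum>c\<in>UNIV. u (r k) (c # w)) - u (r k) w) \<le> 1 / real (Suc (r k))"
        using bound by simp
      have "(\<lambda>n. 1 / real (Suc n)) \<longlonglongrightarrow> 0" using lim_const_over_n[of 1] LIMSEQ_Suc by blast
      from LIMSEQ_subseq_LIMSEQ[OF this m(3)] show "(\<lambda>k. 1 / real (Suc (r k))) \<longlonglongrightarrow> 0" by (simp add: o_def)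
    qed
    moreover have "(\<lambda>k. (\<Sum>c\<in>UNIV. u (r k) (c # w)) - u (r k) w) \<longlonglongrightarrow> (\<Sum>c\<in>UNIV. measure m (cylinder (c # w))) - measure m (cylinder w)"
      by (intro tendsto_diff tendsto_sum m(4))
    ultimately show ?thesis using LIMSEQ_unique by fastforce
  qed
  ultimately show ?thesis
    using m(1,2) by (intro bexI[of _ m]) (simp_all add: invariant_measures_left_shift_iff)
qed

end

section \<open>Ergodicity and uniqueness of the Gibbs measure\<close>

lemma prob_space_eqI_le:
  assumes "prob_space M" "prob_space N" "sets M = sets N" "space M = space N"
    and le: "\<And>A. A \<in> sets N \<Longrightarrow> measure M A \<le> measure N A"
  shows "M = N"
proof (rule measure_eqI)
  interpret M: prob_space M by fact
  interpret N: prob_space N by fact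
  fix A assume A: "A \<in> sets M"
  then have "measure M (space M - A) \<le> measure N (space N - A)"
    using le[of "space N - A"] assms(3,4) by simp
  then have "measure N A \<le> measure M A"
    using M.prob_compl[of A] N.prob_compl[of A] A assms(3) by simp
  then show "emeasure M A = emeasure N A"
    using le[of A] A assms(3) by (simp add: M.emeasure_eq_measure N.emeasure_eq_measure)
qed (rule assms(3))

text \<open>
  The bound \<open>dv\<close> in the proof is the Donsker--Varadhan inequality for the function \<open>t * indicator U\<close>: it
  forces \<open>\<mu>\<close> to be small on clopen sets of small \<open>m\<close>-measure.
\<close>

lemma null_sets_if_entropy_bounded:
  fixes \<mu> m :: "(nat \<Rightarrow> 'a::{finite,discrete_topology}) measure"
  assumes "prob_space \<mu>" "sets \<mu> = sets borel" "prob_space m" "sets m = sets borel"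
    and \<theta>: "\<And>w. \<theta> w > 0" "\<And>n. sum \<theta> (words n) = 1" "\<And>w. \<theta> w \<le> C' * measure m (cylinder w)"
    and D: "\<And>n. (\<Sum>w\<in>words n. measure \<mu> (cylinder w) * ln (measure \<mu> (cylinder w)))
        - (\<Sum>w\<in>words n. measure \<mu> (cylinder w) * ln (\<theta> w)) \<le> C"
    and B: "B \<in> sets borel" "measure m B = 0"
  shows "measure \<mu> B = 0"
proof -
  interpret \<mu>: prob_space \<mu> by fact
  interpret m: prob_space m by fact
  note sets = \<open>sets \<mu> = sets borel\<close> \<open>sets m = sets borel\<close>
  note [measurable_cong, simp] = sets
  note [measurable] = B(1)
  have C': "C' > 0"
  proof -
    have "0 < \<theta> []" "\<theta> [] \<le> C' * measure m (cylinder [])" using \<theta>(1) \<theta>(3) by blast+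
    then have "0 < C' * measure m (cylinder [])" by linarith
    then show ?thesis by (simp add: zero_less_mult_iff)
  qed
  have dv: "t * measure \<mu> (cylinder_set n W) \<le> C + C' * measure m (cylinder_set n W) * exp t" if t: "t > 0" for t n W
  proof -
    let ?p = "\<lambda>w. measure \<mu> (cylinder w)"
    define r where "r w = \<theta> w * exp (t * of_bool (w \<in> W))" for w
    have "(\<Sum>w\<in>words n. ?p w * ln (r w)) - (\<Sum>w\<in>words n. ?p w * ln (?p w)) \<le> sum r (words n) - sum ?p (words n)"
      by (rule gibbs_inequality) (use \<theta>(1) in \<open>auto simp: r_def less_imp_le\<close>)
    moreover have "sum ?p (words n) = 1"
    proof -
      have "cylinder_set n UNIV = (UNIV :: (nat \<Rightarrow> 'a) set)" by (simp add: cylinder_set_def)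
      then show ?thesis
        using measure_cylinder_set[OF \<mu>.finite_measure_axioms sets(1), of UNIV n UNIV] \<mu>.prob_space
          sets_eq_imp_space_eq[OF sets(1)] by simp
    qed
    moreover have "(\<Sum>w\<in>words n. ?p w * ln (r w)) = (\<Sum>w\<in>words n. ?p w * ln (\<theta> w)) + t * measure \<mu> (cylinder_set n W)"
    proof -
      have "?p w * ln (r w) = ?p w * ln (\<theta> w) + (if w \<in> W then t * ?p w else 0)" for w
        using \<theta>(1)[of w] by (simp add: r_def ln_mult_pos algebra_simps)
      moreover have "(\<Sum>w\<in>words n. if w \<in> W then t * ?p w else 0) = t * measure \<mu> (cylinder_set n W)"
        using measure_cylinder_set[OF \<mu>.finite_measure_axioms sets(1), of UNIV n W]
        by (simp add: sum.If_cases sum_distrib_left Int_commute)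
      ultimately show ?thesis by (simp add: sum.distrib)
    qed
    moreover have "sum r (words n) \<le> 1 + C' * measure m (cylinder_set n W) * exp t"
    proof -
      have "r w \<le> \<theta> w + (if w \<in> W then C' * measure m (cylinder w) * exp t else 0)" for w
        using \<theta>(1)[of w] mult_right_mono[OF \<theta>(3)[of w], of "exp t"] by (simp add: r_def add_increasing)
      then have "sum r (words n) \<le> (\<Sum>w\<in>words n. \<theta> w + (if w \<in> W then C' * measure m (cylinder w) * exp t else 0))"
        by (intro sum_mono)
      also have "\<dots> = 1 + (\<Sum>w\<in>W \<inter> words n. C' * measure m (cylinder w) * exp t)"
        by (simp add: sum.distrib \<theta>(2) sum.If_cases Int_commute)
      also have "(\<Sum>w\<in>W \<inter> words n. C' * measure m (cylinder w) * exp t) = C' * measure m (cylinder_set n W) * exp t"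
        using measure_cylinder_set[OF m.finite_measure_axioms sets(2), of UNIV n W]
        by (simp add: sum_distrib_left sum_distrib_right)
      finally show ?thesis .
    qed
    ultimately show ?thesis using D[of n] by linarith
  qed
  have main: "t * measure \<mu> B \<le> C + 1" if t: "t > 0" for t
  proof -
    \<comment> \<open>The approximation error enters as \<open>t * \<epsilon>\<close> through
      \<open>\<mu>\<close> and as \<open>C' * \<epsilon> * exp t\<close> through \<open>m\<close>;
      this choice makes the two add up to 1.\<close>
    define \<epsilon> where "\<epsilon> = 1 / (t + C' * exp t)"
    have den: "t + C' * exp t > 0" using t C' by (simp add: add_pos_pos)
    then have \<epsilon>: "\<epsilon> > 0" by (simp add: \<epsilon>_def)
    obtain n W where nW: "measure \<mu> ((B - cylinder_set n W) \<union> (cylinder_set n W - B)) < \<epsilon>"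
        "measure m ((B - cylinder_set n W) \<union> (cylinder_set n W - B)) < \<epsilon>"
      using cylinder_set_approx[OF \<mu>.finite_measure_axioms m.finite_measure_axioms sets B(1)] \<epsilon> by blast
    let ?U = "cylinder_set n W"
    let ?D = "(B - ?U) \<union> (?U - B)"
    have "measure \<mu> B \<le> measure \<mu> (?U \<union> ?D)" by (rule \<mu>.finite_measure_mono) auto
    also have "\<dots> \<le> measure \<mu> ?U + measure \<mu> ?D" by (rule measure_Un_le) auto
    finally have 1: "measure \<mu> B \<le> measure \<mu> ?U + \<epsilon>" using nW by linarith
    have "measure m ?U \<le> measure m (B \<union> ?D)" by (rule m.finite_measure_mono) auto
    also have "\<dots> \<le> measure m B + measure m ?D" by (rule measure_Un_le) auto
    finally have 2: "measure m ?U \<le> \<epsilon>" using nW B by linarith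
    have "t * measure \<mu> B \<le> t * measure \<mu> ?U + t * \<epsilon>"
      using mult_left_mono[OF 1, of t] t by (simp add: algebra_simps)
    also have "t * measure \<mu> ?U \<le> C + C' * measure m ?U * exp t" by (rule dv[OF t])
    also have "C' * measure m ?U * exp t \<le> C' * \<epsilon> * exp t"
      using 2 C' by (intro mult_right_mono mult_left_mono) auto
    also have "C + C' * \<epsilon> * exp t + t * \<epsilon> = C + (t + C' * exp t) * \<epsilon>" by (simp add: algebra_simps)
    also have "\<dots> = C + 1" using den by (simp add: \<epsilon>_def)
    finally show ?thesis by simp
  qed
  show ?thesis
  proof (rule ccontr)
    assume "measure \<mu> B \<noteq> 0"
    then have pos: "measure \<mu> B > 0" by (simp add: less_le)
    \<comment> \<open>With this \<open>t\<close> the left side of \<open>main\<close> is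
      \<open>\<bar>C\<bar> + 2\<close>, above its right side \<open>C + 1\<close>.\<close>
    then have "(\<bar>C\<bar> + 2) / measure \<mu> B > 0" by simp
    from main[OF this] pos show False by simp
  qed
qed

locale gibbs_measure = quasi_bernoulli \<theta> K for \<theta> :: "'a::{finite,discrete_topology} list \<Rightarrow> real" and K +
  fixes m :: "(nat \<Rightarrow> 'a) measure" and C :: real
  assumes m_inv: "m \<in> invariant_measures left_shift"
    and m_le: "\<And>w. measure m (cylinder w) \<le> C * \<theta> w" and m_ge: "\<And>w. \<theta> w \<le> C * measure m (cylinder w)"
begin

sublocale prob_space m using m_inv by (rule invariant_measures_prob_space)

lemma sets_m [measurable_cong, simp]: "sets m = sets borel"
  using m_inv by (rule invariant_measures_sets)

lemma space_m [simp]: "space m = UNIV"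
  using m_inv by (rule invariant_measures_space)

lemma C_pos: "C > 0"
proof -
  have "0 < C * measure m (cylinder [])" using pos[of "[]"] m_ge[of "[]"] by linarith
  then show ?thesis by (simp add: zero_less_mult_iff)
qed

lemma cylinder_pos: "measure m (cylinder w) > 0"
proof -
  have "0 < C * measure m (cylinder w)" using pos[of w] m_ge[of w] by linarith
  then show ?thesis using C_pos by (simp add: zero_less_mult_iff)
qed

text \<open>For a cylinder in place of \<open>B\<close> this is quasi-multiplicativity (one
  \<open>K\<close>) together with two upper Gibbs bounds and one lower bound (\<open>C ^ 3\<close>).
  Both sides are measures in \<open>B\<close>, so the comparison on cylinders extends to Borel
  sets.\<close>

lemma mixing:
  assumes B: "B \<in> sets borel"
  shows "measure m (cylinder w) * measure m B \<le> C ^ 3 * K * measure m (cylinder w \<inter> (left_shift ^^ length w) -` B)"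
proof -
  define N where "N = distr (density m (indicator (cylinder w))) borel (left_shift ^^ length w)"
  have meas: "left_shift ^^ length w \<in> density m (indicator (cylinder w)) \<rightarrow>\<^sub>M borel"
    using left_shift_funpow_measurable[of "length w"] by (simp cong: measurable_cong_sets)
  interpret D: finite_measure "density m (indicator (cylinder w))"
    by (rule finite_measure_restricted) simp
  have N: "measure N A = measure m (cylinder w \<inter> (left_shift ^^ length w) -` A)" if A: "A \<in> sets borel" for A
  proof -
    have "(left_shift ^^ length w) -` A \<in> sets borel"
      using measurable_sets[OF left_shift_funpow_measurable A] by simp
    then show ?thesis unfolding N_def
      by (subst measure_distr[OF meas A]) (simp add: measure_restricted)
  qed
  have finite_N: "finite_measure N" unfolding N_def using meas by (rule D.finite_measure_distr)
  have le: "measure m (cylinder v) \<le> C ^ 3 * K / measure m (cylinder w) * measure N (cylinder v)" for v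
  proof -
    have "measure m (cylinder w) * measure m (cylinder v) \<le> C * \<theta> w * (C * \<theta> v)"
      using m_le C_pos pos by (intro mult_mono) (auto simp: less_imp_le)
    also have "\<dots> = C\<^sup>2 * (\<theta> w * \<theta> v)" by (simp add: power2_eq_square)
    also have "\<dots> \<le> C\<^sup>2 * (K * \<theta> (w @ v))" by (intro mult_left_mono append_ge) simp
    also have "\<dots> \<le> C\<^sup>2 * (K * (C * measure m (cylinder (w @ v))))"
      using K by (intro mult_left_mono m_ge) auto
    also have "cylinder (w @ v) = cylinder w \<inter> (left_shift ^^ length w) -` cylinder v"
      by (auto simp: mem_cylinder_append_iff)
    finally show ?thesis
      using cylinder_pos[of w] by (simp add: N field_simps power2_eq_square power3_eq_cube)
  qed
  have "measure m B \<le> C ^ 3 * K / measure m (cylinder w) * measure N B"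
    by (rule measure_le_if_cylinder_le[OF finite_measure_axioms finite_N sets_m _ le B]) (simp add: N_def)
  then show ?thesis using cylinder_pos[of w] by (simp add: N[OF B] field_simps)
qed

text \<open>If \<open>B\<close> is invariant, \<open>mixing\<close> says that \<open>B\<close> fills
  a fixed proportion of every cylinder. Hence \<open>m\<close> is dominated by a multiple of its
  restriction to \<open>B\<close>, and evaluating at the complement of \<open>B\<close> gives
  0.\<close>

lemma ergodic:
  assumes B: "B \<in> sets borel"
    and inv: "measure m ((B - left_shift -` B) \<union> (left_shift -` B - B)) = 0"
  shows "measure m B = 0 \<or> measure m (- B) = 0"
proof (cases "measure m B = 0")
  case False
  then have Bpos: "measure m B > 0" by (simp add: less_le)
  have vimage [measurable]: "(left_shift ^^ n) -` A \<in> sets borel" if "A \<in> sets borel" for n and A :: "(nat \<Rightarrow> 'a) set"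
    using measurable_sets[OF left_shift_funpow_measurable that] by simp
  note [measurable] = B
  interpret P: stationary_process m left_shift "\<lambda>x. x 0" UNIV
    by (rule stationary_process_letters[OF m_inv])
  have ae: "AE x in m. x \<in> B \<longleftrightarrow> left_shift x \<in> B"
  proof -
    have "(B - left_shift -` B) \<union> (left_shift -` B - B) \<in> null_sets m"
      using inv vimage[OF B, of 1] by (auto simp: null_sets_def emeasure_eq_measure)
    then show ?thesis by (rule AE_I') auto
  qed
  have ae_n: "AE x in m. x \<in> B \<longleftrightarrow> (left_shift ^^ n) x \<in> B" for n
  proof (induction n)
    case (Suc n)
    have "AE x in m. (left_shift ^^ n) x \<in> B \<longleftrightarrow> left_shift ((left_shift ^^ n) x) \<in> B"
    proof -
      have "AE x in distr m m (left_shift ^^ n). x \<in> B \<longleftrightarrow> left_shift x \<in> B"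
        unfolding P.distr_funpow by (rule ae)
      then show ?thesis by (rule AE_distrD[OF P.funpow_measurable])
    qed
    with Suc show ?case by eventually_elim simp
  qed simp
  have cyl: "measure m (cylinder w) * measure m B \<le> C ^ 3 * K * measure m (B \<inter> cylinder w)" for w
  proof -
    have "measure m (cylinder w \<inter> (left_shift ^^ length w) -` B) = measure m (B \<inter> cylinder w)"
      by (rule measure_eq_AE) (use ae_n[of "length w"] in \<open>auto intro: vimage\<close>)
    then show ?thesis using mixing[OF B, of w] by simp
  qed
  let ?N = "density m (indicator B)"
  have N: "measure ?N A = measure m (B \<inter> A)" if "A \<in> sets borel" for A
    using that by (simp add: measure_restricted)
  have "measure m (- B) \<le> C ^ 3 * K / measure m B * measure ?N (- B)"
  proof (rule measure_le_if_cylinder_le[OF finite_measure_axioms])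
    show "finite_measure ?N" by (rule finite_measure_restricted) simp
    show "measure m (cylinder w) \<le> C ^ 3 * K / measure m B * measure ?N (cylinder w)" for w
      using cyl[of w] Bpos by (simp add: N field_simps)
  qed (use B in auto)
  also have "measure ?N (- B) = 0" using B by (subst N) auto
  finally show ?thesis by (simp add: measure_le_0_iff)
qed simp

text \<open>
  The shift is not invertible, so the density \<open>f\<close> of \<open>\<mu>\<close> need not be invariant a priori; but comparing the masses
  of the two halves of the symmetric difference shows that the set \<open>{f > 1}\<close> is invariant modulo \<open>m\<close>.
\<close>

lemma unique_if_absolutely_continuous:
  assumes \<mu>: "\<mu> \<in> invariant_measures left_shift"
    and ac: "\<And>B. B \<in> sets borel \<Longrightarrow> measure m B = 0 \<Longrightarrow> measure \<mu> B = 0"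
  shows "\<mu> = m"
proof -
  interpret \<mu>: prob_space \<mu> using \<mu> by (rule invariant_measures_prob_space)
  have sets_\<mu> [simp]: "sets \<mu> = sets borel" using \<mu> by (rule invariant_measures_sets)
  have space_\<mu> [simp]: "space \<mu> = UNIV" using \<mu> by (rule invariant_measures_space)
  have "absolutely_continuous m \<mu>"
    unfolding absolutely_continuous_def using ac
    by (auto simp: null_sets_def emeasure_eq_measure \<mu>.emeasure_eq_measure)
  then obtain f where f [measurable]: "f \<in> borel_measurable m" and dens: "density m f = \<mu>"
    using Radon_Nikodym[of \<mu>] by auto
  have em_\<mu>: "emeasure \<mu> A = (\<integral>\<^sup>+x. f x * indicator A x \<partial>m)" if "A \<in> sets borel" for A
    unfolding dens[symmetric] using that by (intro emeasure_density) auto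
  define B where "B = {x. f x > 1}"
  have B [measurable]: "B \<in> sets borel"
  proof -
    have "{x \<in> space m. f x > 1} \<in> sets m" by measurable
    then show ?thesis by (simp add: B_def)
  qed
  have TB [measurable]: "left_shift -` B \<in> sets borel"
    using measurable_sets[OF left_shift_measurable B] by simp
  define A1 A2 where "A1 = B - left_shift -` B" and "A2 = left_shift -` B - B"
  have [measurable]: "A1 \<in> sets borel" "A2 \<in> sets borel" by (auto simp: A1_def A2_def)
  \<comment> \<open>Both sets arise by removing the same intersection from sets of equal measure.
    This holds for \<open>\<mu>\<close> as well as for \<open>m\<close>.\<close>
  have balance: "measure N A1 = measure N A2" if N: "N \<in> invariant_measures left_shift" for N
  proof -
    interpret N: prob_space N using N by (rule invariant_measures_prob_space)
    interpret S: stationary_process N left_shift "\<lambda>x. x 0" UNIV by (rule stationary_process_letters[OF N])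
    have [simp]: "sets N = sets borel" "space N = UNIV"
      using N invariant_measures_sets invariant_measures_space by blast+
    have "measure N (left_shift -` B) = measure N B"
      using S.prob_vimage_funpow[of B 1] B by (simp add: vimage_def)
    moreover have "measure N A1 = measure N B - measure N (B \<inter> left_shift -` B)"
      unfolding A1_def by (rule N.finite_measure_Diff') auto
    moreover have "measure N A2 = measure N (left_shift -` B) - measure N (B \<inter> left_shift -` B)"
      unfolding A2_def Int_commute[of B] by (rule N.finite_measure_Diff') auto
    ultimately show ?thesis by simp
  qed
  have A1_gt: "f x > 1" if "x \<in> A1" for x
    using that by (simp add: A1_def B_def)
  \<comment> \<open>The density exceeds 1 on \<open>A1\<close> and is at most 1 on
    \<open>A2\<close>. A positive mass of \<open>A1\<close> would give
    \<open>m A1 < \<mu> A1 = \<mu> A2 \<le> m A2 = m A1\<close>.\<close>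
  have "emeasure m A1 = 0"
  proof (rule ccontr)
    assume ne: "emeasure m A1 \<noteq> 0"
    have "emeasure m A1 = (\<integral>\<^sup>+x. indicator A1 x \<partial>m)" by simp
    also have "\<dots> < (\<integral>\<^sup>+x. f x * indicator A1 x \<partial>m)"
    proof (rule nn_integral_less)
      show "(\<integral>\<^sup>+x. indicator A1 x \<partial>m) \<noteq> \<infinity>" by simp
      show "AE x in m. indicator A1 x \<le> f x * indicator A1 x"
        by (intro AE_I2) (auto simp: A1_def B_def indicator_def)
      show "\<not> (AE x in m. f x * indicator A1 x \<le> indicator A1 x)"
      proof
        assume "AE x in m. f x * indicator A1 x \<le> indicator A1 x"
        then have "AE x in m. x \<notin> A1"
          by eventually_elim (metis A1_gt indicator_simps(1) leD mult.right_neutral)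
        then have "A1 \<in> null_sets m" by (subst AE_iff_null_sets) auto
        then show False using ne by (simp add: null_setsD1)
      qed
    qed auto
    also have "\<dots> = emeasure \<mu> A1" by (simp add: em_\<mu>)
    also have "\<dots> = emeasure \<mu> A2" using balance[OF \<mu>] by (simp add: \<mu>.emeasure_eq_measure)
    also have "\<dots> = (\<integral>\<^sup>+x. f x * indicator A2 x \<partial>m)" by (simp add: em_\<mu>)
    also have "\<dots> \<le> (\<integral>\<^sup>+x. indicator A2 x \<partial>m)"
      by (intro nn_integral_mono) (auto simp: A2_def B_def indicator_def)
    also have "\<dots> = emeasure m A1" using balance[OF m_inv] by (simp add: emeasure_eq_measure)
    finally show False by simp
  qed
  then have "measure m A1 = 0" "measure m A2 = 0" using balance[OF m_inv] by (auto simp: measure_def)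
  then have "measure m (A1 \<union> A2) = 0" using measure_Un_le[of A1 m A2] by (simp add: measure_le_0_iff)
  \<comment> \<open>In the first case the density is at most 1 almost everywhere and
    \<open>\<mu> \<le> m\<close>, in the second \<open>m \<le> \<mu>\<close>; comparable probability
    measures coincide.\<close>
  then consider "measure m B = 0" | "measure m (- B) = 0"
    using ergodic[OF B] unfolding A1_def A2_def by blast
  then show ?thesis
  proof cases
    case 1
    then have "AE x in m. x \<notin> B" by (intro AE_not_in null_setsI) (auto simp: emeasure_eq_measure)
    then have "emeasure \<mu> A \<le> emeasure m A" if "A \<in> sets borel" for A
      using that unfolding em_\<mu>[OF that]
      by (subst nn_integral_indicator[symmetric], simp, intro nn_integral_mono_AE)
        (auto elim!: eventually_mono simp: B_def indicator_def not_less)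
    then show ?thesis
      by (intro prob_space_eqI_le) (auto simp: emeasure_eq_measure \<mu>.emeasure_eq_measure \<mu>.prob_space_axioms prob_space_axioms)
  next
    case 2
    then have "AE x in m. x \<notin> - B" by (intro AE_not_in null_setsI) (auto simp: emeasure_eq_measure)
    then have "emeasure m A \<le> emeasure \<mu> A" if "A \<in> sets borel" for A
      using that unfolding em_\<mu>[OF that]
      by (subst nn_integral_indicator[symmetric], simp, intro nn_integral_mono_AE)
        (auto elim!: eventually_mono simp: B_def indicator_def)
    then show ?thesis
      by (intro prob_space_eqI_le[symmetric]) (auto simp: emeasure_eq_measure \<mu>.emeasure_eq_measure \<mu>.prob_space_axioms prob_space_axioms)
  qed
qed

end

section \<open>Weighted equilibrium states\<close>

text \<open>The sum over a product set factors when \<open>h\<close> splits exactly, so a defect of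
  at most \<open>c\<close> costs a factor between \<open>exp (- c)\<close> and \<open>exp c\<close>.
  It transfers almost additivity, with the same constant, from exponents to fibre sums and to
  partition sums.\<close>

lemma ln_sum_exp_product:
  fixes h :: "'i \<Rightarrow> 'j \<Rightarrow> real"
  assumes "finite A" "A \<noteq> {}" "finite B" "B \<noteq> {}"
    and h: "\<And>x y. x \<in> A \<Longrightarrow> y \<in> B \<Longrightarrow> \<bar>h x y - f x - g y\<bar> \<le> c"
  shows "\<bar>ln (\<Sum>x\<in>A. \<Sum>y\<in>B. exp (h x y)) - ln (\<Sum>x\<in>A. exp (f x)) - ln (\<Sum>y\<in>B. exp (g y))\<bar> \<le> c"
proof -
  let ?H = "\<Sum>x\<in>A. \<Sum>y\<in>B. exp (h x y)" and ?F = "\<Sum>x\<in>A. exp (f x)" and ?G = "\<Sum>y\<in>B. exp (g y)"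
  have pos: "?H > 0" "?F > 0" "?G > 0" using assms by (auto intro!: sum_pos)
  have upper: "exp (h x y) \<le> exp c * (exp (f x) * exp (g y))" if "x \<in> A" "y \<in> B" for x y
    using h[OF that] by (simp flip: exp_add)
  have lower: "exp (- c) * (exp (f x) * exp (g y)) \<le> exp (h x y)" if "x \<in> A" "y \<in> B" for x y
    using h[OF that] by (simp flip: exp_add)
  have "?H \<le> (\<Sum>x\<in>A. \<Sum>y\<in>B. exp c * (exp (f x) * exp (g y)))" by (intro sum_mono upper)
  also have "\<dots> = exp c * (?F * ?G)" by (rule sum_mult_product)
  finally have "ln ?H \<le> ln (exp c * (?F * ?G))" using pos by (subst ln_le_cancel_iff) auto
  also have "\<dots> = c + ln ?F + ln ?G" using pos by (simp add: ln_mult_pos)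
  finally have 1: "ln ?H \<le> c + ln ?F + ln ?G" .
  have "exp (- c) * (?F * ?G) = (\<Sum>x\<in>A. \<Sum>y\<in>B. exp (- c) * (exp (f x) * exp (g y)))" by (rule sum_mult_product[symmetric])
  also have "\<dots> \<le> ?H" by (intro sum_mono lower)
  finally have "ln (exp (- c) * (?F * ?G)) \<le> ln ?H" using pos by (subst ln_le_cancel_iff) auto
  moreover have "ln (exp (- c) * (?F * ?G)) = - c + ln ?F + ln ?G" using pos by (simp add: ln_mult_pos)
  ultimately show ?thesis using 1 by linarith
qed

text \<open>Subadditivity makes the rate an infimum, so the linear lower bound holds at each
  \<open>n\<close> without any error term.\<close>

lemma word_entropy_subadditive:
  fixes M :: "(nat \<Rightarrow> 'a::{finite,discrete_topology}) measure"
  assumes M: "M \<in> invariant_measures left_shift" and h: "(\<lambda>n. word_entropy M n / real n) \<longlonglongrightarrow> h"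
    and n: "n \<ge> 1"
  shows "real n * h \<le> word_entropy M n"
proof -
  interpret stationary_process M left_shift "\<lambda>x. x 0" UNIV by (rule stationary_process_letters[OF M])
  note eq = block_entropy_letters[OF M]
  obtain L where L: "(\<lambda>n. word_entropy M n / real n) \<longlonglongrightarrow> L" "\<forall>n\<ge>1. real n * L \<le> word_entropy M n + 0"
    using almost_subadditive_limit[of block_entropy 0 0] block_entropy_subadditive block_entropy_nonneg
    unfolding eq by auto
  then show ?thesis using LIMSEQ_unique[OF h L(1)] n by auto
qed

lemma sum_measure_cylinder:
  fixes M :: "(nat \<Rightarrow> 'a::{finite,discrete_topology}) measure"
  assumes "M \<in> invariant_measures left_shift"
  shows "(\<Sum>w\<in>words n. measure M (cylinder w)) = 1"
    and "v \<in> words k \<Longrightarrow> (\<Sum>w\<in>words n. measure M (cylinder (v @ w))) = measure M (cylinder v)"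
    and "v \<in> words k \<Longrightarrow> (\<Sum>w\<in>words n. measure M (cylinder (w @ v))) = measure M (cylinder v)"
proof -
  interpret stationary_process M left_shift "\<lambda>x. x 0" UNIV by (rule stationary_process_letters[OF assms])
  note it = itinerary_letters[OF stationary_process_axioms]
  have eq: "itinerary_prob w = measure M (cylinder w)" for w
    unfolding itinerary_prob_def it by (simp add: cylinder_def invariant_measures_space[OF assms])
  show "(\<Sum>w\<in>words n. measure M (cylinder w)) = 1"
    "v \<in> words k \<Longrightarrow> (\<Sum>w\<in>words n. measure M (cylinder (v @ w))) = measure M (cylinder v)"
    "v \<in> words k \<Longrightarrow> (\<Sum>w\<in>words n. measure M (cylinder (w @ v))) = measure M (cylinder v)"
    using sum_itinerary_prob[of n] sum_itinerary_prob_append[of v k n] unfolding it eq by auto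
qed

definition word_mean :: "('a list \<Rightarrow> real) \<Rightarrow> (nat \<Rightarrow> 'a) measure \<Rightarrow> nat \<Rightarrow> real" where
  "word_mean g M n = (\<Sum>w\<in>words n. measure M (cylinder w) * g w)"

text \<open>By invariance the means over the first \<open>n\<close> and the last \<open>m\<close>
  letters can both be taken against the law of words of length \<open>n + m\<close>; the defect is
  then an average of defects of \<open>g\<close>.\<close>

lemma word_mean_limit:
  fixes M :: "(nat \<Rightarrow> 'a::{finite,discrete_topology}) measure"
  assumes M: "M \<in> invariant_measures left_shift"
    and g: "\<And>v w. \<bar>g (v @ w) - g v - g w\<bar> \<le> c"
  shows "\<exists>L. (\<lambda>n. word_mean g M n / real n) \<longlonglongrightarrow> L \<and> (\<forall>n\<ge>1. \<bar>real n * L - word_mean g M n\<bar> \<le> c)"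
proof (rule almost_additive_limit)
  fix n m :: nat
  let ?\<mu> = "\<lambda>w. measure M (cylinder w)"
  have "word_mean g M n = (\<Sum>v\<in>words n. \<Sum>w\<in>words m. ?\<mu> (v @ w) * g v)"
    unfolding word_mean_def
    by (intro sum.cong refl) (simp add: sum_measure_cylinder(2)[OF M] flip: sum_distrib_right)
  moreover have "word_mean g M m = (\<Sum>v\<in>words n. \<Sum>w\<in>words m. ?\<mu> (v @ w) * g w)"
    unfolding word_mean_def
    by (subst sum.swap, intro sum.cong refl) (simp add: sum_measure_cylinder(3)[OF M] flip: sum_distrib_right)
  moreover have "word_mean g M (n + m) = (\<Sum>v\<in>words n. \<Sum>w\<in>words m. ?\<mu> (v @ w) * g (v @ w))"
    unfolding word_mean_def by (rule sum_words_add)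
  ultimately have "word_mean g M (n + m) - word_mean g M n - word_mean g M m
      = (\<Sum>v\<in>words n. \<Sum>w\<in>words m. ?\<mu> (v @ w) * (g (v @ w) - g v - g w))"
    by (simp add: sum_subtractf right_diff_distrib)
  also have "\<bar>\<dots>\<bar> \<le> (\<Sum>v\<in>words n. \<Sum>w\<in>words m. ?\<mu> (v @ w) * c)"
    by (intro order_trans[OF sum_abs] sum_mono) (simp add: abs_mult mult_left_mono g)
  also have "\<dots> = c"
    using sum_words_add[of ?\<mu> n m] sum_measure_cylinder(1)[OF M, of "n + m"] by (simp flip: sum_distrib_right)
  finally show "\<bar>word_mean g M (n + m) - word_mean g M n - word_mean g M m\<bar> \<le> c" .
qed

section \<open>Weights, partition sums and the block energy identity\<close>

locale weighted_word_potential =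
  fixes p :: "'a::{finite,discrete_topology} \<Rightarrow> 'b::{finite,discrete_topology}"
    and a b c :: real and g :: "'a list \<Rightarrow> real"
  assumes a: "a > 0" and b: "b \<ge> 0"
    and g_append: "\<And>v w. \<bar>g (v @ w) - g v - g w\<bar> \<le> c"
begin

definition fibre :: "'b list \<Rightarrow> 'a list set" where
  "fibre u = {w. map p w = u}"

definition log_fibre :: "'a list \<Rightarrow> real" where
  "log_fibre w = ln (\<Sum>v\<in>fibre (map p w). exp (g v / a))"

text \<open>
  The normalisation of \<open>exp score\<close> on the words of length \<open>n\<close> is the maximiser of the block energy, see
  \<open>block_energy_eq\<close>.
\<close>

definition score :: "'a list \<Rightarrow> real" where
  "score w = g w / a - b / (a + b) * log_fibre w"

definition log_partition :: "nat \<Rightarrow> real" where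
  "log_partition n = ln (\<Sum>w\<in>words n. exp (score w))"

definition weight :: "'a list \<Rightarrow> real" where
  "weight w = exp (score w - log_partition (length w))"

definition pressure :: real where
  "pressure = lim (\<lambda>n. (a + b) * log_partition n / real n)"

definition block_energy :: "(nat \<Rightarrow> 'a) measure \<Rightarrow> nat \<Rightarrow> real" where
  "block_energy M n = word_mean g M n + a * word_entropy M n + b * word_entropy (distr M borel (\<lambda>x i. p (x i))) n"

lemma c_nonneg: "c \<ge> 0"
  using g_append[of "[]" "[]"] by linarith

lemma fibre_subset: "fibre u \<subseteq> words (length u)"
  by (auto simp: fibre_def words_def)

lemma finite_fibre [simp]: "finite (fibre u)"
  using fibre_subset finite_words by (rule finite_subset)

lemma mem_fibre_map [simp]: "w \<in> fibre (map p w)"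
  by (simp add: fibre_def)

lemma fibre_map_nonempty [simp]: "fibre (map p w) \<noteq> {}"
  using mem_fibre_map by blast

lemma fibre_append: "fibre (u @ u') = (\<lambda>(v, w). v @ w) ` (fibre u \<times> fibre u')"
  by (auto simp: fibre_def map_eq_append_conv image_iff)

lemma sum_fibre_append:
  fixes f :: "'a list \<Rightarrow> real"
  shows "(\<Sum>w\<in>fibre (u @ u'). f w) = (\<Sum>v\<in>fibre u. \<Sum>w\<in>fibre u'. f (v @ w))"
proof -
  have "inj_on (\<lambda>(v, w). v @ w) (fibre u \<times> fibre u')"
    by (auto simp: inj_on_def fibre_def) (metis append_eq_append_conv length_map)+
  then show ?thesis by (simp add: fibre_append sum.reindex sum.cartesian_product case_prod_unfold o_def)
qed

lemma sum_fibres: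
  fixes f :: "'a list \<Rightarrow> real"
  shows "(\<Sum>u\<in>words n. \<Sum>w\<in>fibre u. f w) = (\<Sum>w\<in>words n. f w)"
proof -
  have "(\<Sum>u\<in>words n. \<Sum>w\<in>fibre u. f w) = (\<Sum>u\<in>words n. \<Sum>w\<in>{w \<in> words n. map p w = u}. f w)"
    by (intro sum.cong refl) (auto simp: fibre_def words_def)
  also have "\<dots> = (\<Sum>w\<in>words n. f w)" proof (rule sum.group)
    show "map p ` words n \<subseteq> words n" by (auto simp: words_def)
  qed simp_all
  finally show ?thesis .
qed

lemma log_fibre_append: "\<bar>log_fibre (v @ w) - log_fibre v - log_fibre w\<bar> \<le> c / a"
  unfolding log_fibre_def map_append sum_fibre_append
proof (rule ln_sum_exp_product)
  show "\<bar>g (x @ y) / a - g x / a - g y / a\<bar> \<le> c / a" for x y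
    using divide_right_mono[OF g_append[of x y], of a] a by (simp flip: diff_divide_distrib)
qed simp_all

text \<open>The defects of \<open>g / a\<close> and of \<open>log_fibre\<close> are at most
  \<open>c / a\<close> each, and the coefficient \<open>b / (a + b)\<close> lies between 0 and
  1.\<close>

lemma score_append: "\<bar>score (v @ w) - score v - score w\<bar> \<le> 2 * c / a"
proof -
  have ab: "0 \<le> b / (a + b)" "b / (a + b) \<le> 1" using a b by auto
  have "\<bar>b / (a + b) * (log_fibre (v @ w) - log_fibre v - log_fibre w)\<bar> \<le> 1 * (c / a)"
    unfolding abs_mult abs_of_nonneg[OF ab(1)] by (rule mult_mono[OF ab(2) log_fibre_append]) simp_all
  moreover have "\<bar>(g (v @ w) - g v - g w) / a\<bar> \<le> c / a"
    using divide_right_mono[OF g_append[of v w], of a] a by simp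
  moreover have "score (v @ w) - score v - score w
      = (g (v @ w) - g v - g w) / a - b / (a + b) * (log_fibre (v @ w) - log_fibre v - log_fibre w)"
    by (simp add: score_def diff_divide_distrib right_diff_distrib)
  ultimately show ?thesis by linarith
qed

lemma words_nonempty: "words n \<noteq> ({} :: 'c list set)"
  using prefix_word_in_words by blast

lemma log_partition_append: "\<bar>log_partition (n + m) - log_partition n - log_partition m\<bar> \<le> 2 * c / a"
  unfolding log_partition_def sum_words_add
  by (rule ln_sum_exp_product) (auto simp: words_nonempty score_append)

lemma pressure_limit:
  "(\<lambda>n. (a + b) * log_partition n / real n) \<longlonglongrightarrow> pressure"
  "n \<ge> 1 \<Longrightarrow> \<bar>real n * pressure - (a + b) * log_partition n\<bar> \<le> (a + b) * (2 * c / a)"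
proof -
  have "\<bar>(a + b) * log_partition (n + m) - (a + b) * log_partition n - (a + b) * log_partition m\<bar> \<le> (a + b) * (2 * c / a)" for n m
    using mult_left_mono[OF log_partition_append[of n m], of "a + b"] a b
    by (simp add: abs_mult flip: right_diff_distrib)
  from almost_additive_limit[OF this] obtain L
    where L: "(\<lambda>n. (a + b) * log_partition n / real n) \<longlonglongrightarrow> L"
      "\<forall>n\<ge>1. \<bar>real n * L - (a + b) * log_partition n\<bar> \<le> (a + b) * (2 * c / a)" by blast
  have "pressure = L" unfolding pressure_def using L(1) by (rule limI)
  then show "(\<lambda>n. (a + b) * log_partition n / real n) \<longlonglongrightarrow> pressure"
    "n \<ge> 1 \<Longrightarrow> \<bar>real n * pressure - (a + b) * log_partition n\<bar> \<le> (a + b) * (2 * c / a)" using L by auto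
qed

text \<open>The exponent adds the defect \<open>2 * c / a\<close> of \<open>score\<close> to the
  equal defect of \<open>log_partition\<close>.\<close>

sublocale quasi_bernoulli weight "exp (4 * c / a)"
proof
  show "weight w > 0" for w by (simp add: weight_def)
  show "(\<Sum>w\<in>words n. weight w) = 1" for n
  proof -
    have pos: "(\<Sum>w\<in>words n. exp (score w)) > 0" by (intro sum_pos) (auto simp: words_nonempty)
    have "(\<Sum>w\<in>words n. weight w) = (\<Sum>w\<in>words n. exp (score w) / exp (log_partition n))"
      by (intro sum.cong refl) (auto simp: weight_def exp_diff words_def)
    also have "\<dots> = 1" using pos by (simp add: log_partition_def flip: sum_divide_distrib)
    finally show ?thesis .
  qed
  fix v w
  have *: "\<bar>(score (v @ w) - log_partition (length (v @ w)))
      - (score v - log_partition (length v)) - (score w - log_partition (length w))\<bar> \<le> 4 * c / a"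
  proof -
    have "2 * c / a + 2 * c / a = 4 * c / a" by (simp add: add_divide_distrib[symmetric])
    then show ?thesis
      using score_append[of v w] log_partition_append[of "length v" "length w"] unfolding length_append by linarith
  qed
  show "weight (v @ w) \<le> exp (4 * c / a) * weight v * weight w"
    "weight v * weight w \<le> exp (4 * c / a) * weight (v @ w)"
    using * by (simp_all add: weight_def flip: exp_add)
qed simp

text \<open>On a fibre only \<open>g\<close> varies. Summing \<open>exp (g v / a)\<close> restores
  one full power of the fibre sum, of which the weight had removed the power
  \<open>b / (a + b)\<close>.\<close>

lemma sum_weight_fibre:
  "(\<Sum>v\<in>fibre (map p w). weight v) = exp ((1 - b / (a + b)) * log_fibre w - log_partition (length w))"
proof -
  let ?\<gamma> = "b / (a + b)" and ?n = "length w"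
  have pos: "(\<Sum>v\<in>fibre (map p w). exp (g v / a)) > 0"
    by (intro sum_pos) simp_all
  have "(\<Sum>v\<in>fibre (map p w). weight v) = (\<Sum>v\<in>fibre (map p w). exp (g v / a) * exp (- ?\<gamma> * log_fibre w - log_partition ?n))"
  proof (intro sum.cong refl)
    fix v assume "v \<in> fibre (map p w)"
    then have "map p v = map p w" "length v = ?n" by (auto simp: fibre_def dest: map_eq_imp_length_eq)
    then have "log_fibre v = log_fibre w" by (simp add: log_fibre_def)
    then show "weight v = exp (g v / a) * exp (- ?\<gamma> * log_fibre w - log_partition ?n)"
      unfolding weight_def score_def \<open>length v = ?n\<close> exp_add[symmetric] by (simp add: algebra_simps)
  qed
  also have "\<dots> = exp (log_fibre w) * exp (- ?\<gamma> * log_fibre w - log_partition ?n)"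
    using pos by (simp add: log_fibre_def flip: sum_distrib_right)
  also have "\<dots> = exp ((1 - ?\<gamma>) * log_fibre w - log_partition ?n)"
    unfolding exp_add[symmetric] by (simp add: algebra_simps)
  finally show ?thesis .
qed

context
  fixes M :: "(nat \<Rightarrow> 'a) measure"
  assumes M: "M \<in> invariant_measures left_shift"
begin

interpretation prob_space M using M by (rule invariant_measures_prob_space)

lemma factor_measurable: "(\<lambda>x i. p (x i)) \<in> M \<rightarrow>\<^sub>M (borel :: (nat \<Rightarrow> 'b) measure)"
proof -
  have "continuous_on UNIV (\<lambda>x i. p (x i))"
  proof (rule continuous_on_coordinatewise_then_product)
    fix i
    have "continuous_on UNIV p" by (simp add: continuous_on_open_vimage discrete_topology_class.open_discrete)
    then show "continuous_on UNIV (\<lambda>x. p (x i))"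
      by (rule continuous_on_compose2[of UNIV _ UNIV]) auto
  qed
  then show ?thesis
    using borel_measurable_continuous_onI measurable_cong_sets[OF invariant_measures_sets[OF M] refl] by blast
qed

lemma factor_cylinder: "measure (distr M borel (\<lambda>x i. p (x i))) (cylinder u) = (\<Sum>w\<in>fibre u. measure M (cylinder w))"
proof -
  have "measure (distr M borel (\<lambda>x i. p (x i))) (cylinder u) = prob ((\<lambda>x i. p (x i)) -` cylinder u)"
    using measure_distr[OF factor_measurable, of "cylinder u"] invariant_measures_space[OF M] by simp
  also have "(\<lambda>x i. p (x i)) -` cylinder u = cylinder_set (length u) (fibre u)"
    by (auto simp: cylinder_set_def cylinder_def fibre_def prefix_word_def o_def)
  also have "prob \<dots> = (\<Sum>w\<in>fibre u. measure M (cylinder w))"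
    using measure_cylinder_set[OF finite_measure_axioms invariant_measures_sets[OF M], of UNIV "length u" "fibre u"] fibre_subset[of u]
    by (simp add: Int_absorb2)
  finally show ?thesis .
qed

text \<open>The mean of \<open>log_fibre\<close> enters with coefficient
  \<open>- a * \<gamma>\<close> from the words and \<open>b * (1 - \<gamma>)\<close> from their
  images. These cancel exactly for \<open>\<gamma> = b / (a + b)\<close>, leaving the energy and the
  partition sums.\<close>

lemma block_energy_eq:
  "block_energy M n = (a + b) * log_partition n
    - a * ((\<Sum>w\<in>words n. measure M (cylinder w) * ln (measure M (cylinder w)))
        - (\<Sum>w\<in>words n. measure M (cylinder w) * ln (weight w)))
    - b * ((\<Sum>u\<in>words n. (\<Sum>w\<in>fibre u. measure M (cylinder w)) * ln (\<Sum>w\<in>fibre u. measure M (cylinder w)))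
        - (\<Sum>u\<in>words n. (\<Sum>w\<in>fibre u. measure M (cylinder w)) * ln (\<Sum>w\<in>fibre u. weight w)))"
proof -
  let ?\<mu> = "\<lambda>w. measure M (cylinder w)"
  define s where "s = (\<Sum>w\<in>words n. ?\<mu> w * log_fibre w)"
  define \<gamma> where "\<gamma> = b / (a + b)"
  have one: "sum ?\<mu> (words n) = 1" by (rule sum_measure_cylinder(1)[OF M])
  have "(\<Sum>w\<in>words n. ?\<mu> w * ln (weight w)) = (\<Sum>w\<in>words n. ?\<mu> w * g w / a - \<gamma> * (?\<mu> w * log_fibre w) - ?\<mu> w * log_partition n)"
    by (intro sum.cong refl) (auto simp: weight_def score_def words_def \<gamma>_def algebra_simps)
  also have "\<dots> = word_mean g M n / a - \<gamma> * s - log_partition n"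
    by (simp add: sum_subtractf word_mean_def s_def one flip: sum_divide_distrib sum_distrib_left sum_distrib_right)
  finally have 1: "(\<Sum>w\<in>words n. ?\<mu> w * ln (weight w)) = word_mean g M n / a - \<gamma> * s - log_partition n" .
  have "(\<Sum>u\<in>words n. (\<Sum>w\<in>fibre u. ?\<mu> w) * ln (\<Sum>w\<in>fibre u. weight w))
      = (\<Sum>u\<in>words n. \<Sum>w\<in>fibre u. ?\<mu> w * ln (\<Sum>v\<in>fibre (map p w). weight v))"
    by (intro sum.cong refl) (auto simp: sum_distrib_right fibre_def intro!: sum.cong)
  also have "\<dots> = (\<Sum>w\<in>words n. ?\<mu> w * ln (\<Sum>v\<in>fibre (map p w). weight v))" by (rule sum_fibres)
  also have "\<dots> = (\<Sum>w\<in>words n. (1 - \<gamma>) * (?\<mu> w * log_fibre w) - ?\<mu> w * log_partition n)"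
    unfolding sum_weight_fibre by (intro sum.cong refl) (auto simp: \<gamma>_def words_def algebra_simps)
  also have "\<dots> = (1 - \<gamma>) * s - log_partition n"
    by (simp add: sum_subtractf s_def one flip: sum_distrib_left sum_distrib_right)
  finally have 2: "(\<Sum>u\<in>words n. (\<Sum>w\<in>fibre u. ?\<mu> w) * ln (\<Sum>w\<in>fibre u. weight w)) = (1 - \<gamma>) * s - log_partition n" .
  have \<gamma>: "a * \<gamma> = b * (1 - \<gamma>)" using a b by (simp add: \<gamma>_def field_simps)
  have "a * (word_mean g M n / a - \<gamma> * s - log_partition n) + b * ((1 - \<gamma>) * s - log_partition n)
      = word_mean g M n - (a * \<gamma>) * s + (b * (1 - \<gamma>)) * s - (a + b) * log_partition n"
    using a by (simp add: algebra_simps)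
  also have "\<dots> = word_mean g M n - (a + b) * log_partition n" unfolding \<gamma> by simp
  finally show ?thesis
    unfolding block_energy_def word_entropy_def factor_cylinder 1 2 by (simp add: algebra_simps)
qed

lemma relative_entropy_bounds:
  "(\<Sum>w\<in>words n. measure M (cylinder w) * ln (weight w)) \<le> (\<Sum>w\<in>words n. measure M (cylinder w) * ln (measure M (cylinder w)))"
  "(\<Sum>u\<in>words n. (\<Sum>w\<in>fibre u. measure M (cylinder w)) * ln (\<Sum>w\<in>fibre u. weight w))
    \<le> (\<Sum>u\<in>words n. (\<Sum>w\<in>fibre u. measure M (cylinder w)) * ln (\<Sum>w\<in>fibre u. measure M (cylinder w)))"
proof -
  show "(\<Sum>w\<in>words n. measure M (cylinder w) * ln (weight w)) \<le> (\<Sum>w\<in>words n. measure M (cylinder w) * ln (measure M (cylinder w)))"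
    using gibbs_inequality[of "words n" "\<lambda>w. measure M (cylinder w)" weight] pos
    by (simp add: sum_words sum_measure_cylinder(1)[OF M] less_imp_le)
  have "(\<Sum>w\<in>fibre u. weight w) > 0" if "(\<Sum>w\<in>fibre u. measure M (cylinder w)) > 0" for u
  proof -
    have "fibre u \<noteq> {}" using that by auto
    then show ?thesis using pos by (intro sum_pos) auto
  qed
  then show "(\<Sum>u\<in>words n. (\<Sum>w\<in>fibre u. measure M (cylinder w)) * ln (\<Sum>w\<in>fibre u. weight w))
    \<le> (\<Sum>u\<in>words n. (\<Sum>w\<in>fibre u. measure M (cylinder w)) * ln (\<Sum>w\<in>fibre u. measure M (cylinder w)))"
    using gibbs_inequality[of "words n" "\<lambda>u. \<Sum>w\<in>fibre u. measure M (cylinder w)" "\<lambda>u. \<Sum>w\<in>fibre u. weight w"] pos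
    by (simp add: sum_fibres sum_words sum_measure_cylinder(1)[OF M] less_imp_le sum_nonneg)
qed

text \<open>Only the divergence between the images is discarded; the one between the words is kept,
  since uniqueness rests on bounding it.\<close>

lemma block_energy_le:
  "block_energy M n \<le> (a + b) * log_partition n
    - a * ((\<Sum>w\<in>words n. measure M (cylinder w) * ln (measure M (cylinder w)))
        - (\<Sum>w\<in>words n. measure M (cylinder w) * ln (weight w)))"
  unfolding block_energy_eq using relative_entropy_bounds(2)[of n] b by (simp add: mult_left_mono)

lemma block_energy_le_partition: "block_energy M n \<le> (a + b) * log_partition n"
  using block_energy_le[of n] mult_nonneg_nonneg[of a "_ - _"] relative_entropy_bounds(1)[of n] a
  by (smt (verit) mult_nonneg_nonneg)

text \<open>A density bounded by \<open>C\<close> caps a relative entropy at \<open>ln C\<close>.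
  The bound is inherited by sums over fibres, so it applies to both divergences.\<close>

lemma block_energy_ge:
  assumes le: "\<And>w. measure M (cylinder w) \<le> C * weight w" and C: "C > 0"
  shows "(a + b) * log_partition n - (a + b) * ln C \<le> block_energy M n"
proof -
  have bound: "(\<Sum>s\<in>S. q s * ln (q s)) - (\<Sum>s\<in>S. q s * ln (r s)) \<le> ln C"
    if "\<And>s. s \<in> S \<Longrightarrow> q s \<ge> 0" "\<And>s. s \<in> S \<Longrightarrow> q s \<le> C * r s" "sum q S = 1" for q r :: "'s \<Rightarrow> real" and S
  proof -
    have "(\<Sum>s\<in>S. q s * ln (q s)) \<le> (\<Sum>s\<in>S. q s * ln C + q s * ln (r s))"
    proof (rule sum_mono)
      fix s assume s: "s \<in> S"
      show "q s * ln (q s) \<le> q s * ln C + q s * ln (r s)"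
      proof (cases "q s = 0")
        case False
        then have q: "q s > 0" using that(1)[OF s] by simp
        then have "0 < C * r s" using that(2)[OF s] by linarith
        then have r: "r s > 0" using C by (simp add: zero_less_mult_iff)
        have "ln (q s) \<le> ln C + ln (r s)"
          using that(2)[OF s] q r C by (simp flip: ln_mult_pos)
        then have "q s * ln (q s) \<le> q s * (ln C + ln (r s))" using q by (intro mult_left_mono) auto
        then show ?thesis by (simp add: algebra_simps)
      qed simp
    qed
    also have "\<dots> = ln C + (\<Sum>s\<in>S. q s * ln (r s))"
      using that(3) by (simp add: sum.distrib flip: sum_distrib_right)
    finally show ?thesis by simp
  qed
  have fib: "(\<Sum>w\<in>fibre u. measure M (cylinder w)) \<le> C * (\<Sum>w\<in>fibre u. weight w)" for u
    using le by (simp add: sum_distrib_left sum_mono)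
  have 1: "(\<Sum>w\<in>words n. measure M (cylinder w) * ln (measure M (cylinder w)))
        - (\<Sum>w\<in>words n. measure M (cylinder w) * ln (weight w)) \<le> ln C"
    by (rule bound) (auto simp: le sum_measure_cylinder(1)[OF M])
  have 2: "(\<Sum>u\<in>words n. (\<Sum>w\<in>fibre u. measure M (cylinder w)) * ln (\<Sum>w\<in>fibre u. measure M (cylinder w)))
        - (\<Sum>u\<in>words n. (\<Sum>w\<in>fibre u. measure M (cylinder w)) * ln (\<Sum>w\<in>fibre u. weight w)) \<le> ln C"
    by (rule bound) (auto simp: fib sum_fibres sum_measure_cylinder(1)[OF M] intro!: sum_nonneg)
  show ?thesis unfolding block_energy_eq
    using mult_left_mono[OF 1, of a] mult_left_mono[OF 2, of b] a b by (simp add: algebra_simps)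
qed

end

end

section \<open>Free energy as the rate of the block energy, and uniqueness of the equilibrium
  state\<close>

context weighted_word_potential
begin

text \<open>A word over \<open>c # u\<close> is a letter over \<open>c\<close> followed by a word
  over \<open>u\<close>; summing over \<open>c\<close> lets the first letter range over the whole
  alphabet upstairs.\<close>

lemma factor_invariant:
  assumes M: "M \<in> invariant_measures left_shift"
  shows "distr M borel (\<lambda>x i. p (x i)) \<in> invariant_measures left_shift"
proof -
  interpret prob_space M using M by (rule invariant_measures_prob_space)
  let ?\<mu> = "\<lambda>w. measure M (cylinder w)"
  have "(\<Sum>c\<in>UNIV. \<Sum>w\<in>fibre (c # u). ?\<mu> w) = (\<Sum>w\<in>fibre u. ?\<mu> w)" for u
  proof -
    have "(\<Sum>c\<in>UNIV. \<Sum>w\<in>fibre (c # u). ?\<mu> w) = (\<Sum>c\<in>UNIV. \<Sum>v\<in>fibre [c]. \<Sum>w\<in>fibre u. ?\<mu> (v @ w))"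
      using sum_fibre_append[of ?\<mu> "[_]" u] by simp
    also have "\<dots> = (\<Sum>v\<in>words (Suc 0). \<Sum>w\<in>fibre u. ?\<mu> (v @ w))"
      unfolding sum_fibres[symmetric] sum_words_1 ..
    also have "\<dots> = (\<Sum>w\<in>fibre u. ?\<mu> w)"
    proof (subst sum.swap, intro sum.cong refl)
      fix w :: "'a list"
      have "w \<in> words (length w)" by (simp add: words_def)
      then show "(\<Sum>v\<in>words (Suc 0). ?\<mu> (v @ w)) = ?\<mu> w" by (rule sum_measure_cylinder(3)[OF M])
    qed
    finally show ?thesis .
  qed
  then show ?thesis
    using prob_space_distr[OF factor_measurable[OF M]]
    by (simp add: invariant_measures_left_shift_iff factor_cylinder[OF M])
qed

context
  fixes \<Phi> :: "nat \<Rightarrow> (nat \<Rightarrow> 'a) \<Rightarrow> real"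
  assumes \<Phi>: "\<And>M. M \<in> invariant_measures left_shift \<Longrightarrow> (\<lambda>n. word_mean g M n / real n) \<longlonglongrightarrow> potential_mean \<Phi> M"
begin

text \<open>In the last bound the two entropies cost nothing, being infima of their normalised block
  values; only the mean of \<open>g\<close> costs \<open>c\<close>. Because \<open>a\<close> and
  \<open>b\<close> are nonnegative the bounds add up.\<close>

lemma weighted_free_energy_limit:
  assumes M: "M \<in> invariant_measures left_shift"
  shows "\<exists>e. weighted_free_energy left_shift left_shift (\<lambda>x i. p (x i)) a b \<Phi> M = ereal e \<and>
    (\<lambda>n. block_energy M n / real n) \<longlonglongrightarrow> e \<and> (\<forall>n\<ge>1. real n * e \<le> block_energy M n + c)"
proof -
  let ?N = "distr M borel (\<lambda>x i. p (x i))"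
  note N = factor_invariant[OF M]
  obtain h where h: "(\<lambda>n. word_entropy M n / real n) \<longlonglongrightarrow> h" "ks_entropy M left_shift = ereal h"
    using ks_entropy_left_shift[OF M] by blast
  obtain h' where h': "(\<lambda>n. word_entropy ?N n / real n) \<longlonglongrightarrow> h'" "ks_entropy ?N left_shift = ereal h'"
    using ks_entropy_left_shift[OF N] by blast
  obtain L where L: "(\<lambda>n. word_mean g M n / real n) \<longlonglongrightarrow> L" "\<forall>n\<ge>1. \<bar>real n * L - word_mean g M n\<bar> \<le> c"
    using word_mean_limit[OF M g_append] by blast
  have mean: "potential_mean \<Phi> M = L" using \<Phi>[OF M] L(1) by (rule LIMSEQ_unique)
  have "weighted_free_energy left_shift left_shift (\<lambda>x i. p (x i)) a b \<Phi> M = ereal (L + a * h + b * h')"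
    by (simp add: weighted_free_energy_def mean h h')
  moreover have "(\<lambda>n. block_energy M n / real n) \<longlonglongrightarrow> L + a * h + b * h'"
    using tendsto_add[OF tendsto_add[OF L(1) tendsto_mult_left[OF h(1), of a]] tendsto_mult_left[OF h'(1), of b]]
    by (simp add: block_energy_def add_divide_distrib)
  moreover have "real n * (L + a * h + b * h') \<le> block_energy M n + c" if n: "n \<ge> 1" for n
  proof -
    have "\<bar>real n * L - word_mean g M n\<bar> \<le> c" using L(2) n by blast
    then have "real n * L \<le> word_mean g M n + c" by linarith
    moreover have "a * (real n * h) \<le> a * word_entropy M n"
      using word_entropy_subadditive[OF M h(1) n] a by (intro mult_left_mono) auto
    moreover have "b * (real n * h') \<le> b * word_entropy ?N n"
      using word_entropy_subadditive[OF N h'(1) n] b by (intro mult_left_mono)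
    ultimately show ?thesis by (simp add: block_energy_def algebra_simps)
  qed
  ultimately show ?thesis by blast
qed

lemma weighted_free_energy_le:
  assumes M: "M \<in> invariant_measures left_shift"
  shows "weighted_free_energy left_shift left_shift (\<lambda>x i. p (x i)) a b \<Phi> M \<le> ereal pressure"
proof -
  obtain e where e: "weighted_free_energy left_shift left_shift (\<lambda>x i. p (x i)) a b \<Phi> M = ereal e"
      "(\<lambda>n. block_energy M n / real n) \<longlonglongrightarrow> e"
    using weighted_free_energy_limit[OF M] by blast
  have "e \<le> pressure"
    by (rule LIMSEQ_le[OF e(2) pressure_limit(1)])
      (auto intro!: divide_right_mono block_energy_le_partition[OF M])
  then show ?thesis by (simp add: e(1))
qed

lemma weighted_free_energy_gibbs:
  assumes M: "M \<in> invariant_measures left_shift"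
    and le: "\<And>w. measure M (cylinder w) \<le> C * weight w" and C: "C > 0"
  shows "weighted_free_energy left_shift left_shift (\<lambda>x i. p (x i)) a b \<Phi> M = ereal pressure"
proof -
  obtain e where e: "weighted_free_energy left_shift left_shift (\<lambda>x i. p (x i)) a b \<Phi> M = ereal e"
      "(\<lambda>n. block_energy M n / real n) \<longlonglongrightarrow> e"
    using weighted_free_energy_limit[OF M] by blast
  have "(\<lambda>n. (a + b) * log_partition n / real n - (a + b) * ln C / real n) \<longlonglongrightarrow> pressure - 0"
    by (intro tendsto_diff pressure_limit lim_const_over_n)
  moreover have "(a + b) * log_partition n / real n - (a + b) * ln C / real n \<le> block_energy M n / real n" for n
    using divide_right_mono[OF block_energy_ge[OF M le C, of n], of "real n"] by (simp add: diff_divide_distrib)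
  ultimately have "pressure \<le> e" using LIMSEQ_le[OF _ e(2)] by fastforce
  then show ?thesis using weighted_free_energy_le[OF M] by (simp add: e(1))
qed

lemma equilibrium_state_unique:
  "\<exists>m. gibbs_measure weight (exp (4 * c / a)) m ((exp (4 * c / a))\<^sup>2) \<and>
    (\<forall>\<mu>. weighted_equilibrium_state left_shift left_shift (\<lambda>x i. p (x i)) a b \<Phi> \<mu> \<longleftrightarrow> \<mu> = m) \<and>
    weighted_pressure left_shift left_shift (\<lambda>x i. p (x i)) a b \<Phi> = ereal pressure"
proof -
  let ?C = "(exp (4 * c / a))\<^sup>2"
  let ?E = "weighted_free_energy left_shift left_shift (\<lambda>x i. p (x i)) a b \<Phi>"
  obtain m where m: "m \<in> invariant_measures left_shift"
      "\<And>w. measure m (cylinder w) \<le> ?C * weight w" "\<And>w. weight w \<le> ?C * measure m (cylinder w)"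
    using invariant_measure_exists by blast
  interpret gibbs_measure weight "exp (4 * c / a)" m ?C
    using m by unfold_locales
  have E_m: "?E m = ereal pressure" using m by (intro weighted_free_energy_gibbs) auto
  have P: "weighted_pressure left_shift left_shift (\<lambda>x i. p (x i)) a b \<Phi> = ereal pressure"
    unfolding weighted_pressure_def
    by (intro antisym SUP_least weighted_free_energy_le) (auto intro: SUP_upper2[OF m(1)] simp: E_m)
  have "\<mu> = m" if \<mu>: "\<mu> \<in> invariant_measures left_shift" and E: "?E \<mu> = ereal pressure" for \<mu>
  proof (rule unique_if_absolutely_continuous[OF \<mu>])
    fix B :: "(nat \<Rightarrow> 'a) set" assume B: "B \<in> sets borel" "measure m B = 0"
    have e: "real n * pressure \<le> block_energy \<mu> n + c" if "n \<ge> 1" for n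
      using weighted_free_energy_limit[OF \<mu>] E that by auto
    define D where "D n = (\<Sum>w\<in>words n. measure \<mu> (cylinder w) * ln (measure \<mu> (cylinder w)))
        - (\<Sum>w\<in>words n. measure \<mu> (cylinder w) * ln (weight w))" for n
    \<comment> \<open>The loss is \<open>c\<close> in \<open>e\<close>, and
      \<open>(a + b) * (2 * c / a)\<close> for replacing \<open>n * pressure\<close> by
      \<open>(a + b) * log_partition n\<close>. The empty word is treated apart because both bounds
      speak of \<open>n \<ge> 1\<close>.\<close>
    have "D n \<le> ((a + b) * (2 * c / a) + c) / a" for n
    proof (cases "n = 0")
      case True
      have "measure \<mu> UNIV = 1"
        using sum_measure_cylinder(1)[OF \<mu>, of 0] by simp
      moreover have "weight [] = 1" using sum_words[of 0] by simp
      ultimately have "D n = 0" using True by (simp add: D_def)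
      then show ?thesis using a b c_nonneg by simp
    next
      case False
      then have n: "n \<ge> 1" by simp
      have "a * D n \<le> (a + b) * (2 * c / a) + c"
        using e[OF n] pressure_limit(2)[OF n] block_energy_le[OF \<mu>, of n] unfolding D_def[symmetric] by linarith
      then show ?thesis using a by (simp add: pos_le_divide_eq mult.commute)
    qed
    then show "measure \<mu> B = 0"
      unfolding D_def
      by (intro null_sets_if_entropy_bounded[OF invariant_measures_prob_space[OF \<mu>] invariant_measures_sets[OF \<mu>]
          prob_space_axioms sets_m pos sum_words m_ge _ B])
  qed
  then have "weighted_equilibrium_state left_shift left_shift (\<lambda>x i. p (x i)) a b \<Phi> \<mu> \<longleftrightarrow> \<mu> = m" for \<mu>
    using m(1) E_m unfolding weighted_equilibrium_state_def P by metis
  then show ?thesis using gibbs_measure_axioms P by blast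
qed

end

end

section \<open>Dependence on the parameter\<close>

text \<open>One constant bounds both the additivity defect of \<open>F\<close> and its distance from
  the potential. Measurability is recorded so that the integrals in \<open>potential_mean\<close>
  can be compared with word means.\<close>

definition word_approximation :: "(nat \<Rightarrow> (nat \<Rightarrow> 'a::{finite,discrete_topology}) \<Rightarrow> real) \<Rightarrow> ('a list \<Rightarrow> real) \<Rightarrow> real \<Rightarrow> bool" where
  "word_approximation \<Phi> F c \<longleftrightarrow> (\<forall>v w. \<bar>F (v @ w) - F v - F w\<bar> \<le> c) \<and>
    (\<forall>n\<ge>1. \<Phi> n \<in> borel_measurable borel \<and> (\<forall>x. \<bar>\<Phi> n x - F (prefix_word n x)\<bar> \<le> c))"

lemma word_approximation_exists:
  fixes \<Phi> :: "nat \<Rightarrow> (nat \<Rightarrow> 'a::{finite,discrete_topology}) \<Rightarrow> real"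
  assumes aa: "almost_additive left_shift \<Phi>" and bd: "bounded_distortion \<Phi>"
  shows "\<exists>F c. word_approximation \<Phi> F c"
proof -
  obtain c1 where c1: "c1 > 0" "\<And>x n m. n \<ge> 1 \<Longrightarrow> m \<ge> 1 \<Longrightarrow>
      inverse c1 * exp (\<Phi> n x) * exp (\<Phi> m ((left_shift ^^ n) x)) \<le> exp (\<Phi> (n + m) x) \<and>
      exp (\<Phi> (n + m) x) \<le> c1 * exp (\<Phi> n x) * exp (\<Phi> m ((left_shift ^^ n) x))"
    using aa unfolding almost_additive_def by blast
  obtain c2 where c2: "c2 > 0" "\<And>n x y. n \<ge> 1 \<Longrightarrow> (\<forall>i<n. x i = y i) \<Longrightarrow>
      inverse c2 * exp (\<Phi> n y) \<le> exp (\<Phi> n x) \<and> exp (\<Phi> n x) \<le> c2 * exp (\<Phi> n y)"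
    using bd unfolding bounded_distortion_def by blast
  have add: "\<bar>\<Phi> (n + m) x - \<Phi> n x - \<Phi> m ((left_shift ^^ n) x)\<bar> \<le> ln c1" if "n \<ge> 1" "m \<ge> 1" for n m x
  proof -
    have "exp (- ln c1 + \<Phi> n x + \<Phi> m ((left_shift ^^ n) x)) \<le> exp (\<Phi> (n + m) x)"
      "exp (\<Phi> (n + m) x) \<le> exp (ln c1 + \<Phi> n x + \<Phi> m ((left_shift ^^ n) x))"
      using c1(2)[OF that, of x] by (simp_all only: exp_add exp_minus exp_ln[OF c1(1)])
    then show ?thesis unfolding exp_le_cancel_iff by linarith
  qed
  have dist: "\<bar>\<Phi> n x - \<Phi> n y\<bar> \<le> ln c2" if "n \<ge> 1" "\<forall>i<n. x i = y i" for n x y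
  proof -
    have "exp (- ln c2 + \<Phi> n y) \<le> exp (\<Phi> n x)" "exp (\<Phi> n x) \<le> exp (ln c2 + \<Phi> n y)"
      using c2(2)[OF that] by (simp_all only: exp_add exp_minus exp_ln[OF c2(1)])
    then show ?thesis unfolding exp_le_cancel_iff by linarith
  qed
  have "ln c1 \<ge> 0" using add[of 1 1 undefined] by linarith
  moreover have "ln c2 \<ge> 0" using dist[of 1 undefined undefined] by simp
  ultimately have ln_nonneg: "ln c1 \<ge> 0" "ln c2 \<ge> 0" .
  \<comment> \<open>A word is evaluated at one fixed extension; the value 0 at the empty word
    replaces the unconstrained term \<open>\<Phi> 0\<close>. In \<open>c\<close>, one
    \<open>ln c1\<close> comes from almost additivity and two \<open>ln c2\<close> from moving the
    evaluation points of \<open>v\<close> and \<open>w\<close>.\<close>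
  define F where "F w = (if w = [] then 0 else \<Phi> (length w) (prepend w undefined))" for w :: "'a list"
  define c where "c = ln c1 + 2 * ln c2"
  have "\<bar>F (v @ w) - F v - F w\<bar> \<le> c" for v w
  proof (cases "v = [] \<or> w = []")
    case True
    then show ?thesis using ln_nonneg by (auto simp: F_def c_def)
  next
    case False
    let ?n = "length v" and ?m = "length w" and ?x = "prepend (v @ w) (undefined :: nat \<Rightarrow> 'a)"
    have nm: "?n \<ge> 1" "?m \<ge> 1" using False by (auto simp: Suc_le_eq)
    have "\<bar>\<Phi> (?n + ?m) ?x - \<Phi> ?n ?x - \<Phi> ?m ((left_shift ^^ ?n) ?x)\<bar> \<le> ln c1" by (rule add[OF nm])
    moreover have "\<bar>\<Phi> ?n ?x - F v\<bar> \<le> ln c2"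
      using False dist[OF nm(1), of ?x "prepend v undefined"] by (simp add: F_def prepend_def nth_append)
    moreover have "\<bar>\<Phi> ?m ((left_shift ^^ ?n) ?x) - F w\<bar> \<le> ln c2"
      using False dist[OF nm(2), of "(left_shift ^^ ?n) ?x" "prepend w undefined"]
      by (simp add: F_def prepend_def nth_append left_shift_funpow)
    moreover have "F (v @ w) = \<Phi> (?n + ?m) ?x" using False by (simp add: F_def)
    ultimately show ?thesis unfolding c_def by linarith
  qed
  moreover have "\<Phi> n \<in> borel_measurable borel" if "n \<ge> 1" for n
  proof -
    have "(\<lambda>x. exp (\<Phi> n x)) \<in> borel_measurable borel"
      using aa that unfolding almost_additive_def by (intro borel_measurable_continuous_onI) auto
    from borel_measurable_ln[OF this] show ?thesis by simp
  qed
  moreover have "\<bar>\<Phi> n x - F (prefix_word n x)\<bar> \<le> c" if n: "n \<ge> 1" for n x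
  proof -
    have "prefix_word n x \<noteq> []" using n by (metis length_prefix_word list.size(3) not_one_le_zero)
    moreover have "\<bar>\<Phi> n x - \<Phi> n (prepend (prefix_word n x) undefined)\<bar> \<le> ln c2"
      using n by (intro dist) (auto simp: prepend_def)
    ultimately show ?thesis using ln_nonneg by (simp add: F_def c_def)
  qed
  ultimately show ?thesis unfolding word_approximation_def by blast
qed

text \<open>The integral of \<open>\<Phi> n\<close> and the word mean of \<open>F\<close> differ by
  at most \<open>c\<close>, which vanishes after division by \<open>n\<close>. So the
  \<open>lim\<close> in \<open>potential_mean\<close> is a genuine limit.\<close>

lemma potential_mean_limit:
  fixes M :: "(nat \<Rightarrow> 'a::{finite,discrete_topology}) measure"
  assumes M: "M \<in> invariant_measures left_shift" and wa: "word_approximation \<Phi> F c"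
  shows "(\<lambda>n. word_mean F M n / real n) \<longlonglongrightarrow> potential_mean \<Phi> M"
proof -
  interpret prob_space M using M by (rule invariant_measures_prob_space)
  note sets = invariant_measures_sets[OF M] and space = invariant_measures_space[OF M]
  have F: "\<bar>F (v @ w) - F v - F w\<bar> \<le> c" for v w using wa by (auto simp: word_approximation_def)
  obtain L where L: "(\<lambda>n. word_mean F M n / real n) \<longlonglongrightarrow> L"
    using word_mean_limit[OF M F] by blast
  have bound: "\<bar>(\<integral>x. \<Phi> n x \<partial>M) - word_mean F M n\<bar> \<le> c" if n: "n \<ge> 1" for n
  proof -
    have dist: "\<bar>\<Phi> n x - F (prefix_word n x)\<bar> \<le> c" for x using wa n by (auto simp: word_approximation_def)
    have meas: "\<Phi> n \<in> borel_measurable M"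
      using wa n measurable_cong_sets[OF sets refl] unfolding word_approximation_def by blast
    have step: "F (prefix_word n x) = (\<Sum>w\<in>words n. F w * indicator (cylinder w) x)" for x
    proof -
      have "(\<Sum>w\<in>words n. F w * indicator (cylinder w) x) = (\<Sum>w\<in>words n. if w = prefix_word n x then F w else 0)"
        by (intro sum.cong refl) (auto simp: indicator_def mem_cylinder_iff)
      then show ?thesis by simp
    qed
    have int: "integrable M (\<lambda>x. F w * indicator (cylinder w) x)" for w
      by (intro integrable_mult_right integrable_real_indicator) (simp_all add: sets emeasure_eq_measure)
    have int_F: "integrable M (\<lambda>x. F (prefix_word n x))"
      unfolding step by (intro Bochner_Integration.integrable_sum int)
    have "(\<integral>x. F (prefix_word n x) \<partial>M) = (\<Sum>w\<in>words n. \<integral>x. F w * indicator (cylinder w) x \<partial>M)"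
      unfolding step by (intro Bochner_Integration.integral_sum int)
    also have "\<dots> = word_mean F M n"
      unfolding word_mean_def by (intro sum.cong refl) (simp add: space)
    finally have integral_F: "(\<integral>x. F (prefix_word n x) \<partial>M) = word_mean F M n" .
    have "integrable M (\<Phi> n)"
    proof (rule integrable_const_bound)
      show "AE x in M. norm (\<Phi> n x) \<le> c + (\<Sum>w\<in>words n. \<bar>F w\<bar>)"
      proof (rule AE_I2)
        fix x
        have "\<bar>F (prefix_word n x)\<bar> \<le> (\<Sum>w\<in>words n. \<bar>F w\<bar>)" by (rule member_le_sum) auto
        then show "norm (\<Phi> n x) \<le> c + (\<Sum>w\<in>words n. \<bar>F w\<bar>)" using dist[of x] by simp
      qed
    qed (rule meas)
    then have "(\<integral>x. \<Phi> n x \<partial>M) - word_mean F M n = (\<integral>x. \<Phi> n x - F (prefix_word n x) \<partial>M)"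
      using int_F integral_F by simp
    also have "\<bar>\<dots>\<bar> \<le> (\<integral>x. \<bar>\<Phi> n x - F (prefix_word n x)\<bar> \<partial>M)" by (rule integral_abs_bound)
    also have "\<dots> \<le> (\<integral>x. c \<partial>M)"
      using dist \<open>integrable M (\<Phi> n)\<close> int_F by (intro integral_mono) auto
    finally show ?thesis by (simp add: prob_space)
  qed
  have "(\<lambda>n. (\<integral>x. \<Phi> n x \<partial>M) / real n - word_mean F M n / real n) \<longlonglongrightarrow> 0"
  proof (rule Lim_null_comparison)
    show "\<forall>\<^sub>F n in sequentially. norm ((\<integral>x. \<Phi> n x \<partial>M) / real n - word_mean F M n / real n) \<le> c / real n"
      unfolding eventually_sequentially
    proof (intro exI[of _ 1] allI impI)
      fix n :: nat assume "n \<ge> 1"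
      then show "norm ((\<integral>x. \<Phi> n x \<partial>M) / real n - word_mean F M n / real n) \<le> c / real n"
        using divide_right_mono[OF bound, of n "real n"] by (simp flip: diff_divide_distrib)
    qed
  qed (rule lim_const_over_n)
  from tendsto_add[OF this L] have "(\<lambda>n. (\<integral>x. \<Phi> n x \<partial>M) / real n) \<longlonglongrightarrow> L" by simp
  then have "potential_mean \<Phi> M = L" unfolding potential_mean_def by (rule limI)
  then show ?thesis using L by simp
qed

text \<open>The subgradient inequalities at \<open>x\<close> and at \<open>x + h\<close> trap the
  remainder between 0 and \<open>h \<bullet> (v (x + h) - v x)\<close>, which is
  \<open>o(norm h)\<close> by continuity of \<open>v\<close> at \<open>x\<close>.\<close>

lemma gderiv_of_subgradient:
  fixes Q :: "'v::euclidean_space \<Rightarrow> real"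
  assumes sub: "\<And>x y. (y - x) \<bullet> v x \<le> Q y - Q x" and cont: "isCont v x"
  shows "GDERIV Q x :> v x"
  unfolding gderiv_def has_derivative_at
proof (intro conjI bounded_linear_inner_left)
  have "(\<lambda>h. v (x + h)) \<midarrow>0\<rightarrow> v x" using cont by (simp add: isCont_def LIM_offset_zero_iff add.commute)
  then have "(\<lambda>h. norm (v (x + h) - v x)) \<midarrow>0\<rightarrow> 0" by (simp add: tendsto_norm_zero_iff LIM_zero_iff)
  then show "(\<lambda>h. norm (Q (x + h) - Q x - h \<bullet> v x) / norm h) \<midarrow>0\<rightarrow> 0"
  proof (rule Lim_null_comparison[rotated], intro always_eventually allI)
    fix h
    have "h \<bullet> v x \<le> Q (x + h) - Q x" using sub[of "x + h" x] by simp
    moreover have "Q (x + h) - Q x \<le> h \<bullet> v (x + h)" using sub[of x "x + h"] by simp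
    ultimately have "norm (Q (x + h) - Q x - h \<bullet> v x) \<le> h \<bullet> (v (x + h) - v x)"
      by (simp add: inner_diff_right)
    also have "\<dots> \<le> norm h * norm (v (x + h) - v x)" by (rule norm_cauchy_schwarz)
    finally show "norm (norm (Q (x + h) - Q x - h \<bullet> v x) / norm h) \<le> norm (v (x + h) - v x)"
      by (cases "h = 0") (auto simp: divide_le_eq mult.commute)
  qed
qed

lemma LIMSEQ_if_subseq:
  fixes f :: "nat \<Rightarrow> 'v::metric_space"
  assumes sub: "\<And>r :: nat \<Rightarrow> nat. strict_mono r \<Longrightarrow> \<exists>s. strict_mono (s :: nat \<Rightarrow> nat) \<and> (\<lambda>k. f (r (s k))) \<longlonglongrightarrow> l"
  shows "f \<longlonglongrightarrow> l"
proof (rule ccontr)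
  assume "\<not> f \<longlonglongrightarrow> l"
  then obtain e where e: "e > 0" "\<not> (\<forall>\<^sub>F n in sequentially. dist (f n) l < e)" by (auto simp: tendsto_iff)
  then have "infinite {n. \<not> dist (f n) l < e}"
    by (simp add: frequently_cofinite[symmetric] not_eventually cofinite_eq_sequentially)
  then obtain r where r: "strict_mono (r :: nat \<Rightarrow> nat)" "\<And>n. \<not> dist (f (r n)) l < e"
    using infinite_enumerate by blast
  obtain s where s: "(\<lambda>k. f (r (s k))) \<longlonglongrightarrow> l" using sub[OF r(1)] by blast
  have "\<forall>\<^sub>F k in sequentially. dist (f (r (s k))) l < e" using tendstoD[OF s e(1)] .
  then show False using r(2) by simp
qed

text \<open>The mean is within \<open>c / n\<close> of a word mean of length \<open>n\<close>,
  uniformly in the measure, and a word mean is a finite combination of cylinder masses.\<close>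

lemma potential_mean_weakly_continuous:
  fixes M :: "nat \<Rightarrow> (nat \<Rightarrow> 'a::{finite,discrete_topology}) measure"
  assumes M: "\<And>k. M k \<in> invariant_measures left_shift" and N: "N \<in> invariant_measures left_shift"
    and lim: "\<And>w. (\<lambda>k. measure (M k) (cylinder w)) \<longlonglongrightarrow> measure N (cylinder w)"
    and wa: "word_approximation \<Phi> F c"
  shows "(\<lambda>k. potential_mean \<Phi> (M k)) \<longlonglongrightarrow> potential_mean \<Phi> N"
proof (rule tendstoI)
  fix e :: real assume e: "e > 0"
  have F: "\<bar>F (v @ w) - F v - F w\<bar> \<le> c" for v w using wa by (auto simp: word_approximation_def)
  have close: "\<bar>potential_mean \<Phi> L - word_mean F L n / real n\<bar> \<le> c / real n"
    if L: "L \<in> invariant_measures left_shift" and n: "n \<ge> 1" for L n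
  proof -
    obtain l where l: "(\<lambda>n. word_mean F L n / real n) \<longlonglongrightarrow> l" "\<forall>n\<ge>1. \<bar>real n * l - word_mean F L n\<bar> \<le> c"
      using word_mean_limit[OF L F] by blast
    have "l = potential_mean \<Phi> L" using l(1) potential_mean_limit[OF L wa] by (rule LIMSEQ_unique)
    then have "\<bar>real n * potential_mean \<Phi> L - word_mean F L n\<bar> / real n \<le> c / real n"
      using l(2) n by (intro divide_right_mono) auto
    also have "\<bar>real n * potential_mean \<Phi> L - word_mean F L n\<bar> / real n = \<bar>(real n * potential_mean \<Phi> L - word_mean F L n) / real n\<bar>"
      by simp
    also have "(real n * potential_mean \<Phi> L - word_mean F L n) / real n = potential_mean \<Phi> L - word_mean F L n / real n"
      using n by (simp add: diff_divide_distrib)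
    finally show ?thesis .
  qed
  have "\<forall>\<^sub>F n in sequentially. c / real n < e / 3"
    using e by (intro order_tendstoD[OF lim_const_over_n]) auto
  then have "\<forall>\<^sub>F n in sequentially. c / real n < e / 3 \<and> n \<ge> 1"
    using eventually_ge_at_top by (rule eventually_conj)
  then obtain n where n: "c / real n < e / 3" "n \<ge> 1"
    using eventually_happens'[OF sequentially_bot] by blast
  have "(\<lambda>k. word_mean F (M k) n / real n) \<longlonglongrightarrow> word_mean F N n / real n"
    unfolding word_mean_def using n by (intro tendsto_divide tendsto_sum tendsto_mult lim tendsto_const) auto
  then have "\<forall>\<^sub>F k in sequentially. dist (word_mean F (M k) n / real n) (word_mean F N n / real n) < e / 3"
    using e by (intro tendstoD) auto
  then show "\<forall>\<^sub>F k in sequentially. dist (potential_mean \<Phi> (M k)) (potential_mean \<Phi> N) < e"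
  proof eventually_elim
    case (elim k)
    then show ?case
      using close[OF M n(2), of k] close[OF N n(2)] n(1) unfolding dist_real_def by linarith
  qed
qed

text \<open>The weight of a fixed word involves finitely many words and logarithms of positive sums,
  so pointwise convergence of the word functions carries over.\<close>

lemma weight_continuous:
  fixes p :: "'a::{finite,discrete_topology} \<Rightarrow> 'b::{finite,discrete_topology}"
  assumes loc: "\<And>k. weighted_word_potential a b (c k) (g k)" "weighted_word_potential a b c' g'"
    and lim: "\<And>w. (\<lambda>k. g k w) \<longlonglongrightarrow> g' w"
  shows "(\<lambda>k. weighted_word_potential.weight p a b (g k) w) \<longlonglongrightarrow> weighted_word_potential.weight p a b g' w"
proof -
  interpret W: weighted_word_potential p a b c' g' by (rule loc(2))
  have a: "a \<noteq> 0" using W.a by simp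
  have log_fibre: "(\<lambda>k. weighted_word_potential.log_fibre p a (g k) w) \<longlonglongrightarrow> W.log_fibre w" for w
  proof -
    have "(\<Sum>v\<in>W.fibre (map p w). exp (g' v / a)) > 0" by (intro sum_pos) simp_all
    then have "(\<Sum>v\<in>W.fibre (map p w). exp (g' v / a)) \<noteq> 0" by simp
    then show ?thesis
      unfolding weighted_word_potential.log_fibre_def[OF loc(1)] W.log_fibre_def
      by (intro tendsto_ln tendsto_sum tendsto_exp tendsto_divide lim tendsto_const a)
  qed
  have score: "(\<lambda>k. weighted_word_potential.score p a b (g k) w) \<longlonglongrightarrow> W.score w" for w
    unfolding weighted_word_potential.score_def[OF loc(1)] W.score_def
    by (intro tendsto_diff tendsto_mult tendsto_divide log_fibre lim tendsto_const a)
  have "(\<lambda>k. weighted_word_potential.log_partition p a b (g k) n) \<longlonglongrightarrow> W.log_partition n" for n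
  proof -
    have "(\<Sum>w\<in>words n. exp (W.score w)) > 0" by (intro sum_pos) (simp_all add: W.words_nonempty)
    then have "(\<Sum>w\<in>words n. exp (W.score w)) \<noteq> 0" by simp
    then show ?thesis
      unfolding weighted_word_potential.log_partition_def[OF loc(1)] W.log_partition_def
      by (intro tendsto_ln tendsto_sum tendsto_exp score)
  qed
  then show ?thesis
    unfolding weighted_word_potential.weight_def[OF loc(1)] W.weight_def
    by (intro tendsto_exp tendsto_diff score)
qed

lemma word_approximation_linear_combination:
  fixes \<Phi> :: "'d::finite \<Rightarrow> nat \<Rightarrow> (nat \<Rightarrow> 'a::{finite,discrete_topology}) \<Rightarrow> real"
  assumes "\<And>i. word_approximation (\<Phi> i) (F i) (c i)"
  shows "word_approximation (linear_combination q \<Phi>) (\<lambda>w. \<Sum>i\<in>UNIV. q $ i * F i w) (\<Sum>i\<in>UNIV. \<bar>q $ i\<bar> * c i)"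
proof -
  have bound: "\<bar>\<Sum>i\<in>UNIV. q $ i * x i\<bar> \<le> (\<Sum>i\<in>UNIV. \<bar>q $ i\<bar> * c i)" if "\<And>i. \<bar>x i\<bar> \<le> c i" for x
  proof -
    have "\<bar>\<Sum>i\<in>UNIV. q $ i * x i\<bar> \<le> (\<Sum>i\<in>UNIV. \<bar>q $ i * x i\<bar>)" by (rule sum_abs)
    also have "\<dots> \<le> (\<Sum>i\<in>UNIV. \<bar>q $ i\<bar> * c i)"
      unfolding abs_mult using that by (intro sum_mono mult_left_mono) auto
    finally show ?thesis .
  qed
  have "\<bar>(\<Sum>i\<in>UNIV. q $ i * F i (v @ w)) - (\<Sum>i\<in>UNIV. q $ i * F i v) - (\<Sum>i\<in>UNIV. q $ i * F i w)\<bar> \<le> (\<Sum>i\<in>UNIV. \<bar>q $ i\<bar> * c i)" for v w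
    using bound[of "\<lambda>i. F i (v @ w) - F i v - F i w"] assms
    by (simp add: word_approximation_def right_diff_distrib sum_subtractf)
  moreover have "\<bar>linear_combination q \<Phi> n x - (\<Sum>i\<in>UNIV. q $ i * F i (prefix_word n x))\<bar> \<le> (\<Sum>i\<in>UNIV. \<bar>q $ i\<bar> * c i)"
    if "n \<ge> 1" for n x
    using bound[of "\<lambda>i. \<Phi> i n x - F i (prefix_word n x)"] assms that
    by (simp add: word_approximation_def linear_combination_def right_diff_distrib sum_subtractf)
  moreover have "linear_combination q \<Phi> n \<in> borel_measurable borel" if "n \<ge> 1" for n
    unfolding linear_combination_def using assms that
    by (intro borel_measurable_sum borel_measurable_times borel_measurable_const) (auto simp: word_approximation_def)
  ultimately show ?thesis unfolding word_approximation_def by blast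
qed

lemma potential_mean_linear_combination:
  fixes \<Phi> :: "'d::finite \<Rightarrow> nat \<Rightarrow> (nat \<Rightarrow> 'a::{finite,discrete_topology}) \<Rightarrow> real"
  assumes M: "M \<in> invariant_measures left_shift" and wa: "\<And>i. word_approximation (\<Phi> i) (F i) (c i)"
  shows "potential_mean (linear_combination q \<Phi>) M = q \<bullet> (\<chi> i. potential_mean (\<Phi> i) M)"
proof -
  let ?g = "\<lambda>w. \<Sum>i\<in>UNIV. q $ i * F i w"
  have "word_mean ?g M n / real n = (\<Sum>i\<in>UNIV. q $ i * (word_mean (F i) M n / real n))" for n
    by (simp add: word_mean_def sum_distrib_left sum_divide_distrib sum.swap[of _ "words n" UNIV] mult_ac)
  moreover have "(\<lambda>n. \<Sum>i\<in>UNIV. q $ i * (word_mean (F i) M n / real n)) \<longlonglongrightarrow> (\<Sum>i\<in>UNIV. q $ i * potential_mean (\<Phi> i) M)"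
    by (intro tendsto_sum tendsto_mult tendsto_const potential_mean_limit[OF M wa])
  ultimately have "(\<lambda>n. word_mean ?g M n / real n) \<longlonglongrightarrow> (\<Sum>i\<in>UNIV. q $ i * potential_mean (\<Phi> i) M)" by simp
  then have "potential_mean (linear_combination q \<Phi>) M = (\<Sum>i\<in>UNIV. q $ i * potential_mean (\<Phi> i) M)"
    by (rule LIMSEQ_unique[OF potential_mean_limit[OF M word_approximation_linear_combination[OF wa]]])
  then show ?thesis by (simp add: inner_vec_def)
qed

theorem theorem1p3:
  fixes \<pi> :: "(nat \<Rightarrow> 'a::{finite,discrete_topology}) \<Rightarrow> (nat \<Rightarrow> 'b::{finite,discrete_topology})"
    and a b :: real
    and \<Phi> :: "'d::finite \<Rightarrow> nat \<Rightarrow> (nat \<Rightarrow> 'a) \<Rightarrow> real"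
  assumes "one_block_factor_map \<pi>"
    and "a > 0" and "b \<ge> 0"
    and "\<And>i. almost_additive left_shift (\<Phi> i)"
    and "\<And>i. bounded_distortion (\<Phi> i)"
  defines "P \<equiv> \<lambda>q :: real ^ 'd. weighted_pressure left_shift left_shift \<pi> a b (linear_combination q \<Phi>)"
    and "E \<equiv> \<lambda>q :: real ^ 'd. weighted_equilibrium_state left_shift left_shift \<pi> a b (linear_combination q \<Phi>)"
  shows "(\<forall>q. \<bar>P q\<bar> \<noteq> \<infinity>) \<and>
    (\<forall>q. \<exists>!\<mu>. E q \<mu>) \<and>
    (\<forall>q. GDERIV (\<lambda>q. real_of_ereal (P q)) q :> (\<chi> i. potential_mean (\<Phi> i) (THE \<mu>. E q \<mu>))) \<and>
    continuous_on UNIV (\<lambda>q. \<chi> i. potential_mean (\<Phi> i) (THE \<mu>. E q \<mu>))"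
proof -
  obtain p where "\<And>x n. \<pi> x n = p (x n)" using assms(1) unfolding one_block_factor_map_def by blast
  then have \<pi>: "\<pi> = (\<lambda>x i. p (x i))" by auto
  have "\<forall>i. \<exists>F c. word_approximation (\<Phi> i) F c"
    using word_approximation_exists assms(4,5) by blast
  then obtain F c where wa: "\<And>i. word_approximation (\<Phi> i) (F i) (c i)" by metis
  define g where "g q w = (\<Sum>i\<in>UNIV. q $ i * F i w)" for q :: "real ^ 'd" and w
  \<comment> \<open>These constants are explicit and continuous in \<open>q\<close>, so the Gibbs
    bounds survive a limit in the parameter.\<close>
  define C where "C q = (\<Sum>i\<in>UNIV. \<bar>q $ i\<bar> * c i)" for q :: "real ^ 'd"
  define K where "K q = exp (4 * C q / a)" for q
  let ?Q = "\<lambda>q. weighted_word_potential.pressure p a b (g q)"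
  let ?w = "\<lambda>q. weighted_word_potential.weight p a b (g q)"
  have wa_g: "word_approximation (linear_combination q \<Phi>) (g q) (C q)" for q
    using word_approximation_linear_combination[OF wa, of q] unfolding g_def C_def .
  have loc: "weighted_word_potential a b (C q) (g q)" for q
    using wa_g[of q] assms(2,3) by unfold_locales (auto simp: word_approximation_def)
  have "\<exists>m. gibbs_measure (?w q) (K q) m ((K q)\<^sup>2) \<and> (\<forall>\<mu>. E q \<mu> \<longleftrightarrow> \<mu> = m) \<and> P q = ereal (?Q q)" for q
    unfolding E_def P_def \<pi> K_def
    by (rule weighted_word_potential.equilibrium_state_unique[OF loc]) (rule potential_mean_limit[OF _ wa_g])
  then obtain m where gibbs: "\<And>q. gibbs_measure (?w q) (K q) (m q) ((K q)\<^sup>2)"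
    and E: "\<And>q \<mu>. E q \<mu> \<longleftrightarrow> \<mu> = m q" and P: "\<And>q. P q = ereal (?Q q)" by metis
  have the_m: "(THE \<mu>. E q \<mu>) = m q" for q unfolding E by simp
  have inv: "m q \<in> invariant_measures left_shift" for q by (rule gibbs_measure.m_inv[OF gibbs])
  define v where "v q = (\<chi> i. potential_mean (\<Phi> i) (m q))" for q
  \<comment> \<open>For a fixed measure the free energy is affine in \<open>q\<close>. The one of
    \<open>m x\<close> has slope \<open>v x\<close>, touches the pressure at \<open>x\<close> and
    lies below it everywhere.\<close>
  have sub: "(y - x) \<bullet> v x \<le> ?Q y - ?Q x" for x y
  proof -
    obtain h where h: "ks_entropy (m x) left_shift = ereal h"
      using ks_entropy_left_shift[OF inv] by blast
    obtain h' where h': "ks_entropy (distr (m x) borel \<pi>) left_shift = ereal h'"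
      using ks_entropy_left_shift[OF weighted_word_potential.factor_invariant[OF loc inv]] unfolding \<pi> by blast
    have energy: "weighted_free_energy left_shift left_shift \<pi> a b (linear_combination q \<Phi>) (m x) = ereal (q \<bullet> v x + a * h + b * h')" for q
      by (simp add: weighted_free_energy_def h h' potential_mean_linear_combination[OF inv wa] v_def)
    have "ereal (x \<bullet> v x + a * h + b * h') = ereal (?Q x)"
      using E[of x "m x"] unfolding E_def weighted_equilibrium_state_def energy P[symmetric] P_def by simp
    moreover have "ereal (y \<bullet> v x + a * h + b * h') \<le> ereal (?Q y)"
      unfolding energy[symmetric] P[symmetric] P_def weighted_pressure_def by (intro SUP_upper inv)
    ultimately show ?thesis by (simp add: inner_diff_left)
  qed
  have cont: "isCont v q" for q
    unfolding continuous_at_sequentially o_def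
  proof (intro allI impI LIMSEQ_if_subseq)
    fix X :: "nat \<Rightarrow> real ^ 'd" and r :: "nat \<Rightarrow> nat"
    assume X: "X \<longlonglongrightarrow> q" and r: "strict_mono r"
    have prob: "prob_space (m x)" "sets (m x) = sets borel" for x
      using inv invariant_measures_prob_space invariant_measures_sets by blast+
    \<comment> \<open>Any subsequence of equilibrium states has a weakly convergent further one; it
      remains to identify its limit \<open>N\<close>.\<close>
    obtain N s where N: "prob_space N" "sets N = sets borel" and s: "strict_mono (s :: nat \<Rightarrow> nat)"
      and lim: "\<And>w. (\<lambda>k. measure (m (X (r (s k)))) (cylinder w)) \<longlonglongrightarrow> measure N (cylinder w)"
      using prob_space_shift_weak_compact[of "\<lambda>k. m (X (r k))"] prob by blast
    have N_inv: "N \<in> invariant_measures left_shift"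
      by (rule invariant_measures_weak_limit[OF inv N lim])
    have Xrs: "(\<lambda>k. X (r (s k))) \<longlonglongrightarrow> q"
      using LIMSEQ_subseq_LIMSEQ[OF LIMSEQ_subseq_LIMSEQ[OF X r] s] by (simp add: o_def)
    have "N = m q"
    proof (rule gibbs_measure.unique_if_absolutely_continuous[OF gibbs N_inv])
      have K: "(\<lambda>k. (K (X (r (s k))))\<^sup>2) \<longlonglongrightarrow> (K q)\<^sup>2"
        unfolding K_def C_def using assms(2)
        by (intro tendsto_power tendsto_exp tendsto_divide tendsto_mult tendsto_sum tendsto_rabs tendsto_vec_nth Xrs tendsto_const) auto
      have w: "(\<lambda>k. ?w (X (r (s k))) w) \<longlonglongrightarrow> ?w q w" for w
        by (rule weight_continuous[OF loc loc])
          (unfold g_def, intro tendsto_sum tendsto_mult tendsto_vec_nth Xrs tendsto_const)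
      \<comment> \<open>The upper Gibbs bounds along the sequence converge to an upper bound by the
        weight at \<open>q\<close>, which the lower Gibbs bound of \<open>m q\<close> turns into a
        comparison of measures; hence two factors \<open>(K q)\<^sup>2\<close>.\<close>
      have le: "measure N (cylinder w) \<le> (K q)\<^sup>2 * (K q)\<^sup>2 * measure (m q) (cylinder w)" for w
      proof -
        have "measure N (cylinder w) \<le> (K q)\<^sup>2 * ?w q w"
          by (rule LIMSEQ_le[OF lim tendsto_mult[OF K w]]) (auto intro: gibbs_measure.m_le[OF gibbs])
        also have "\<dots> \<le> (K q)\<^sup>2 * ((K q)\<^sup>2 * measure (m q) (cylinder w))"
          by (intro mult_left_mono gibbs_measure.m_ge[OF gibbs]) simp
        finally show ?thesis by simp
      qed
      fix B :: "(nat \<Rightarrow> 'a) set" assume B: "B \<in> sets borel" "measure (m q) B = 0"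
      have "measure N B \<le> (K q)\<^sup>2 * (K q)\<^sup>2 * measure (m q) B"
        by (rule measure_le_if_cylinder_le[OF prob_space.finite_measure[OF N(1)]
              prob_space.finite_measure[OF prob(1)] N(2) prob(2) le B(1)])
      then show "measure N B = 0" using B(2) by (simp add: measure_le_0_iff)
    qed
    then have "(\<lambda>k. potential_mean (\<Phi> i) (m (X (r (s k))))) \<longlonglongrightarrow> potential_mean (\<Phi> i) (m q)" for i
      using potential_mean_weakly_continuous[OF inv N_inv lim wa] by simp
    then have "(\<lambda>k. v (X (r (s k)))) \<longlonglongrightarrow> v q"
      unfolding v_def by (intro vec_tendstoI) simp
    then show "\<exists>s. strict_mono s \<and> (\<lambda>k. v (X (r (s k)))) \<longlonglongrightarrow> v q" using s by blast
  qed
  have "GDERIV ?Q q :> v q" for q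
    using sub cont by (rule gderiv_of_subgradient)
  moreover have "continuous_on UNIV v"
    using cont by (simp add: continuous_on_eq_continuous_at)
  ultimately show ?thesis
    unfolding the_m P E v_def[abs_def] by auto
qed

end
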